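(* Let $(h_j)_j$ be positive numbers with $h_j=o(2^{-2j})$ as $j\to\infty$. Let $\Phi=\{\psi_\lambda\}_\lambda$ be the 2D Meyer Parseval wavelet system of $L^2(\mathbb{R}^2)$, let $f_j=P_{\mathbb{R}^2\setminus\mathcal{M}_{h_j}}\,w\mathcal{L}_j$, and let $L_j$ be a solution of $$L_j=\operatorname{argmin}_{L\in L^2(\mathbb{R}^2)}\ \|\Phi^\ast L\|_1\quad\text{subject to}\quad f_j=P_{\mathbb{R}^2\setminus\mathcal{M}_{h_j}}L .$$ Then $$\frac{\|L_j-w\mathcal{L}_j\|_2}{\|w\mathcal{L}_j\|_2}\to 0,\qquad j\to\infty .$$
   Context: Fourier transform: $\hat f(\xi)=\int f(x)e^{-2\pi i\langle x,\xi\rangle}dx$; $\check f$ (or $f^\vee$) is the inverse transform. Meyer functions. Fix $\nu\in C^\infty(\mathbb{R})$ with $\nu(x)+\nu(1-x)=1$ for all $x$, $\nu(x)=0$ for $x\le 0$, $\nu(x)=1$ for $x\ge1$. Let $W(\xi)=e^{-16\pi i\xi/3}\sin[\frac{\pi}{2}\nu(16|\xi|-1)]$ for $\frac1{16}\le|\xi|\le\frac18$, $W(\xi)=e^{-16\pi i\xi/3}\cos[\frac{\pi}{2}\nu(8|\xi|-1)]$ for $\frac18\le|\xi|\le\frac14$, $W(\xi)=0$ otherwise; and $\hat\phi(\xi)=1$ for $|\xi|\le\frac1{16}$, $\hat\phi(\xi)=\cos[\frac{\pi}{2}\nu(16|\xi|-1)]$ for $\frac1{16}\le|\xi|\le\frac18$,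 $\hat\phi(\xi)=0$ otherwise. For $\xi=(\xi_1,\xi_2)$ set $W^v(\xi)=\hat\phi(\xi_1)W(\xi_2)$, $W^h(\xi)=W(\xi_1)\hat\phi(\xi_2)$, $W^d(\xi)=W(\xi_1)W(\xi_2)$. Meyer Parseval system: $\{\psi_\lambda:\lambda=(\iota,j,k),\ \iota\in\{h,v,d\},\ j\in\mathbb{Z},\ k\in\mathbb{Z}^2\}$ with $\hat\psi_\lambda(\xi)=2^{-j}W^\iota(\xi/2^j)e^{-2\pi i\langle k,\xi/2^j\rangle}$. It is a Parseval frame: $\sum_\lambda|\langle x,\psi_\lambda\rangle|^2=\|x\|^2$. $\Phi^\ast x=(\langle x,\psi_\lambda\rangle)_\lambda$ is the analysis operator. Image model. $\rho>0$, and $w:\mathbb{R}\to[0,1]$ is a smooth function supported in $[-\rho,\rho]$, not identically zero. $w\mathcal{L}$ is the tempered distribution on $\mathbb{R}^2$ given on Schwartz functions by $\langle w\mathcal{L},g\rangle=\int_{-\rho}^\rho w(x_1)g(x_1,0)\,dx_1$. Let $F_j(\xi)=\sum_{\iota\in\{h,v,d\}}\big(W^\iota(2^{-2j}\xi)+W^\iota(2^{-2j-1}\xi)\big)$ and $w\mathcal{L}_j=w\mathcal{L}\star\check F_j$, i.e. $\widehat{w\mathcal{L}_j}(\xi)=\hat w(\xi_1)F_j(\xi)$. Mask. $\mathcal{M}_h=\mathbb{1}_{\{|x_1|\le h\}}$; $P_{\mathbb{R}^2\setminus\mathcal{M}_h}$ is the orthogonal projection of $L^2(\mathbb{R}^2)$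 given by multiplication with $1-\mathcal{M}_h$. Standing assumption: $\rho$ is sufficiently large, in particular much larger than $h_j$ (so $h_j<\rho$). *)

theory Defs
  imports "HOL-Analysis.Analysis" "HOL-Library.Landau_Symbols"
begin

definition smooth :: "(real \<Rightarrow> real) \<Rightarrow> bool" where
  "smooth f \<longleftrightarrow> (\<forall>n. (deriv ^^ n) f differentiable_on UNIV)"


subsection \<open>Functions on the plane\<close>

text \<open>Elements of \<open>L\<^sup>2(\<real>\<^sup>2)\<close> are represented by Borel functions; equality in
  \<open>L\<^sup>2\<close> is equality almost everywhere.\<close>

definition L2_space :: "(real \<times> real \<Rightarrow> complex) set" where
  "L2_space = {f. f \<in> borel_measurable lborel \<and> integrable lborel (\<lambda>x. (cmod (f x))\<^sup>2)}"

definition L2_norm :: "(real \<times> real \<Rightarrow> complex) \<Rightarrow> real" where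
  "L2_norm f = sqrt (LINT x|lborel. (cmod (f x))\<^sup>2)"

definition L2_inner :: "(real \<times> real \<Rightarrow> complex) \<Rightarrow> (real \<times> real \<Rightarrow> complex) \<Rightarrow> complex" where
  "L2_inner f g = (LINT x|lborel. f x * cnj (g x))"

text \<open>The inverse of \<open>f \<mapsto> (\<lambda>\<xi>. \<integral> f x * exp (- 2 \<pi> \<i> \<langle>x, \<xi>\<rangle>) dx)\<close>, as an integral.  It is
  only applied below to continuous functions of compact support.\<close>

definition inv_fourier :: "(real \<times> real \<Rightarrow> complex) \<Rightarrow> real \<times> real \<Rightarrow> complex" where
  "inv_fourier F x = (LINT \<xi>|lborel. F \<xi> * exp (2 * pi * \<i> * of_real (x \<bullet> \<xi>)))"


subsection \<open>Meyer functions\<close>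

definition meyer_aux :: "(real \<Rightarrow> real) \<Rightarrow> bool" where
  "meyer_aux \<nu> \<longleftrightarrow> smooth \<nu> \<and> (\<forall>x. \<nu> x + \<nu> (1 - x) = 1) \<and>
     (\<forall>x\<le>0. \<nu> x = 0) \<and> (\<forall>x\<ge>1. \<nu> x = 1)"

definition meyer_W :: "(real \<Rightarrow> real) \<Rightarrow> real \<Rightarrow> complex" where
  "meyer_W \<nu> \<xi> =
     (if 1/16 \<le> \<bar>\<xi>\<bar> \<and> \<bar>\<xi>\<bar> \<le> 1/8
        then exp (- 16 * pi * \<i> * of_real \<xi> / 3) * of_real (sin (pi/2 * \<nu> (16 * \<bar>\<xi>\<bar> - 1)))
      else if 1/8 \<le> \<bar>\<xi>\<bar> \<and> \<bar>\<xi>\<bar> \<le> 1/4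
        then exp (- 16 * pi * \<i> * of_real \<xi> / 3) * of_real (cos (pi/2 * \<nu> (8 * \<bar>\<xi>\<bar> - 1)))
      else 0)"

definition meyer_phi_hat :: "(real \<Rightarrow> real) \<Rightarrow> real \<Rightarrow> complex" where
  "meyer_phi_hat \<nu> \<xi> =
     (if \<bar>\<xi>\<bar> \<le> 1/16 then 1
      else if \<bar>\<xi>\<bar> \<le> 1/8 then of_real (cos (pi/2 * \<nu> (16 * \<bar>\<xi>\<bar> - 1)))
      else 0)"

datatype orientation = Horizontal | Vertical | Diagonal

fun meyer_W2 :: "(real \<Rightarrow> real) \<Rightarrow> orientation \<Rightarrow> real \<times> real \<Rightarrow> complex" where
  "meyer_W2 \<nu> Vertical (\<xi>1, \<xi>2) = meyer_phi_hat \<nu> \<xi>1 * meyer_W \<nu> \<xi>2"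
| "meyer_W2 \<nu> Horizontal (\<xi>1, \<xi>2) = meyer_W \<nu> \<xi>1 * meyer_phi_hat \<nu> \<xi>2"
| "meyer_W2 \<nu> Diagonal (\<xi>1, \<xi>2) = meyer_W \<nu> \<xi>1 * meyer_W \<nu> \<xi>2"


subsection \<open>The Meyer Parseval system\<close>

type_synonym wavelet_index = "orientation \<times> int \<times> int \<times> int"

fun meyer_psi_hat :: "(real \<Rightarrow> real) \<Rightarrow> wavelet_index \<Rightarrow> real \<times> real \<Rightarrow> complex" where
  "meyer_psi_hat \<nu> (\<iota>, j, k1, k2) \<xi> =
     of_real (2 powi (- j)) * meyer_W2 \<nu> \<iota> (\<xi> /\<^sub>R 2 powi j) *
     exp (- 2 * pi * \<i> * of_real ((real_of_int k1, real_of_int k2) \<bullet> (\<xi> /\<^sub>R 2 powi j)))"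

definition meyer_psi :: "(real \<Rightarrow> real) \<Rightarrow> wavelet_index \<Rightarrow> real \<times> real \<Rightarrow> complex" where
  "meyer_psi \<nu> l = inv_fourier (meyer_psi_hat \<nu> l)"

definition analysis_op ::
    "('i \<Rightarrow> real \<times> real \<Rightarrow> complex) \<Rightarrow> (real \<times> real \<Rightarrow> complex) \<Rightarrow> 'i \<Rightarrow> complex" where
  "analysis_op \<Psi> f = (\<lambda>l. L2_inner f (\<Psi> l))"

text \<open>Extended-valued, since the coefficients of an \<open>L\<^sup>2\<close> function need not be summable.\<close>

definition l1_norm :: "('i \<Rightarrow> complex) \<Rightarrow> ennreal" where
  "l1_norm c = (\<integral>\<^sup>+ i. ennreal (cmod (c i)) \<partial>count_space UNIV)"


subsection \<open>Image model and mask\<close>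

definition line_distr :: "real \<Rightarrow> (real \<Rightarrow> real) \<Rightarrow> (real \<times> real \<Rightarrow> complex) \<Rightarrow> complex" where
  "line_distr \<rho> w g = (LINT x1:{-\<rho>..\<rho>}|lborel. of_real (w x1) * g (x1, 0))"

text \<open>Convolution of a distribution with a test function.\<close>

definition distr_conv ::
    "((real \<times> real \<Rightarrow> complex) \<Rightarrow> complex) \<Rightarrow> (real \<times> real \<Rightarrow> complex) \<Rightarrow> real \<times> real \<Rightarrow> complex" where
  "distr_conv T g x = T (\<lambda>y. g (x - y))"

definition band_filter :: "(real \<Rightarrow> real) \<Rightarrow> nat \<Rightarrow> real \<times> real \<Rightarrow> complex" where
  "band_filter \<nu> j \<xi> = (\<Sum>\<iota>\<in>{Horizontal, Vertical, Diagonal}.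
     meyer_W2 \<nu> \<iota> (2 powi (- 2 * int j) *\<^sub>R \<xi>) + meyer_W2 \<nu> \<iota> (2 powi (- 2 * int j - 1) *\<^sub>R \<xi>))"

text \<open>By Fubini, the Fourier transform of \<open>line_image \<nu> \<rho> w j\<close> at \<open>\<xi>\<close> is
  \<open>(\<integral> w t * exp (- 2 \<pi> \<i> t \<xi>\<^sub>1) dt) * band_filter \<nu> j \<xi>\<close>.\<close>

definition line_image :: "(real \<Rightarrow> real) \<Rightarrow> real \<Rightarrow> (real \<Rightarrow> real) \<Rightarrow> nat \<Rightarrow> real \<times> real \<Rightarrow> complex" where
  "line_image \<nu> \<rho> w j = distr_conv (line_distr \<rho> w) (inv_fourier (band_filter \<nu> j))"

definition mask :: "real \<Rightarrow> (real \<times> real) set" where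
  "mask h = {x. \<bar>fst x\<bar> \<le> h}"

definition unmasked_proj :: "real \<Rightarrow> (real \<times> real \<Rightarrow> complex) \<Rightarrow> real \<times> real \<Rightarrow> complex" where
  "unmasked_proj h f x = (1 - indicator (mask h) x) * f x"

definition inpainting_solution ::
    "('i \<Rightarrow> real \<times> real \<Rightarrow> complex) \<Rightarrow> real \<Rightarrow> (real \<times> real \<Rightarrow> complex) \<Rightarrow> (real \<times> real \<Rightarrow> complex) \<Rightarrow> bool" where
  "inpainting_solution \<Psi> h f L \<longleftrightarrow>
     is_arg_min (\<lambda>L. l1_norm (analysis_op \<Psi> L))
       (\<lambda>L. L \<in> L2_space \<and> (AE x in lborel. f x = unmasked_proj h L x)) L"

end

theory Submission
  imports Defs
begin

text \<open>
  For all large \<open>j\<close> the minimiser recovers the image exactly, so that the quotient in the theorem is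
  eventually \<open>0\<close>. Write \<open>x\<close> for the line image at level \<open>j\<close>, \<open>L\<close> for a minimiser, and
  \<open>c\<^sub>i = \<langle>g, \<psi>\<^sub>i\<rangle>\<close> for the wavelet coefficients of \<open>g = L - x\<close>, a function that vanishes outside the
  strip \<open>M = {\<bar>x\<^sub>1\<bar> \<le> h\<^sub>j}\<close>.

  The image is band-limited: its coefficients vanish at every scale outside \<open>\<Lambda> = {2j-1, \<dots>, 2j+2}\<close>
  (\<open>line_image_coefficient_zero\<close>). Comparing \<open>\<parallel>\<Phi>\<^sup>* L\<parallel>\<^sub>1 \<le> \<parallel>\<Phi>\<^sup>* x\<parallel>\<^sub>1\<close> entry by entry, minimality therefore says
  that the part of \<open>c\<close> outside \<open>\<Lambda>\<close> has no larger \<open>l\<^sup>1\<close>-norm than the part inside.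

  A function living on a strip much thinner than the wavelength \<open>2^(-2j)\<close>, on the other hand, has almost
  none of its \<open>l\<^sup>1\<close>-mass in \<open>\<Lambda>\<close>. Since \<open>g = 1\<^sub>M g\<close> and \<open>g = \<Sum>\<^sub>i c\<^sub>i \<psi>\<^sub>i\<close>, one has
  \<open>c\<^sub>\<mu> = \<Sum>\<^sub>i c\<^sub>i \<langle>\<psi>\<^sub>i, 1\<^sub>M \<psi>\<^sub>\<mu>\<rangle>\<close>. All translates \<open>\<psi>\<^sub>\<mu>\<close> at scale \<open>b\<close> together satisfy \<open>\<Sum>\<^sub>\<mu> \<bar>\<psi>\<^sub>\<mu>\<bar> \<le> K 2^b\<close>, and
  \<open>\<integral>\<^sub>M \<bar>\<psi>\<^sub>i\<bar> \<le> K h\<close> for every \<open>i\<close>, whatever its scale. Hence the coefficients in \<open>\<Lambda>\<close> contribute at most a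
  constant times \<open>2^(2j) h\<^sub>j\<close> times the total (\<open>mask_concentration\<close>). As \<open>h\<^sub>j = o(2^(-2j))\<close>, the two
  statements force \<open>c = 0\<close> for large \<open>j\<close>, and then \<open>g = 0\<close> almost everywhere (\<open>exact_recovery\<close>).

  Two facts about the Meyer system enter: the pointwise decay of the wavelets, which comes from two
  integrations by parts on the Fourier side (\<open>ift_decay\<close>), and the expansion \<open>g = \<Sum>\<^sub>i c\<^sub>i \<psi>\<^sub>i\<close> for a
  square-integrable \<open>g\<close> with summable coefficients (\<open>reconstruction\<close>). The expansion is obtained
  without Plancherel's theorem on \<open>L\<^sup>2\<close>. Summation over translations is the Parseval identity for
  Fourier series (\<open>shannon_parseval\<close>), which turns the wavelets of one scale into the convolution
  kernel \<open>K(b+1) - K(b)\<close>, where \<open>K(b)(z) = 4^b k(2^b z\<^sub>1) k(2^b z\<^sub>2)\<close> and \<open>k\<close> is the inverse transform of the squared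
  scaling function. The sum over scales telescopes; tested against the indicator function of a box,
  \<open>K(b)\<close> acts as an approximate identity for \<open>b \<longrightarrow> \<infinity>\<close> and disappears for \<open>b \<longrightarrow> -\<infinity>\<close>. Boxes determine a
  function up to null sets.
\<close>

section \<open>Compactly supported functions of one variable and their inverse Fourier transform\<close>

definition ift :: "(real \<Rightarrow> complex) \<Rightarrow> real \<Rightarrow> complex" where
  "ift u x = (LINT t|lborel. u t * cis (2 * pi * x * t))"

definition C2 :: "(real \<Rightarrow> complex) \<Rightarrow> bool" where
  "C2 u \<longleftrightarrow> (\<exists>u' u''. (\<forall>t. (u has_vector_derivative u' t) (at t)) \<and>
     (\<forall>t. (u' has_vector_derivative u'' t) (at t)) \<and> continuous_on UNIV u'')"

definition bump :: "real \<Rightarrow> (real \<Rightarrow> complex) \<Rightarrow> bool" where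
  "bump R u \<longleftrightarrow> C2 u \<and> (\<forall>t. R \<le> \<bar>t\<bar> \<longrightarrow> u t = 0)"

lemma bump_mono: "bump R u \<Longrightarrow> R \<le> R' \<Longrightarrow> bump R' u"
  by (auto simp: bump_def)

lemma bump_zero: "bump R u \<Longrightarrow> R \<le> \<bar>t\<bar> \<Longrightarrow> u t = 0"
  by (auto simp: bump_def)

lemma C2_continuous: "C2 u \<Longrightarrow> continuous_on UNIV u"
  unfolding C2_def
  by (meson continuous_at_imp_continuous_on has_vector_derivative_continuous)

lemma bump_continuous: "bump R u \<Longrightarrow> continuous_on UNIV u"
  by (simp add: bump_def C2_continuous)

lemma C2_mult:
  assumes "C2 u" "C2 v" shows "C2 (\<lambda>t. u t * v t)"
proof -
  obtain u' u'' where u: "\<And>t. (u has_vector_derivative u' t) (at t)"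
     "\<And>t. (u' has_vector_derivative u'' t) (at t)" "continuous_on UNIV u''"
    using assms(1) unfolding C2_def by blast
  obtain v' v'' where v: "\<And>t. (v has_vector_derivative v' t) (at t)"
     "\<And>t. (v' has_vector_derivative v'' t) (at t)" "continuous_on UNIV v''"
    using assms(2) unfolding C2_def by blast
  have cont: "continuous_on UNIV u" "continuous_on UNIV u'" "continuous_on UNIV v" "continuous_on UNIV v'"
    using u v by (meson continuous_at_imp_continuous_on has_vector_derivative_continuous)+
  show ?thesis unfolding C2_def
  proof (intro exI conjI allI)
    fix t
    show "((\<lambda>t. u t * v t) has_vector_derivative (u t * v' t + u' t * v t)) (at t)"
      by (intro has_vector_derivative_mult u v)
    show "((\<lambda>t. u t * v' t + u' t * v t) has_vector_derivative
      ((u t * v'' t + u' t * v' t) + (u' t * v' t + u'' t * v t))) (at t)"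
      by (intro has_vector_derivative_add has_vector_derivative_mult u v)
  qed (intro continuous_intros cont u v)
qed

lemma C2_add:
  assumes "C2 u" "C2 v" shows "C2 (\<lambda>t. u t + v t)"
proof -
  obtain u' u'' where u: "\<And>t. (u has_vector_derivative u' t) (at t)"
     "\<And>t. (u' has_vector_derivative u'' t) (at t)" "continuous_on UNIV u''"
    using assms(1) unfolding C2_def by blast
  obtain v' v'' where v: "\<And>t. (v has_vector_derivative v' t) (at t)"
     "\<And>t. (v' has_vector_derivative v'' t) (at t)" "continuous_on UNIV v''"
    using assms(2) unfolding C2_def by blast
  show ?thesis unfolding C2_def
  proof (intro exI conjI allI)
    fix t
    show "((\<lambda>t. u t + v t) has_vector_derivative u' t + v' t) (at t)"
      by (intro has_vector_derivative_add u v)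
    show "((\<lambda>t. u' t + v' t) has_vector_derivative u'' t + v'' t) (at t)"
      by (intro has_vector_derivative_add u v)
  qed (intro continuous_intros u v)
qed

lemma C2_affine:
  assumes "C2 u" shows "C2 (\<lambda>t. u (a * t + b))"
proof -
  obtain u' u'' where u: "\<And>t. (u has_vector_derivative u' t) (at t)"
     "\<And>t. (u' has_vector_derivative u'' t) (at t)" "continuous_on UNIV u''"
    using assms(1) unfolding C2_def by blast
  have *: "((\<lambda>t. f (a * t + b)) has_vector_derivative a *\<^sub>R f' (a * t + b)) (at t)"
    if "\<And>t. (f has_vector_derivative f' t) (at t)" for f f' :: "real \<Rightarrow> complex" and t
  proof -
    have "((\<lambda>t. a * t + b) has_vector_derivative a) (at t)"
      by (auto intro!: derivative_eq_intros)
    from vector_diff_chain_at[OF this that[of "a * t + b"]] show ?thesis by (simp add: o_def)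
  qed
  show ?thesis unfolding C2_def
  proof (intro exI conjI allI)
    fix t
    show "((\<lambda>t. u (a * t + b)) has_vector_derivative (a *\<^sub>R u' (a * t + b))) (at t)"
      by (intro * u)
    show "((\<lambda>t. a *\<^sub>R u' (a * t + b)) has_vector_derivative a *\<^sub>R (a *\<^sub>R u'' (a * t + b))) (at t)"
      using bounded_linear.has_vector_derivative[OF bounded_linear_scaleR_right *[OF u(2)]] .
  qed (intro continuous_intros continuous_on_compose2[OF u(3)]; simp)
qed

lemma C2_cnj: assumes "C2 u" shows "C2 (\<lambda>t. cnj (u t))"
proof -
  obtain u' u'' where u: "\<And>t. (u has_vector_derivative u' t) (at t)"
     "\<And>t. (u' has_vector_derivative u'' t) (at t)" "continuous_on UNIV u''"
    using assms(1) unfolding C2_def by blast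
  show ?thesis unfolding C2_def
  proof (intro exI conjI allI)
    fix t
    show "((\<lambda>t. cnj (u t)) has_vector_derivative cnj (u' t)) (at t)" by (intro has_vector_derivative_cnj u)
    show "((\<lambda>t. cnj (u' t)) has_vector_derivative cnj (u'' t)) (at t)" by (intro has_vector_derivative_cnj u)
  qed (intro continuous_intros u)
qed

lemma bump_mult: "bump R u \<Longrightarrow> C2 v \<Longrightarrow> bump R (\<lambda>t. u t * v t)"
  by (auto simp: bump_def intro: C2_mult)

lemma bump_mult_cnj: "bump R u \<Longrightarrow> bump R' v \<Longrightarrow> bump R (\<lambda>t. u t * cnj (v t))"
  by (intro bump_mult C2_cnj) (auto simp: bump_def)

lemma bump_measurable [measurable_dest]: "bump R u \<Longrightarrow> u \<in> borel_measurable borel"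
  by (intro borel_measurable_continuous_onI bump_continuous)

lemma integrable_compactly_supported:
  fixes u :: "real \<Rightarrow> complex"
  assumes "continuous_on UNIV u" "\<And>t. R \<le> \<bar>t\<bar> \<Longrightarrow> u t = 0"
  shows "integrable lborel u"
proof -
  have "set_integrable lborel {-R..R} u"
    by (intro borel_integrable_atLeastAtMost' continuous_on_subset[OF assms(1)]) auto
  moreover have "(\<lambda>t. indicator {-R..R} t *\<^sub>R u t) = u"
    using assms(2) by (force simp: indicator_def)
  ultimately show ?thesis by (simp add: set_integrable_def)
qed

lemma bump_integrable: "bump R u \<Longrightarrow> integrable lborel u"
  by (intro integrable_compactly_supported[of u R] bump_continuous) (auto simp: bump_zero)

lemma continuous_on_cis_compose [continuous_intros]:
  "continuous_on S f \<Longrightarrow> continuous_on S (\<lambda>x. cis (f x))"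
  by (simp add: cis_conv_exp) (intro continuous_intros)

lemma has_vector_derivative_cis:
  "((\<lambda>t. cis (a * t)) has_vector_derivative (\<i> * a * cis (a * t))) (at t within S)"
proof -
  have "((\<lambda>z. exp (\<i> * complex_of_real a * z)) has_field_derivative
      (\<i> * a * exp (\<i> * complex_of_real a * of_real t))) (at (of_real t))"
    by (auto intro!: derivative_eq_intros)
  from has_vector_derivative_real_field[OF this, of S]
  show ?thesis by (simp add: cis_conv_exp mult.assoc)
qed

lemma C2_cis: "C2 (\<lambda>t. cis (a * t))"
  unfolding C2_def
proof (intro exI conjI allI)
  fix t
  show "((\<lambda>t. \<i> * a * cis (a * t)) has_vector_derivative \<i> * a * (\<i> * a * cis (a * t))) (at t)"
    by (intro has_vector_derivative_mult_right has_vector_derivative_cis)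
qed (intro has_vector_derivative_cis continuous_intros)+

lemma borel_measurable_cis [measurable]: "f \<in> borel_measurable M \<Longrightarrow> (\<lambda>x. cis (f x)) \<in> borel_measurable M"
proof -
  assume "f \<in> borel_measurable M"
  moreover have "cis \<in> borel_measurable borel"
    by (intro borel_measurable_continuous_onI continuous_intros)
  ultimately show ?thesis by (rule measurable_compose)
qed

lemma borel_measurable_cnj [measurable]:
  assumes "f \<in> borel_measurable M" shows "(\<lambda>x. cnj (f x)) \<in> borel_measurable M"
  using assms by (rule measurable_compose) (intro borel_measurable_continuous_onI continuous_intros)

lemma integrable_dominated:
  fixes f :: "'a \<Rightarrow> 'b::{banach, second_countable_topology}" and g :: "'a \<Rightarrow> real"
  assumes "integrable M g" "f \<in> borel_measurable M" "\<And>x. norm (f x) \<le> g x"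
  shows "integrable M f"
  using assms(1,2)
  by (rule Bochner_Integration.integrable_bound) (use assms(3) in \<open>auto intro: order_trans[OF _ abs_ge_self]\<close>)

lemma integrable_mult_bounded:
  fixes f g :: "'a \<Rightarrow> complex"
  assumes f: "integrable M f" and g: "g \<in> borel_measurable M" "\<And>x. norm (g x) \<le> C"
  shows "integrable M (\<lambda>x. f x * g x)"
proof (rule integrable_dominated)
  show "integrable M (\<lambda>x. norm (f x) * C)" by (intro integrable_mult_left integrable_norm f)
  show "(\<lambda>x. f x * g x) \<in> borel_measurable M"
    by (rule borel_measurable_times[OF borel_measurable_integrable[OF f] g(1)])
  show "norm (f x * g x) \<le> norm (f x) * C" for x
    unfolding norm_mult by (intro mult_left_mono g) simp
qed

lemma integrable_mult_cis:
  "integrable lborel u \<Longrightarrow> f \<in> borel_measurable borel \<Longrightarrow> integrable lborel (\<lambda>t::real. u t * cis (f t))"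
  by (rule integrable_mult_bounded[where C=1]) auto

lemma ift_measurable [measurable]:
  assumes [measurable]: "u \<in> borel_measurable borel"
  shows "ift u \<in> borel_measurable borel"
  unfolding ift_def by measurable

lemma norm_ift_le: "integrable lborel u \<Longrightarrow> norm (ift u x) \<le> (LINT t|lborel. norm (u t))"
  unfolding ift_def by (rule order_trans[OF integral_norm_bound]) (simp add: norm_mult)

text \<open>Both boundary terms vanish, because \<open>u\<close> and \<open>u'\<close> are zero at
  \<open>\<plusminus>(\<bar>R\<bar> + 1)\<close>; one application of the fundamental theorem to
  \<open>-\<i> a u(t) cis(a t) + u'(t) cis(a t)\<close> performs both integrations at once.\<close>

lemma bump_ift_by_parts:
  assumes "bump R u"
  obtains u'' where "continuous_on UNIV u''" "\<And>t. R + 1 \<le> \<bar>t\<bar> \<Longrightarrow> u'' t = 0"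
    "\<And>x. complex_of_real ((2 * pi * x)\<^sup>2) * ift u x = - ift u'' x"
proof -
  obtain u' u'' where u': "\<And>t. (u has_vector_derivative u' t) (at t)"
    and u'': "\<And>t. (u' has_vector_derivative u'' t) (at t)" and c: "continuous_on UNIV u''"
    and z: "\<And>t. R \<le> \<bar>t\<bar> \<Longrightarrow> u t = 0"
    using assms unfolding bump_def C2_def by blast
  have op: "open {t. R < \<bar>t\<bar>}"
    by (intro open_Collect_less continuous_intros)
  have z': "u' t = 0" if "R < \<bar>t\<bar>" for t
  proof -
    have "((\<lambda>_. 0) has_vector_derivative u' t) (at t)"
      using that z by (intro has_vector_derivative_transform_within_open[OF u' op]) auto
    then show ?thesis
      using vector_derivative_unique_at has_vector_derivative_const by blast
  qed
  have z'': "u'' t = 0" if "R < \<bar>t\<bar>" for t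
  proof -
    have "((\<lambda>_. 0) has_vector_derivative u'' t) (at t)"
      using that z' by (intro has_vector_derivative_transform_within_open[OF u'' op]) auto
    then show ?thesis
      using vector_derivative_unique_at has_vector_derivative_const by blast
  qed
  have cu: "continuous_on UNIV u" using assms by (rule bump_continuous)
  have "complex_of_real ((2 * pi * x)\<^sup>2) * ift u x = - ift u'' x" for x
  proof -
    define a where "a = 2 * pi * x"
    define S where "S = \<bar>R\<bar> + 1"
    define G where "G = (\<lambda>t. - \<i> * complex_of_real a * (u t * cis (a * t)) + u' t * cis (a * t))"
    define g where "g = (\<lambda>t. complex_of_real (a\<^sup>2) * (u t * cis (a * t)) + u'' t * cis (a * t))"
    have "(G has_vector_derivative g t) (at t within {-S..S})" for t
      unfolding G_def g_def
      by (rule derivative_eq_intros has_vector_derivative_at_within[OF u']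
          has_vector_derivative_at_within[OF u''] has_vector_derivative_cis refl)+
        (simp add: algebra_simps power2_eq_square)
    moreover have "continuous_on {-S..S} g"
      unfolding g_def by (intro continuous_intros continuous_on_subset[OF cu] continuous_on_subset[OF c]) auto
    ultimately have "(LINT t|lborel. indicator {-S..S} t *\<^sub>R g t) = G S - G (-S)"
      by (intro integral_FTC_Icc) (auto simp: S_def)
    also have "\<dots> = 0" unfolding G_def S_def by (simp add: z z')
    also have "(\<lambda>t. indicator {-S..S} t *\<^sub>R g t) = g"
      unfolding g_def S_def by (auto simp: fun_eq_iff indicator_def z z'')
    finally have 1: "(LINT t|lborel. g t) = 0" .
    have i: "integrable lborel (\<lambda>t. u t * cis (a * t))" "integrable lborel (\<lambda>t. u'' t * cis (a * t))"
      by (intro integrable_mult_cis bump_integrable[OF assms] integrable_compactly_supported[OF c, of "R+1"];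
          simp add: z'')+
    have "(LINT t|lborel. g t) = complex_of_real (a\<^sup>2) * ift u x + ift u'' x"
      unfolding g_def ift_def using i by (simp add: a_def)
    with 1 show ?thesis unfolding a_def by (simp add: add_eq_0_iff)
  qed
  with c z'' show ?thesis by (intro that[of u'']) auto
qed

definition decay :: "real \<Rightarrow> real" where "decay x = 1 / (1 + x\<^sup>2)"

lemma decay_pos: "decay x > 0" by (simp add: decay_def add_pos_nonneg)

lemma decay_nonneg [simp]: "decay x \<ge> 0" using decay_pos[of x] by simp

lemma decay_le_1: "decay x \<le> 1" by (simp add: decay_def divide_le_eq_1 add_pos_nonneg)

lemma decay_minus [simp]: "decay (- x) = decay x" by (simp add: decay_def)

lemma decay_measurable [measurable]: "decay \<in> borel_measurable borel" unfolding decay_def by measurable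

lemma integrable_decay: "integrable lborel decay"
proof -
  have 1: "(\<integral>\<^sup>+x. ennreal (decay x) * indicator {0..} x \<partial>lborel) = ennreal (pi / 2 - arctan 0)"
  proof (rule nn_integral_FTC_atLeast)
    fix x show "DERIV arctan x :> decay x"
      unfolding decay_def by (rule derivative_eq_intros refl)+ (simp add: inverse_eq_divide)
  qed (auto intro: tendsto_arctan_at_top)
  have 2: "(\<integral>\<^sup>+x. ennreal (decay x) * indicator {..0} x \<partial>lborel) = (\<integral>\<^sup>+x. ennreal (decay x) * indicator {0..} x \<partial>lborel)"
    by (subst nn_integral_real_affine[where c="-1" and t=0]) (auto intro!: nn_integral_cong simp: indicator_def)
  have "(\<integral>\<^sup>+x. ennreal (norm (decay x)) \<partial>lborel) \<le>
      (\<integral>\<^sup>+x. ennreal (decay x) * indicator {..0} x + ennreal (decay x) * indicator {0..} x \<partial>lborel)"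
    by (intro nn_integral_mono) (auto simp: indicator_def)
  also have "\<dots> = (\<integral>\<^sup>+x. ennreal (decay x) * indicator {..0} x \<partial>lborel) + (\<integral>\<^sup>+x. ennreal (decay x) * indicator {0..} x \<partial>lborel)"
    by (subst nn_integral_add) auto
  also have "\<dots> < \<infinity>" unfolding 2 1 by simp
  finally show ?thesis by (intro integrableI_bounded) auto
qed

lemma decay_bound_integrable:
  fixes g :: "real \<Rightarrow> 'b::{banach, second_countable_topology}"
  assumes "g \<in> borel_measurable borel" "\<And>x. norm (g x) \<le> C * decay x"
  shows "integrable lborel g"
  by (rule integrable_dominated[OF integrable_mult_right[OF integrable_decay, of C]]) (use assms in simp_all)

lemma ift_decay:
  assumes "bump R u"
  obtains C where "C > 0" "\<And>x. norm (ift u x) \<le> C * decay x"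
proof -
  obtain u'' where c: "continuous_on UNIV u''" "\<And>t. R + 1 \<le> \<bar>t\<bar> \<Longrightarrow> u'' t = 0"
    and eq: "\<And>x. complex_of_real ((2 * pi * x)\<^sup>2) * ift u x = - ift u'' x"
    using bump_ift_by_parts[OF assms] by blast
  define A where "A = (LINT t|lborel. norm (u t))"
  define B where "B = (LINT t|lborel. norm (u'' t))"
  have A: "A \<ge> 0" and B: "B \<ge> 0" unfolding A_def B_def by simp_all
  have "norm (ift u x) \<le> (A + B + 1) * decay x" for x
  proof -
    have 1: "norm (ift u x) \<le> A"
      unfolding A_def by (intro norm_ift_le bump_integrable[OF assms])
    have "(2 * pi * x)\<^sup>2 * norm (ift u x) = norm (ift u'' x)"
      using arg_cong[OF eq[of x], of norm] by (simp only: norm_mult norm_of_real norm_minus_cancel abs_power2)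
    also have "\<dots> \<le> B"
      unfolding B_def by (intro norm_ift_le integrable_compactly_supported[OF c])
    finally have "(2 * pi * x)\<^sup>2 * norm (ift u x) \<le> B" .
    moreover have "x\<^sup>2 \<le> (2 * pi * x)\<^sup>2"
      using pi_gt3 mult_right_mono[OF one_le_power[of "2 * pi" 2], of "x\<^sup>2"] by (simp add: power_mult_distrib)
    ultimately have "x\<^sup>2 * norm (ift u x) \<le> B"
      by (meson mult_right_mono norm_ge_zero order_trans)
    with 1 have "(1 + x\<^sup>2) * norm (ift u x) \<le> A + B + 1" by (simp add: algebra_simps)
    then show ?thesis
      by (simp add: decay_def pos_le_divide_eq mult.commute add_pos_nonneg)
  qed
  then show ?thesis using A B by (intro that[of "A+B+1"]) auto
qed

lemma integrable_ift: "bump R u \<Longrightarrow> integrable lborel (ift u)"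
  by (metis bump_measurable decay_bound_integrable ift_decay ift_measurable)

lemma bump_modulate: "bump R u \<Longrightarrow> bump R (\<lambda>t. u t * cis (a * t))"
  by (intro bump_mult C2_cis)

lemma ift_modulate: "ift (\<lambda>t. u t * cis (2 * pi * a * t)) x = ift u (x + a)"
  unfolding ift_def mult.assoc cis_mult
  by (intro Bochner_Integration.integral_cong refl arg_cong2[of _ _ _ _ "(*)"] arg_cong[of _ _ cis]) (simp add: algebra_simps)

lemma bump_dilate: 
  assumes "bump R u" "c > 0" shows "bump (R / c) (\<lambda>t. u (c * t))"
  using assms C2_affine[of u c 0] by (auto simp: bump_def abs_mult field_simps)

lemma ift_dilate: "c > 0 \<Longrightarrow> ift (\<lambda>t. u (c * t)) x = complex_of_real (1 / c) * ift u (x / c)"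
  unfolding ift_def
  by (subst lborel_integral_real_affine[where c="1/c" and t=0]) (auto simp: scaleR_conv_of_real)

section \<open>Absolutely convergent sums\<close>

text \<open>Sums over a countable index set are integrals with respect to counting measure, so that
  interchanging a sum with an integral is an instance of Fubini's theorem.\<close>

abbreviation asum :: "('i \<Rightarrow> 'b::{banach, second_countable_topology}) \<Rightarrow> 'b" where
  "asum f \<equiv> integral\<^sup>L (count_space UNIV) f"

abbreviation asummable :: "('i \<Rightarrow> 'b::{banach, second_countable_topology}) \<Rightarrow> bool" where
  "asummable f \<equiv> integrable (count_space UNIV) f"

lemma asum_integral_swap:
  fixes F :: "'i::countable \<Rightarrow> 'a \<Rightarrow> 'b::{banach, second_countable_topology}" and B :: "'i \<Rightarrow> real"
  assumes "sigma_finite_measure M"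
    and meas: "\<And>i. F i \<in> borel_measurable M"
    and bound: "\<And>i. (\<integral>\<^sup>+x. ennreal (norm (F i x)) \<partial>M) \<le> ennreal (B i)" and B: "asummable B"
  shows "integrable M (\<lambda>x. asum (\<lambda>i. F i x))"
    and "(LINT x|M. asum (\<lambda>i. F i x)) = asum (\<lambda>i. LINT x|M. F i x)"
proof -
  let ?C = "count_space (UNIV::'i set)"
  interpret M: sigma_finite_measure M by fact
  interpret C: sigma_finite_measure ?C by (rule sigma_finite_measure_count_space)
  interpret pair_sigma_finite ?C M ..
  have int: "integrable (?C \<Otimes>\<^sub>M M) (case_prod F)"
  proof (rule integrableI_bounded)
    show m: "case_prod F \<in> borel_measurable (?C \<Otimes>\<^sub>M M)"
      by (rule measurable_pair_measure_countable1) (auto simp: meas)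
    have "(\<integral>\<^sup>+ p. norm (case_prod F p) \<partial>(?C \<Otimes>\<^sub>M M)) = (\<integral>\<^sup>+i. \<integral>\<^sup>+x. norm (F i x) \<partial>M \<partial>?C)"
      using m by (subst M.nn_integral_fst[symmetric]) auto
    also have "\<dots> \<le> (\<integral>\<^sup>+i. norm (B i) \<partial>?C)"
      by (intro nn_integral_mono order_trans[OF bound] ennreal_leI) auto
    also have "\<dots> < \<infinity>" using B by (simp add: integrable_iff_bounded)
    finally show "(\<integral>\<^sup>+ p. norm (case_prod F p) \<partial>(?C \<Otimes>\<^sub>M M)) < \<infinity>" .
  qed
  show "integrable M (\<lambda>x. asum (\<lambda>i. F i x))" by (rule integrable_snd[OF int])
  show "(LINT x|M. asum (\<lambda>i. F i x)) = asum (\<lambda>i. LINT x|M. F i x)" by (rule Fubini_integral[OF int])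
qed

text \<open>Tonelli's theorem, for families whose sum is known to be dominated by an integrable function.\<close>

lemma asum_integral_bound:
  fixes F :: "'i::countable \<Rightarrow> 'a \<Rightarrow> real"
  assumes M: "sigma_finite_measure M" and meas: "\<And>i. F i \<in> borel_measurable M"
    and nonneg: "\<And>i x. F i x \<ge> 0" and s: "\<And>x. asummable (\<lambda>i. F i x)"
    and le: "\<And>x. asum (\<lambda>i. F i x) \<le> G x" and G: "integrable M G"
  shows "integrable M (F i)" "asummable (\<lambda>i. LINT x|M. F i x)"
    and "asum (\<lambda>i. LINT x|M. F i x) \<le> (LINT x|M. G x)"
proof -
  let ?C = "count_space (UNIV::'i set)"
  interpret M: sigma_finite_measure M by fact
  interpret C: sigma_finite_measure ?C by (rule sigma_finite_measure_count_space)
  interpret pair_sigma_finite ?C M ..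
  have G0: "G x \<ge> 0" for x
    by (rule order_trans[OF _ le]) (intro Bochner_Integration.integral_nonneg nonneg; simp)
  have m: "case_prod (\<lambda>i x. ennreal (F i x)) \<in> borel_measurable (?C \<Otimes>\<^sub>M M)"
    by (rule measurable_pair_measure_countable1) (use meas in auto)
  have "(\<integral>\<^sup>+i. \<integral>\<^sup>+x. F i x \<partial>M \<partial>?C) = (\<integral>\<^sup>+x. \<integral>\<^sup>+i. F i x \<partial>?C \<partial>M)"
    by (rule Fubini'[OF m, symmetric])
  also have "\<dots> = (\<integral>\<^sup>+x. ennreal (asum (\<lambda>i. F i x)) \<partial>M)"
    by (intro nn_integral_cong nn_integral_eq_integral s) (simp add: nonneg)
  also have "\<dots> \<le> (\<integral>\<^sup>+x. ennreal (G x) \<partial>M)" by (rule nn_integral_mono, rule ennreal_leI, rule le)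
  also have "\<dots> = ennreal (LINT x|M. G x)" by (rule nn_integral_eq_integral[OF G]) (simp add: G0)
  finally have *: "(\<integral>\<^sup>+i. \<integral>\<^sup>+x. F i x \<partial>M \<partial>?C) \<le> ennreal (LINT x|M. G x)" .
  show int: "integrable M (F i)" for i
  proof (rule integrableI_bounded[OF meas])
    have "(\<integral>\<^sup>+x. ennreal (norm (F i x)) \<partial>M) = (\<integral>\<^sup>+x. F i x \<partial>M)" by (simp add: nonneg)
    also have "\<dots> \<le> (\<integral>\<^sup>+i. \<integral>\<^sup>+x. F i x \<partial>M \<partial>?C)"
      by (rule nn_integral_ge_point) simp
    also have "\<dots> < \<infinity>" using * by (rule le_less_trans) simp
    finally show "(\<integral>\<^sup>+x. ennreal (norm (F i x)) \<partial>M) < \<infinity>" .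
  qed
  have I0: "(LINT x|M. F i x) \<ge> 0" for i by (intro Bochner_Integration.integral_nonneg nonneg)
  have **: "(\<integral>\<^sup>+i. ennreal (LINT x|M. F i x) \<partial>?C) \<le> ennreal (LINT x|M. G x)"
  proof -
    have "(\<integral>\<^sup>+i. ennreal (LINT x|M. F i x) \<partial>?C) = (\<integral>\<^sup>+i. \<integral>\<^sup>+x. F i x \<partial>M \<partial>?C)"
      by (intro nn_integral_cong nn_integral_eq_integral[symmetric] int) (simp add: nonneg)
    with * show ?thesis by simp
  qed
  show s': "asummable (\<lambda>i. LINT x|M. F i x)"
  proof (rule integrableI_bounded)
    have "(\<integral>\<^sup>+i. ennreal (norm (LINT x|M. F i x)) \<partial>?C) = (\<integral>\<^sup>+i. ennreal (LINT x|M. F i x) \<partial>?C)"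
      by (simp add: I0)
    also have "\<dots> < \<infinity>" using ** by (rule le_less_trans) simp
    finally show "(\<integral>\<^sup>+i. ennreal (norm (LINT x|M. F i x)) \<partial>?C) < \<infinity>" .
  qed simp
  have "ennreal (asum (\<lambda>i. LINT x|M. F i x)) \<le> ennreal (LINT x|M. G x)"
    using ** by (subst (asm) nn_integral_eq_integral[OF s']) (simp_all add: I0)
  then show "asum (\<lambda>i. LINT x|M. F i x) \<le> (LINT x|M. G x)"
    by (subst (asm) ennreal_le_iff) (auto intro!: Bochner_Integration.integral_nonneg G0)
qed

lemma nn_integral_le_of_integral:
  fixes f :: "'a \<Rightarrow> 'b::{banach, second_countable_topology}"
  assumes "integrable M f" "(LINT x|M. norm (f x)) \<le> B"
  shows "(\<integral>\<^sup>+x. ennreal (norm (f x)) \<partial>M) \<le> ennreal B"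
  using assms by (subst nn_integral_eq_integral) (auto intro: ennreal_leI Bochner_Integration.integrable_norm)

lemma asummable_bound:
  assumes "asummable (g :: 'i \<Rightarrow> real)" "\<And>i. norm (f i) \<le> g i"
  shows "asummable f" "norm (asum f) \<le> asum g" "asum (\<lambda>i. norm (f i)) \<le> asum g"
proof -
  show f: "asummable f"
    by (rule integrable_dominated[OF assms(1) _ assms(2)]) simp
  show 1: "asum (\<lambda>i. norm (f i)) \<le> asum g"
    by (intro integral_mono integrable_norm f assms)
  show "norm (asum f) \<le> asum g"
    using integral_norm_bound 1 by (rule order_trans)
qed

lemma asum_finite_support:
  fixes f :: "'i \<Rightarrow> 'b::{banach, second_countable_topology}"
  assumes "finite B" "\<And>b. b \<notin> B \<Longrightarrow> f b = 0"
  shows "asummable f" "asum f = sum f B"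
proof -
  have "Infinite_Set_Sum.abs_summable_on f UNIV \<longleftrightarrow> Infinite_Set_Sum.abs_summable_on f B"
    by (rule abs_summable_on_cong_neutral) (use assms in auto)
  then have "Infinite_Set_Sum.abs_summable_on f UNIV" using assms(1) by simp
  then show "asummable f" by (simp add: abs_summable_on_def)
  have "asum f = (\<Sum>a | a \<in> UNIV \<and> f a \<noteq> 0. f a)"
    by (rule lebesgue_integral_count_space_finite_support) (use assms in \<open>auto intro: finite_subset[of _ B]\<close>)
  also have "\<dots> = sum f B"
    by (rule sum.mono_neutral_left) (use assms in auto)
  finally show "asum f = sum f B" .
qed

lemma asum_single:
  fixes c :: "'b::{banach, second_countable_topology}"
  shows "asum (\<lambda>n. if n = m then c else 0) = c"
proof -
  have "asum (\<lambda>n. if n = m then c else 0) = (\<Sum>a | a \<in> UNIV \<and> (if a = m then c else 0) \<noteq> 0. if a = m then c else 0)"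
    by (rule lebesgue_integral_count_space_finite_support) (auto intro: finite_subset[of _ "{m}"])
  also have "\<dots> = (\<Sum>a\<in>{m}. if a = m then c else 0)"
    by (rule sum.mono_neutral_left) auto
  finally show ?thesis by simp
qed

lemma asum_finite_UNIV:
  fixes f :: "'i::finite \<Rightarrow> 'b::{banach, second_countable_topology}"
  shows "asum f = (\<Sum>i\<in>UNIV. f i)" "asummable f"
  by (simp_all add: lebesgue_integral_count_space_finite integrable_count_space)

lemma asum_pair:
  fixes g :: "'i::countable \<times> 'j::countable \<Rightarrow> 'b::{banach, second_countable_topology}"
  assumes "asummable g"
  shows "asummable (\<lambda>j. g (i, j))" "asummable (\<lambda>i. asum (\<lambda>j. g (i, j)))"
    and "asum g = asum (\<lambda>i. asum (\<lambda>j. g (i, j)))"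
proof -
  let ?I = "count_space (UNIV::'i set)" and ?J = "count_space (UNIV::'j set)"
  interpret I: sigma_finite_measure ?I by (rule sigma_finite_measure_count_space)
  interpret J: sigma_finite_measure ?J by (rule sigma_finite_measure_count_space)
  interpret pair_sigma_finite ?I ?J ..
  have e: "count_space (UNIV :: ('i \<times> 'j) set) = ?I \<Otimes>\<^sub>M ?J"
    by (subst pair_measure_countable) auto
  have g: "integrable (?I \<Otimes>\<^sub>M ?J) g" using assms unfolding e .
  show "asummable (\<lambda>j. g (i, j))" using AE_integrable_fst'[OF g] by (simp add: AE_count_space)
  show "asummable (\<lambda>i. asum (\<lambda>j. g (i, j)))" by (rule integrable_fst'[OF g])
  show "asum g = asum (\<lambda>i. asum (\<lambda>j. g (i, j)))" unfolding e by (rule integral_fst'[OF g, symmetric])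
qed

lemma asummable_pairI:
  fixes g :: "'i::countable \<times> 'j::countable \<Rightarrow> 'b::{banach, second_countable_topology}"
  assumes "\<And>i. asummable (\<lambda>j. g (i, j))" "asummable (\<lambda>i. asum (\<lambda>j. norm (g (i, j))))"
  shows "asummable g"
proof -
  let ?I = "count_space (UNIV::'i set)" and ?J = "count_space (UNIV::'j set)"
  interpret I: sigma_finite_measure ?I by (rule sigma_finite_measure_count_space)
  interpret J: sigma_finite_measure ?J by (rule sigma_finite_measure_count_space)
  interpret pair_sigma_finite ?I ?J ..
  have e: "count_space (UNIV :: ('i \<times> 'j) set) = ?I \<Otimes>\<^sub>M ?J"
    by (subst pair_measure_countable) auto
  show ?thesis unfolding e
    by (rule Fubini_integrable) (use assms in \<open>auto simp: AE_count_space simp flip: e\<close>)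
qed

lemma asum_prod:
  fixes f :: "'i::countable \<Rightarrow> 'c::{banach, real_normed_field, second_countable_topology}" and g :: "'j::countable \<Rightarrow> 'c"
  assumes "asummable f" "asummable g"
  shows "asummable (\<lambda>p. f (fst p) * g (snd p))" "asum (\<lambda>p. f (fst p) * g (snd p)) = asum f * asum g"
  using assms abs_summable_on_product[of "UNIV::'i set" "UNIV::'j set" f g]
    infsetsum_product[of "UNIV::'i set" "UNIV::'j set" f g]
  by (simp_all add: abs_summable_on_def infsetsum_def case_prod_beta)

lemma decay_unit_shift:
  assumes "0 \<le> y" "y \<le> 1" shows "decay (y - k) \<le> 3 * decay k"
proof -
  have "0 \<le> (2 * y - k)\<^sup>2" by simp
  then have "k\<^sup>2 \<le> 2 * (y - k)\<^sup>2 + 2 * y\<^sup>2" by (simp add: power2_eq_square algebra_simps)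
  moreover have "y\<^sup>2 \<le> 1" using assms by (simp add: power_le_one)
  moreover have "0 \<le> (y - k)\<^sup>2" by simp
  ultimately have "1 + k\<^sup>2 \<le> 3 * (1 + (y - k)\<^sup>2)" by (simp only: distrib_left)
  moreover have "1 / A \<le> 3 * (1 / B)" if "B \<le> 3 * A" "A > 0" "B > 0" for A B :: real
    using that by (simp add: field_simps)
  ultimately show ?thesis
    unfolding decay_def by (simp add: add_pos_nonneg)
qed

lemma asummable_decay_int: "asummable (\<lambda>n::int. decay (of_int n))"
proof -
  have "summable (\<lambda>n::nat. 1 / (1 + (real n)\<^sup>2))"
  proof (rule summable_comparison_test'[of "\<lambda>n. inverse (real n ^ 2)" 1])
    fix n :: nat assume "n \<ge> 1"
    then show "norm (1 / (1 + (real n)\<^sup>2)) \<le> inverse (real n ^ 2)"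
      using le_imp_inverse_le[of "real n ^ 2" "1 + real n ^ 2"] by (simp add: inverse_eq_divide)
  qed (simp add: inverse_power_summable)
  then have nat: "Infinite_Set_Sum.abs_summable_on (\<lambda>n::nat. 1 / (1 + (real n)\<^sup>2)) UNIV"
    by (subst abs_summable_on_nat_iff') (simp add: add_nonneg_nonneg)
  have U: "(UNIV::int set) = int ` UNIV \<union> (\<lambda>n. - int n) ` UNIV"
  proof -
    have "z \<in> range int \<union> range (\<lambda>n. - int n)" for z :: int
      by (cases z rule: int_cases2) auto
    then show ?thesis by blast
  qed
  have "Infinite_Set_Sum.abs_summable_on (\<lambda>n::int. 1 / (1 + (real_of_int n)\<^sup>2)) UNIV"
    by (subst U, intro abs_summable_on_union abs_summable_on_reindex) (use nat in simp_all)
  then show ?thesis by (simp add: abs_summable_on_def decay_def)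
qed

definition decay_sum_bound :: real where
  "decay_sum_bound = 3 * asum (\<lambda>n::int. decay (of_int n))"

text \<open>By periodicity in \<open>x\<close> only \<open>0 \<le> x < 1\<close> matters, where a shift by
  \<open>x\<close> costs a factor \<open>3\<close>. The bound does not depend on \<open>x\<close>,
  which is what makes the sum of all translates of a wavelet bounded.\<close>

lemma asummable_decay:
  shows "asummable (\<lambda>n::int. decay (x - of_int n))"
    and "asum (\<lambda>n::int. decay (x - of_int n)) \<le> decay_sum_bound"
proof -
  define f where "f = (\<lambda>n::int. decay (x - of_int n))"
  define g where "g = (\<lambda>k::int. f (\<lfloor>x\<rfloor> + k))"
  have gle: "norm (g k) \<le> 3 * decay (of_int k)" for k
  proof -
    have "g k = decay (frac x - of_int k)" by (simp add: g_def f_def frac_def algebra_simps)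
    also have "\<dots> \<le> 3 * decay (of_int k)"
      using frac_ge_0[of x] frac_lt_1[of x] by (intro decay_unit_shift) auto
    finally show ?thesis by (simp add: g_def f_def)
  qed
  note s = integrable_mult_right[OF asummable_decay_int, of 3]
  have bij: "bij_betw (\<lambda>k. \<lfloor>x\<rfloor> + k) UNIV UNIV"
    by (rule bij_betw_byWitness[where f'="\<lambda>k. k - \<lfloor>x\<rfloor>"]) auto
  have "Infinite_Set_Sum.abs_summable_on f UNIV"
    using abs_summable_on_reindex_bij_betw[OF bij, of f] asummable_bound(1)[OF s gle]
    by (simp add: g_def abs_summable_on_def)
  then show "asummable f" by (simp add: abs_summable_on_def)
  have "asum f = asum g"
    using infsetsum_reindex_bij_betw[OF bij, of f] by (simp add: infsetsum_def g_def)
  also have "\<dots> \<le> asum (\<lambda>k::int. 3 * decay (of_int k))"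
    using asummable_bound(2)[OF s gle] by simp
  also have "\<dots> = decay_sum_bound" by (simp only: decay_sum_bound_def integral_mult_right_zero)
  finally show "asum f \<le> decay_sum_bound" .
qed

lemma decay_sum_bound_nonneg: "decay_sum_bound \<ge> 0"
  unfolding decay_sum_bound_def by (intro mult_nonneg_nonneg Bochner_Integration.integral_nonneg) auto

lemma ift_int_bound:
  assumes "bump R u"
  obtains C where "C > 0" "\<And>x. asummable (\<lambda>n::int. ift u (x - of_int n))"
    "\<And>x. asum (\<lambda>n::int. norm (ift u (x - of_int n))) \<le> C" "\<And>x. norm (ift u x) \<le> C * decay x" "\<And>x. norm (ift u x) \<le> C"
proof -
  obtain C where C: "C > 0" "\<And>x. norm (ift u x) \<le> C * decay x" using ift_decay[OF assms] by blast
  have s: "asummable (\<lambda>n::int. C * decay (x - of_int n))" for x by (intro integrable_mult_right asummable_decay)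
  define D where "D = C * (decay_sum_bound + 1)"
  have D: "C \<le> D" "0 < D" "C * decay_sum_bound \<le> D" using C decay_sum_bound_nonneg by (auto simp: D_def algebra_simps add_pos_nonneg)
  show ?thesis
  proof (rule that[OF D(2)])
    fix x
    show "asummable (\<lambda>n::int. ift u (x - of_int n))" by (rule asummable_bound[OF s C(2)])
    have "asum (\<lambda>n::int. norm (ift u (x - of_int n))) \<le> asum (\<lambda>n::int. C * decay (x - of_int n))"
      by (rule asummable_bound[OF s C(2)])
    also have "\<dots> = C * asum (\<lambda>n::int. decay (x - of_int n))" by (rule integral_mult_right_zero)
    also have "\<dots> \<le> C * decay_sum_bound" using C by (intro mult_left_mono asummable_decay) auto
    also have "\<dots> \<le> D" by (rule D)
    finally show "asum (\<lambda>n::int. norm (ift u (x - of_int n))) \<le> D" .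
    show 1: "norm (ift u x) \<le> D * decay x"
      by (rule order_trans[OF C(2) mult_right_mono[OF D(1)]]) simp
    show "norm (ift u x) \<le> D"
      using mult_left_mono[OF decay_le_1, of D x] D by (intro order_trans[OF 1]) auto
  qed
qed

lemma asum_int_symmetric_limit:
  fixes a :: "int \<Rightarrow> complex"
  assumes "asummable a"
  shows "(\<lambda>N. \<Sum>n=-int N..int N. a n) \<longlonglongrightarrow> asum a"
proof -
  have a: "Infinite_Set_Sum.abs_summable_on a UNIV" using assms by (simp add: abs_summable_on_def)
  then have "a summable_on UNIV"
    using abs_summable_equivalent abs_summable_summable by blast
  then have "(sum a \<longlongrightarrow> infsum a UNIV) (finite_subsets_at_top UNIV)"
    by (simp add: has_sum_infsum flip: has_sum_def)
  moreover have "filterlim (\<lambda>N::nat. {-int N..int N}) (finite_subsets_at_top UNIV) sequentially"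
    unfolding filterlim_finite_subsets_at_top
  proof (intro allI impI, elim conjE)
    fix X :: "int set" assume X: "finite X"
    define m where "m = Max (insert 0 (abs ` X))"
    have "\<bar>x\<bar> \<le> m" if "x \<in> X" for x unfolding m_def using X that by (intro Max_ge) auto
    then have "X \<subseteq> {-int N..int N}" if "N \<ge> nat m" for N using that by fastforce
    then show "\<forall>\<^sub>F N in sequentially. finite {-int N..int N} \<and> X \<subseteq> {-int N..int N} \<and> {-int N..int N} \<subseteq> UNIV"
      unfolding eventually_sequentially by auto
  qed
  ultimately have "(\<lambda>N. sum a {-int N..int N}) \<longlonglongrightarrow> infsum a UNIV"
    by (rule filterlim_compose)
  also have "infsum a UNIV = asum a" using infsetsum_infsum[OF a] by (simp add: infsetsum_def)
  finally show ?thesis .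
qed

lemma sum_telescope_symmetric:
  fixes P :: "int \<Rightarrow> 'a::ab_group_add"
  shows "(\<Sum>n=-int N..int N. P (n + 1) - P n) = P (int N + 1) - P (- int N)"
proof (induction N)
  case (Suc N)
  have "{-int (Suc N)..int (Suc N)} = insert (- int (Suc N)) (insert (int (Suc N)) {-int N..int N})" by auto
  then have "(\<Sum>n=-int (Suc N)..int (Suc N). P (n + 1) - P n) =
     (P (- int (Suc N) + 1) - P (- int (Suc N))) + (P (int (Suc N) + 1) - P (int (Suc N))) + (P (int N + 1) - P (- int N))"
    using Suc by (simp add: add.assoc)
  moreover have "- int (Suc N) + 1 = - int N" "int N + 1 = int (Suc N)" by simp_all
  ultimately show ?case by (simp only:) simp
qed simp

section \<open>Fourier series and Parseval identity for integer translates\<close>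

text \<open>Integration by parts gives decay \<open>O(1/\<bar>s\<bar>)\<close> for polynomials, and these
  are uniformly dense by the Stone-Weierstrass theorem.\<close>

lemma Riemann_Lebesgue_interval:
  fixes v :: "real \<Rightarrow> complex"
  assumes c: "continuous_on {a..b} v" and ab: "a \<le> b" and e: "e > 0"
  obtains S where "\<And>s. \<bar>s\<bar> \<ge> S \<Longrightarrow> norm (LINT t|lborel. indicator {a..b} t *\<^sub>R (v t * cis (s * t))) < e"
proof -
  define d where "d = e / (2 * (b - a + 1))"
  have d: "d > 0" using e ab by (simp add: d_def)
  obtain p where p: "polynomial_function p" and vp: "\<And>t. t \<in> {a..b} \<Longrightarrow> norm (v t - p t) < d"
    using Stone_Weierstrass_polynomial_function[OF compact_Icc c d] by blast
  obtain p' where p': "polynomial_function p'" "\<And>x. (p has_vector_derivative (p' x)) (at x)"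
    using has_vector_derivative_polynomial_function[OF p] by blast
  have cp: "continuous_on {a..b} p" "continuous_on {a..b} p'"
    using p p' by (auto intro: continuous_on_polymonial_function)
  define I where "I = (\<lambda>f::real \<Rightarrow> complex. LINT t|lborel. indicator {a..b} t *\<^sub>R f t)"
  have int: "integrable lborel (\<lambda>t. indicator {a..b} t *\<^sub>R f t)" if "continuous_on {a..b} f" for f :: "real \<Rightarrow> complex"
    using borel_integrable_atLeastAtMost'[OF that] by (simp add: set_integrable_def)
  define B where "B = norm (p b) + norm (p a) + (LINT t|lborel. norm (indicator {a..b} t *\<^sub>R p' t))"
  have IB: "norm (I (\<lambda>t. p t * cis (s * t))) * \<bar>s\<bar> \<le> B" for s
  proof -
    define g where "g = (\<lambda>t. p t * (\<i> * s * cis (s * t)) + p' t * cis (s * t))"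
    have "I g = p b * cis (s * b) - p a * cis (s * a)"
      unfolding I_def g_def
    proof (rule integral_FTC_Icc[OF ab])
      fix t show "((\<lambda>t. p t * cis (s * t)) has_vector_derivative
         p t * (\<i> * s * cis (s * t)) + p' t * cis (s * t)) (at t within {a..b})"
        by (rule derivative_eq_intros has_vector_derivative_at_within[OF p'(2)] has_vector_derivative_cis refl)+
    qed (intro continuous_intros cp)
    moreover have "I g = \<i> * s * I (\<lambda>t. p t * cis (s * t)) + I (\<lambda>t. p' t * cis (s * t))"
    proof -
      have "I g = I (\<lambda>t. (\<i> * s) * (p t * cis (s * t))) + I (\<lambda>t. p' t * cis (s * t))"
        unfolding I_def g_def scaleR_add_right
        by (subst Bochner_Integration.integral_add[symmetric])
           (auto intro!: int continuous_intros cp simp: mult_ac)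
      then show ?thesis by (simp add: I_def flip: mult_scaleR_right)
    qed
    ultimately have "\<i> * s * I (\<lambda>t. p t * cis (s * t)) = p b * cis (s * b) - p a * cis (s * a) - I (\<lambda>t. p' t * cis (s * t))"
      by (simp add: algebra_simps)
    then have "norm (\<i> * s * I (\<lambda>t. p t * cis (s * t))) \<le> norm (p b) + norm (p a) + norm (I (\<lambda>t. p' t * cis (s * t)))"
      by (simp only:) (intro order_trans[OF norm_triangle_ineq4] add_mono; simp add: norm_mult)
    moreover have "norm (I (\<lambda>t. p' t * cis (s * t))) \<le> (LINT t|lborel. norm (indicator {a..b} t *\<^sub>R p' t))"
      unfolding I_def by (rule order_trans[OF integral_norm_bound]) (simp add: norm_mult)
    ultimately show ?thesis by (simp add: norm_mult B_def mult.commute)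
  qed
  have B0: "B \<ge> 0" by (simp add: B_def)
  show ?thesis
  proof (rule that[of "2 * (B + 1) / e"])
    fix s :: real assume s: "\<bar>s\<bar> \<ge> 2 * (B + 1) / e"
    then have s0: "\<bar>s\<bar> > 0" using B0 e by (smt (verit) divide_pos_pos)
    have "norm (I (\<lambda>t. p t * cis (s * t))) * \<bar>s\<bar> < e / 2 * \<bar>s\<bar>"
      using s e by (intro order.strict_trans1[OF IB]) (auto simp: field_simps)
    then have 1: "norm (I (\<lambda>t. p t * cis (s * t))) < e / 2" using s0 by simp
    have "I (\<lambda>t. v t * cis (s * t)) - I (\<lambda>t. p t * cis (s * t)) = I (\<lambda>t. (v t - p t) * cis (s * t))"
      unfolding I_def by (subst Bochner_Integration.integral_diff[symmetric])
        (auto intro!: int continuous_intros cp c simp: algebra_simps)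
    also have "norm \<dots> \<le> (LINT t|lborel. norm (indicator {a..b} t *\<^sub>R ((v t - p t) * cis (s * t))))"
      unfolding I_def by (rule integral_norm_bound)
    also have "\<dots> \<le> (LINT t|lborel. indicator {a..b} t * d)"
      using vp d by (intro integral_mono integrable_norm int continuous_intros cp c integrable_mult_left integrable_real_indicator)
        (auto simp: norm_mult indicator_def less_imp_le emeasure_lborel_Icc ab simp del: indicator_simps)
    also have "\<dots> = d * (b - a)" using ab by simp
    also have "\<dots> \<le> e / 2" using e ab by (simp add: d_def field_simps)
    finally have 2: "norm (I (\<lambda>t. v t * cis (s * t)) - I (\<lambda>t. p t * cis (s * t))) \<le> e / 2" .
    have "norm (I (\<lambda>t. v t * cis (s * t))) < e"
      using norm_triangle_ineq[of "I (\<lambda>t. v t * cis (s * t)) - I (\<lambda>t. p t * cis (s * t))" "I (\<lambda>t. p t * cis (s * t))"] 1 2 by simp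
    then show "norm (LINT t|lborel. indicator {a..b} t *\<^sub>R (v t * cis (s * t))) < e"
      by (simp add: I_def)
  qed
qed

lemma integral_cis_period:
  "(LINT t|lborel. indicator {-1/2..1/2} t *\<^sub>R cis (2 * pi * of_int n * (t - r))) = (if n = 0 then 1 else 0)"
proof (cases "n = 0")
  case False
  define a where "a = 2 * pi * of_int n"
  have a: "a \<noteq> 0" using False by (simp add: a_def)
  define G where "G = (\<lambda>t. cis (- a * r) / (\<i> * a) * cis (a * t))"
  have "(LINT t|lborel. indicator {-1/2..1/2} t *\<^sub>R cis (2 * pi * of_int n * (t - r))) = G (1/2) - G (-1/2)"
  proof (rule integral_FTC_Icc)
    fix t
    have "cis (2 * pi * of_int n * (t - r)) = cis (- a * r) * cis (a * t)"
      unfolding a_def cis_mult by (rule arg_cong[of _ _ cis]) (simp add: algebra_simps)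
    moreover have "(G has_vector_derivative cis (- a * r) / (\<i> * a) * (\<i> * a * cis (a * t))) (at t within {-1/2..1/2})"
      unfolding G_def by (intro has_vector_derivative_mult_right has_vector_derivative_cis)
    ultimately show "(G has_vector_derivative cis (2 * pi * of_int n * (t - r))) (at t within {-1/2..1/2})"
      using a by simp
  qed (auto intro!: continuous_intros)
  also have "cis (a * (1/2)) = cis (a * (-1/2)) * cis (2 * pi * of_int n)"
    unfolding cis_mult by (rule arg_cong[of _ _ cis]) (simp add: a_def)
  then have "G (1/2) = G (-1/2)" unfolding G_def by (simp only: cis_multiple_2pi Ints_of_int mult_1_right)
  finally show ?thesis using False by simp
qed simp

lemma difference_quotient_tendsto:
  fixes f :: "real \<Rightarrow> 'b::real_normed_vector"
  assumes "(f has_vector_derivative D) (at x)"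
  shows "((\<lambda>t. (f t - f x) /\<^sub>R (t - x)) \<longlongrightarrow> D) (at x)"
proof -
  have "((\<lambda>t. norm (f t - f x - (t - x) *\<^sub>R D) / norm (t - x)) \<longlongrightarrow> 0) (at x)"
    using assms unfolding has_vector_derivative_def has_derivative_iff_norm by blast
  also have "?this \<longleftrightarrow> ((\<lambda>t. norm ((f t - f x) /\<^sub>R (t - x) - D)) \<longlongrightarrow> 0) (at x)"
  proof (intro filterlim_cong refl)
    have "norm (f t - f x - (t - x) *\<^sub>R D) / norm (t - x) = norm ((f t - f x) /\<^sub>R (t - x) - D)" if "t \<noteq> x" for t
    proof -
      have "f t - f x - (t - x) *\<^sub>R D = (t - x) *\<^sub>R ((f t - f x) /\<^sub>R (t - x) - D)"
        using that by (simp add: scaleR_diff_right)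
      then show ?thesis using that by simp
    qed
    then show "\<forall>\<^sub>F t in at x. norm (f t - f x - (t - x) *\<^sub>R D) / norm (t - x) = norm ((f t - f x) /\<^sub>R (t - x) - D)"
      by (simp add: eventually_at_filter)
  qed
  finally show ?thesis using tendsto_norm_zero_iff LIM_zero_iff by blast
qed

text \<open>Chernoff's argument: \<open>v(t) = (u(t) - u(\<xi>)) / (cis(2\<pi>(t - \<xi>)) - 1)\<close> extends continuously over
  \<open>t = \<xi>\<close>, and the Fourier coefficients of \<open>u - u(\<xi>)\<close> are the differences of consecutive coefficients
  of \<open>v\<close>. The symmetric partial sums of the series of \<open>u - u(\<xi>)\<close> at \<open>\<xi>\<close> thus telescope to two
  coefficients of \<open>v\<close>, which tend to \<open>0\<close> by the Riemann-Lebesgue lemma.\<close>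

lemma fourier_series:
  fixes u :: "real \<Rightarrow> complex"
  assumes u: "bump (1/4) u" and xi: "\<bar>\<xi>\<bar> \<le> 1/4"
  shows "asummable (\<lambda>n::int. ift u (- of_int n))"
    and "asum (\<lambda>n::int. ift u (- of_int n) * cis (2 * pi * of_int n * \<xi>)) = u \<xi>"
proof -
  obtain C where C: "C > 0" "\<And>x. norm (ift u x) \<le> C * decay x" using ift_decay[OF u] by blast
  have Cs: "asummable (\<lambda>n::int. C * decay (- of_int n))"
    using asummable_decay(1)[of 0] by simp
  show "asummable (\<lambda>n::int. ift u (- of_int n))"
    by (rule asummable_bound[OF Cs C(2)])
  define b where "b = (\<lambda>n::int. ift u (- of_int n) * cis (2 * pi * of_int n * \<xi>))"
  have sb: "asummable b"
    by (rule asummable_bound[OF Cs]) (use C(2)[of "- of_int n" for n] in \<open>simp add: b_def norm_mult\<close>)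
  let ?T = "{-1/2..1/2::real}"
  obtain u' u'' where u': "\<And>t. (u has_vector_derivative u' t) (at t)"
    using u unfolding bump_def C2_def by blast
  define E where "E = (\<lambda>t. cis (2 * pi * (t - \<xi>)))"
  have E': "(E has_vector_derivative (\<i> * complex_of_real (2 * pi))) (at \<xi>)"
  proof -
    have "((\<lambda>t. cis (2 * pi * t) * cis (- 2 * pi * \<xi>)) has_vector_derivative
       (\<i> * complex_of_real (2 * pi) * cis (2 * pi * \<xi>)) * cis (- 2 * pi * \<xi>)) (at \<xi>)"
      by (intro has_vector_derivative_mult_left has_vector_derivative_cis)
    moreover have "(\<lambda>t. cis (2 * pi * t) * cis (- 2 * pi * \<xi>)) = E"
      by (auto simp: E_def cis_mult algebra_simps)
    moreover have "(\<i> * complex_of_real (2 * pi) * cis (2 * pi * \<xi>)) * cis (- 2 * pi * \<xi>) = \<i> * complex_of_real (2 * pi)"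
      unfolding mult.assoc cis_mult by simp
    ultimately show ?thesis by (simp only:)
  qed
  \<comment> \<open>On the period interval \<open>?T\<close> the distance to \<open>\<xi>\<close> stays below \<open>1\<close>.\<close>
  have E1: "E t \<noteq> 1" if "t \<in> ?T" "t \<noteq> \<xi>" for t
  proof
    assume "E t = 1"
    then have "cos (2 * pi * (t - \<xi>)) = 1" by (simp add: E_def complex_eq_iff)
    then obtain m :: int where "2 * pi * (t - \<xi>) = of_int m * 2 * pi"
      using cos_one_2pi_int by blast
    then have "t - \<xi> = of_int m" by simp
    moreover have "\<bar>t - \<xi>\<bar> < 1" using that xi by (auto simp: abs_if split: if_splits)
    moreover have "t - \<xi> \<noteq> 0" using that by simp
    ultimately show False by simp
  qed
  define v where "v = (\<lambda>t. if t = \<xi> then u' \<xi> / (\<i> * complex_of_real (2 * pi)) else (u t - u \<xi>) / (E t - 1))"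
  have vE: "v t * (E t - 1) = u t - u \<xi>" if "t \<in> ?T" for t
  proof (cases "t = \<xi>")
    case True
    then show ?thesis by (simp add: E_def)
  next
    case False
    with E1[OF that False] show ?thesis by (simp add: v_def)
  qed
  have cE: "continuous_on S E" for S unfolding E_def by (intro continuous_intros)
  have cu: "continuous_on S u" for S using bump_continuous[OF u] continuous_on_subset by blast
  have cv: "continuous_on ?T v"
    unfolding continuous_on_eq_continuous_within
  proof
    fix t assume t: "t \<in> ?T"
    show "continuous (at t within ?T) v"
    proof (cases "t = \<xi>")
      case True
      have "((\<lambda>t. ((u t - u \<xi>) /\<^sub>R (t - \<xi>)) / ((E t - E \<xi>) /\<^sub>R (t - \<xi>)))
          \<longlongrightarrow> u' \<xi> / (\<i> * complex_of_real (2 * pi))) (at \<xi> within ?T)"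
        by (intro tendsto_divide tendsto_within_subset[OF difference_quotient_tendsto[OF u']]
            tendsto_within_subset[OF difference_quotient_tendsto[OF E']]) auto
      also have "?this \<longleftrightarrow> (v \<longlongrightarrow> u' \<xi> / (\<i> * complex_of_real (2 * pi))) (at \<xi> within ?T)"
      proof (intro filterlim_cong refl)
        have "((u t - u \<xi>) /\<^sub>R (t - \<xi>)) / ((E t - E \<xi>) /\<^sub>R (t - \<xi>)) = v t" if "t \<noteq> \<xi>" for t
        proof -
          have "E \<xi> = 1" by (simp add: E_def)
          then show ?thesis using that by (simp add: v_def scaleR_conv_of_real)
        qed
        then show "\<forall>\<^sub>F t in at \<xi> within ?T. ((u t - u \<xi>) /\<^sub>R (t - \<xi>)) / ((E t - E \<xi>) /\<^sub>R (t - \<xi>)) = v t"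
          by (simp add: eventually_at_filter)
      qed
      finally show ?thesis using True by (simp add: continuous_within v_def)
    next
      case False
      have "continuous (at t within ?T) (\<lambda>t. (u t - u \<xi>) / (E t - 1))"
        using cE[of ?T] cu[of ?T] t E1[OF t False]
        by (intro continuous_intros) (auto simp: continuous_on_eq_continuous_within)
      then show ?thesis
      proof (rule continuous_transform_within[where \<delta> = "\<bar>t - \<xi>\<bar>"])
        fix s assume "dist s t < \<bar>t - \<xi>\<bar>"
        then show "(u s - u \<xi>) / (E s - 1) = v s" by (auto simp: v_def dist_real_def)
      qed (use t False in auto)
    qed
  qed
  define I where "I = (\<lambda>f::real \<Rightarrow> complex. LINT t|lborel. indicator ?T t *\<^sub>R f t)"
  have int: "integrable lborel (\<lambda>t. indicator ?T t *\<^sub>R f t)" if "continuous_on ?T f" for f :: "real \<Rightarrow> complex"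
    using borel_integrable_atLeastAtMost'[OF that] by (simp add: set_integrable_def)
  define d where "d = (\<lambda>n::int. I (\<lambda>t. v t * cis (2 * pi * of_int (-n) * (t - \<xi>))))"
  have tele: "b n - (if n = 0 then u \<xi> else 0) = d (n - 1) - d n" for n
  proof -
    let ?e = "\<lambda>n::int. \<lambda>t. cis (2 * pi * of_int (-n) * (t - \<xi>))"
    have "b n = (LINT t|lborel. u t * ?e n t)"
      unfolding b_def ift_def integral_mult_left_zero[symmetric] mult.assoc cis_mult
      by (intro Bochner_Integration.integral_cong refl arg_cong2[of _ _ _ _ "(*)"] arg_cong[of _ _ cis])
        (simp add: algebra_simps)
    also have "\<dots> = I (\<lambda>t. u t * ?e n t)"
      unfolding I_def
      by (intro Bochner_Integration.integral_cong) (use bump_zero[OF u] in \<open>force simp: indicator_def\<close>)+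
    finally have 1: "b n = I (\<lambda>t. u t * ?e n t)" .
    have "I (\<lambda>t. ?e n t) = (if n = 0 then 1 else 0)"
      unfolding I_def using integral_cis_period[of "-n" \<xi>] by simp
    then have "I (\<lambda>t. u \<xi> * ?e n t) = (if n = 0 then u \<xi> else 0)"
      by (simp add: I_def flip: mult_scaleR_right)
    then have "b n - (if n = 0 then u \<xi> else 0) = I (\<lambda>t. u t * ?e n t) - I (\<lambda>t. u \<xi> * ?e n t)"
      using 1 by simp
    also have "\<dots> = I (\<lambda>t. (u t - u \<xi>) * ?e n t)"
      unfolding I_def by (subst Bochner_Integration.integral_diff[symmetric],
          (intro int continuous_intros cu)+, simp add: algebra_simps)
    also have "\<dots> = I (\<lambda>t. v t * ?e (n - 1) t - v t * ?e n t)"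
      unfolding I_def
    proof (intro Bochner_Integration.integral_cong refl)
      fix t
      have "E t * ?e n t = ?e (n - 1) t"
        unfolding E_def cis_mult by (rule arg_cong[of _ _ cis]) (simp add: algebra_simps)
      then show "indicator ?T t *\<^sub>R ((u t - u \<xi>) * ?e n t) = indicator ?T t *\<^sub>R (v t * ?e (n - 1) t - v t * ?e n t)"
      proof (cases "t \<in> ?T")
        case True
        have "(u t - u \<xi>) * ?e n t = v t * (E t * ?e n t) - v t * ?e n t"
          unfolding vE[OF True, symmetric] by (simp only: left_diff_distrib right_diff_distrib mult.assoc mult_1_left mult_1_right)
        then show ?thesis unfolding \<open>E t * ?e n t = ?e (n - 1) t\<close> by (simp only:)
      qed simp
    qed
    also have "\<dots> = d (n - 1) - d n"
      unfolding I_def d_def by (subst Bochner_Integration.integral_diff[symmetric],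
          (intro int continuous_intros cv)+, simp only: scaleR_diff_right)
    finally show ?thesis .
  qed
  have part: "(\<Sum>n=-int N..int N. b n) - u \<xi> = d (- int N - 1) - d (int N)" for N
  proof -
    have "(\<Sum>n=-int N..int N. b n) - u \<xi> = (\<Sum>n=-int N..int N. b n - (if n = 0 then u \<xi> else 0))"
      by (simp add: sum_subtractf)
    also have "\<dots> = (\<Sum>n=-int N..int N. (- d (n + 1 - 1)) - (- d (n - 1)))"
      unfolding tele by simp
    also have "\<dots> = d (- int N - 1) - d (int N)"
      by (subst sum_telescope_symmetric[of "\<lambda>n. - d (n - 1)"]) simp
    finally show ?thesis .
  qed
  \<comment> \<open>Both ends of the telescoped sum have frequencies tending to infinity.\<close>
  have dlim: "(\<lambda>N. d (f N)) \<longlonglongrightarrow> 0" if f: "\<And>N. real_of_int \<bar>f N\<bar> \<ge> real N" for f :: "nat \<Rightarrow> int"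
  proof (rule LIMSEQ_I)
    fix e :: real assume e: "e > 0"
    have "-1/2 \<le> (1/2::real)" by simp
    from Riemann_Lebesgue_interval[OF cv this e]
    obtain S where S: "\<And>s. \<bar>s\<bar> \<ge> S \<Longrightarrow> norm (LINT t|lborel. indicator ?T t *\<^sub>R (v t * cis (s * t))) < e"
      by blast
    have "norm (d (f N) - 0) < e" if "N \<ge> nat \<lceil>S\<rceil>" for N
    proof -
      let ?s = "2 * pi * of_int (- f N)"
      have "d (f N) = I (\<lambda>t. cis (- ?s * \<xi>) * (v t * cis (?s * t)))"
        unfolding d_def by (rule arg_cong[of _ _ I]) (auto simp: cis_mult algebra_simps)
      also have "\<dots> = cis (- ?s * \<xi>) * I (\<lambda>t. v t * cis (?s * t))"
        by (simp only: I_def integral_mult_right_zero flip: mult_scaleR_right)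
      finally have "norm (d (f N)) = norm (I (\<lambda>t. v t * cis (?s * t)))" by (simp only: norm_mult norm_cis mult_1)
      also have "\<dots> < e" unfolding I_def
      proof (rule S)
        have "S \<le> 1 * real N" using that by linarith
        also have "\<dots> \<le> (2 * pi) * real_of_int \<bar>f N\<bar>"
          using pi_gt3 f[of N] by (intro mult_mono) auto
        finally show "S \<le> \<bar>?s\<bar>" by (simp add: abs_mult)
      qed
      finally show ?thesis by simp
    qed
    then show "\<exists>no. \<forall>n\<ge>no. norm (d (f n) - 0) < e" by blast
  qed
  have "(\<lambda>N. d (- int N - 1) - d (int N)) \<longlonglongrightarrow> 0 - 0"
    by (intro tendsto_diff dlim) auto
  then have "(\<lambda>N. (\<Sum>n=-int N..int N. b n) - u \<xi>) \<longlonglongrightarrow> 0" by (simp add: part)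
  then have "(\<lambda>N. \<Sum>n=-int N..int N. b n) \<longlonglongrightarrow> u \<xi>" by (rule LIM_zero_cancel)
  with asum_int_symmetric_limit[OF sb] have "asum b = u \<xi>" by (rule LIMSEQ_unique)
  then show "asum (\<lambda>n::int. ift u (- of_int n) * cis (2 * pi * of_int n * \<xi>)) = u \<xi>"
    by (simp add: b_def)
qed

lemma fourier_series_shifted:
  assumes u: "bump (1/4) u" and xi: "\<bar>\<xi>\<bar> \<le> 1/4"
  shows "asum (\<lambda>n::int. ift u (x - of_int n) * cis (2 * pi * of_int n * \<xi>)) = u \<xi> * cis (2 * pi * x * \<xi>)"
proof -
  have "ift (\<lambda>t. u t * cis (2 * pi * x * t)) (- of_int n) = ift u (x - of_int n)" for n :: int
    unfolding ift_modulate by simp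
  then show ?thesis
    using fourier_series(2)[OF bump_modulate[OF u, of "2 * pi * x"] xi] by (simp only:)
qed

text \<open>The values \<open>ift v (y - n)\<close> are the Fourier coefficients of \<open>v(t)
  cis(2\<pi>yt)\<close> on a period, so summing the series under the integral that defines
  \<open>ift u (x - n)\<close> puts \<open>v\<close> back. It is essential that the supports fit
  into one period.\<close>

lemma shannon_parseval:
  assumes u: "bump (1/4) u" and v: "bump (1/4) v"
  shows "asum (\<lambda>n::int. ift u (x - of_int n) * cnj (ift v (y - of_int n))) = ift (\<lambda>t. u t * cnj (v t)) (x - y)"
proof -
  obtain C where C: "C > 0" "\<And>x. norm (ift v x) \<le> C * decay x" using ift_decay[OF v] by blast
  define F where "F = (\<lambda>(n::int) t. u t * cis (2 * pi * (x - of_int n) * t) * cnj (ift v (y - of_int n)))"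
  note [measurable] = bump_measurable[OF u] bump_measurable[OF v]
  have [measurable]: "F n \<in> borel_measurable lborel" for n unfolding F_def by measurable
  define A where "A = (LINT t|lborel. norm (u t))"
  have A: "A \<ge> 0" by (simp add: A_def)
  have int: "integrable lborel (F n)" for n
    unfolding F_def by (intro integrable_mult_left integrable_mult_cis bump_integrable[OF u]) auto
  have bound: "(\<integral>\<^sup>+t. ennreal (norm (F n t)) \<partial>lborel) \<le> ennreal (A * C * decay (y - of_int n))" for n
  proof (rule nn_integral_le_of_integral[OF int])
    have "(LINT t|lborel. norm (F n t)) = A * norm (ift v (y - of_int n))"
      unfolding F_def by (simp add: norm_mult A_def)
    also have "\<dots> \<le> A * C * decay (y - of_int n)"
      unfolding mult.assoc by (intro mult_left_mono C A)
    finally show "(LINT t|lborel. norm (F n t)) \<le> A * C * decay (y - of_int n)" .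
  qed
  have B: "asummable (\<lambda>n::int. A * C * decay (y - of_int n))"
    by (intro integrable_mult_right asummable_decay)
  have "asum (\<lambda>n::int. ift u (x - of_int n) * cnj (ift v (y - of_int n))) = asum (\<lambda>n. LINT t|lborel. F n t)"
    unfolding F_def ift_def by (simp only: integral_mult_left_zero)
  also have "\<dots> = (LINT t|lborel. asum (\<lambda>n. F n t))"
    by (rule asum_integral_swap(2)[OF lborel.sigma_finite_measure_axioms _ bound B, symmetric]) auto
  also have "\<dots> = ift (\<lambda>t. u t * cnj (v t)) (x - y)"
    unfolding ift_def[of "\<lambda>t. u t * cnj (v t)"]
  proof (intro Bochner_Integration.integral_cong refl)
    fix t
    show "asum (\<lambda>n. F n t) = u t * cnj (v t) * cis (2 * pi * (x - y) * t)"
    proof (cases "\<bar>t\<bar> \<le> 1/4")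
      case True
      have "asum (\<lambda>n. F n t) = asum (\<lambda>n::int. u t * cis (2 * pi * x * t) * cnj (ift v (y - of_int n) * cis (2 * pi * of_int n * t)))"
      proof (intro Bochner_Integration.integral_cong refl)
        fix n :: int
        have "cis (2 * pi * (x - of_int n) * t) = cis (2 * pi * x * t) * cnj (cis (2 * pi * of_int n * t))"
          unfolding cis_cnj cis_mult by (rule arg_cong[of _ _ cis]) (simp add: algebra_simps)
        then show "F n t = u t * cis (2 * pi * x * t) * cnj (ift v (y - of_int n) * cis (2 * pi * of_int n * t))"
          by (simp add: F_def)
      qed
      also have "\<dots> = u t * cis (2 * pi * x * t) * cnj (asum (\<lambda>n::int. ift v (y - of_int n) * cis (2 * pi * of_int n * t)))"
        by (simp only: integral_mult_right_zero Bochner_Integration.integral_cnj)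
      also have "\<dots> = u t * cis (2 * pi * x * t) * cnj (v t * cis (2 * pi * y * t))"
        by (simp only: fourier_series_shifted[OF v True])
      also have "\<dots> = u t * cnj (v t) * (cis (2 * pi * x * t) * cnj (cis (2 * pi * y * t)))" by simp
      also have "cis (2 * pi * x * t) * cnj (cis (2 * pi * y * t)) = cis (2 * pi * (x - y) * t)"
        unfolding cis_cnj cis_mult by (rule arg_cong[of _ _ cis]) (simp add: algebra_simps)
      finally show ?thesis .
    next
      case False
      then have "u t = 0" by (intro bump_zero[OF u]) auto
      then show ?thesis by (simp add: F_def)
    qed
  qed
  finally show ?thesis .
qed

section \<open>Fourier inversion and the Plancherel identity for smooth functions\<close>

lemma integral_periodization:
  fixes g :: "real \<Rightarrow> complex"
  assumes [measurable]: "g \<in> borel_measurable borel" and g: "\<And>x. norm (g x) \<le> C * decay x"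
  shows "(LINT x|lborel. g x) = (LINT x|lborel. indicator {0..<1} x *\<^sub>R asum (\<lambda>n::int. g (x - of_int n)))"
proof -
  define F where "F = (\<lambda>(n::int) x::real. indicator {0..<1} x *\<^sub>R g (x - of_int n))"
  define G where "G = (\<lambda>(n::int) x::real. indicator {0..<1} (x + of_int n) *\<^sub>R g x)"
  have "norm (g 0) \<le> C" using g[of 0] by (simp add: decay_def)
  then have C: "C \<ge> 0" by (rule order_trans[OF norm_ge_zero])
  have [measurable]: "F n \<in> borel_measurable borel" "G n \<in> borel_measurable borel" for n
    unfolding F_def G_def by measurable
  have FG: "F n = (\<lambda>x. G n (- of_int n + 1 * x))" for n by (auto simp: F_def G_def)
  have F: "(\<integral>\<^sup>+x. ennreal (norm (F n x)) \<partial>lborel) \<le> ennreal (C * 3 * decay (0 - of_int n))" for n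
  proof -
    have "norm (F n x) \<le> C * 3 * decay (0 - of_int n) * indicator {0..1} x" for x
      using order_trans[OF g mult_left_mono[OF decay_unit_shift C], of x "of_int n"]
      using C by (auto simp: F_def indicator_def)
    then have "(\<integral>\<^sup>+x. ennreal (norm (F n x)) \<partial>lborel) \<le> (\<integral>\<^sup>+x. ennreal (C * 3 * decay (0 - of_int n)) * indicator {0..1::real} x \<partial>lborel)"
    proof (intro nn_integral_mono)
      fix x assume "\<And>x. norm (F n x) \<le> C * 3 * decay (0 - of_int n) * indicator {0..1} x"
      from ennreal_leI[OF this[of x]]
      show "ennreal (norm (F n x)) \<le> ennreal (C * 3 * decay (0 - of_int n)) * indicator {0..1} x"
        by (cases "x \<in> {0..1}") auto
    qed
    also have "\<dots> = ennreal (C * 3 * decay (0 - of_int n))"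
      by (subst nn_integral_cmult_indicator) auto
    finally show ?thesis .
  qed
  have G: "(\<integral>\<^sup>+x. ennreal (norm (G n x)) \<partial>lborel) \<le> ennreal (C * 3 * decay (0 - of_int n))" for n
    using F[of n] unfolding FG by (subst nn_integral_real_affine[where c=1 and t="- of_int n"]) auto
  have B: "asummable (\<lambda>n::int. C * 3 * decay (0 - of_int n))"
    by (intro integrable_mult_right asummable_decay)
  have sf: "sigma_finite_measure (lborel::real measure)" by (rule lborel.sigma_finite_measure_axioms)
  \<comment> \<open>Exactly one translate of the unit interval contains \<open>x\<close>.\<close>
  have "asum (\<lambda>n. G n x) = g x" for x
  proof -
    have "(\<lambda>n. G n x) = (\<lambda>n. if n = - \<lfloor>x\<rfloor> then g x else 0)"
    proof
      fix n
      have "0 \<le> x + of_int n \<and> x + of_int n < 1 \<longleftrightarrow> n = - \<lfloor>x\<rfloor>" by linarith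
      then show "G n x = (if n = - \<lfloor>x\<rfloor> then g x else 0)" by (simp add: G_def indicator_def)
    qed
    then show ?thesis by (simp only: asum_single)
  qed
  then have "(LINT x|lborel. g x) = (LINT x|lborel. asum (\<lambda>n. G n x))" by simp
  also have "\<dots> = asum (\<lambda>n. LINT x|lborel. G n x)"
    by (rule asum_integral_swap(2)[OF sf _ G B]) auto
  also have "\<dots> = asum (\<lambda>n. LINT x|lborel. F n x)"
  proof (rule arg_cong[of _ _ asum], rule ext)
    fix n show "(LINT x|lborel. G n x) = (LINT x|lborel. F n x)"
      unfolding FG by (subst lborel_integral_real_affine[where c=1 and t="- of_int n"]) auto
  qed
  also have "\<dots> = (LINT x|lborel. asum (\<lambda>n. F n x))"
    by (rule asum_integral_swap(2)[OF sf _ F B, symmetric]) auto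
  also have "\<dots> = (LINT x|lborel. indicator {0..<1} x *\<^sub>R asum (\<lambda>n::int. g (x - of_int n)))"
    by (intro Bochner_Integration.integral_cong refl) (simp add: F_def)
  finally show ?thesis .
qed

text \<open>Cutting the line into unit intervals turns the integral into the Fourier series of
  \<open>v\<close>, whose sum at \<open>\<xi>\<close> is the same for every point of the unit
  interval.\<close>

lemma fourier_inversion_unit:
  assumes v: "bump (1/4) v" and xi: "\<bar>\<xi>\<bar> \<le> 1/4"
  shows "(LINT x|lborel. ift v x * cis (- 2 * pi * x * \<xi>)) = v \<xi>"
proof -
  obtain C where C: "C > 0" "\<And>x. norm (ift v x) \<le> C * decay x" using ift_decay[OF v] by blast
  note [measurable] = bump_measurable[OF v]
  have "(LINT x|lborel. ift v x * cis (- 2 * pi * x * \<xi>)) =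
     (LINT x|lborel. indicator {0..<1} x *\<^sub>R asum (\<lambda>n::int. ift v (x - of_int n) * cis (- 2 * pi * (x - of_int n) * \<xi>)))"
    by (rule integral_periodization[where C=C]) (use C(2) in \<open>simp_all add: norm_mult\<close>)
  also have "\<dots> = (LINT x|lborel. indicator {0..<1::real} x *\<^sub>R v \<xi>)"
  proof (intro Bochner_Integration.integral_cong refl)
    fix x :: real
    have "asum (\<lambda>n::int. ift v (x - of_int n) * cis (- 2 * pi * (x - of_int n) * \<xi>)) =
      asum (\<lambda>n::int. cis (- 2 * pi * x * \<xi>) * (ift v (x - of_int n) * cis (2 * pi * of_int n * \<xi>)))"
    proof (intro Bochner_Integration.integral_cong refl)
      fix n :: int
      have "cis (- 2 * pi * (x - of_int n) * \<xi>) = cis (- 2 * pi * x * \<xi>) * cis (2 * pi * of_int n * \<xi>)"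
        unfolding cis_mult by (rule arg_cong[of _ _ cis]) (simp add: algebra_simps)
      then show "ift v (x - of_int n) * cis (- 2 * pi * (x - of_int n) * \<xi>) = cis (- 2 * pi * x * \<xi>) * (ift v (x - of_int n) * cis (2 * pi * of_int n * \<xi>))"
        by simp
    qed
    also have "\<dots> = cis (- 2 * pi * x * \<xi>) * (v \<xi> * cis (2 * pi * x * \<xi>))"
      by (simp only: integral_mult_right_zero fourier_series_shifted[OF v xi])
    also have "\<dots> = v \<xi> * (cis (- 2 * pi * x * \<xi>) * cis (2 * pi * x * \<xi>))" by simp
    also have "cis (- 2 * pi * x * \<xi>) * cis (2 * pi * x * \<xi>) = 1" unfolding cis_mult by simp
    finally show "indicator {0..<1} x *\<^sub>R asum (\<lambda>n::int. ift v (x - of_int n) * cis (- 2 * pi * (x - of_int n) * \<xi>)) = indicator {0..<1} x *\<^sub>R v \<xi>"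
      by simp
  qed
  also have "\<dots> = v \<xi>" by simp
  finally show ?thesis .
qed

theorem fourier_inversion:
  assumes v: "bump R v"
  shows "(LINT x|lborel. ift v x * cis (- 2 * pi * x * \<xi>)) = v \<xi>"
proof -
  \<comment> \<open>A dilation by \<open>c\<close> brings both the support and the frequency \<open>\<xi>\<close> into \<open>[-1/4, 1/4]\<close>.\<close>
  define c where "c = 4 * (\<bar>R\<bar> + \<bar>\<xi>\<bar> + 1)"
  have c: "c > 0" by (simp add: c_def)
  have "\<bar>R\<bar> \<le> c / 4" "\<bar>\<xi>\<bar> \<le> c / 4" by (simp_all add: c_def)
  then have R: "R / c \<le> 1/4" and x: "\<bar>\<xi> / c\<bar> \<le> 1/4" using c by (auto simp: field_simps abs_mult)
  have b: "bump (1/4) (\<lambda>t. v (c * t))" using bump_mono[OF bump_dilate[OF v c] R] .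
  have "(LINT x|lborel. ift v x * cis (- 2 * pi * x * \<xi>)) =
    (LINT x|lborel. ift (\<lambda>t. v (c * t)) x * cis (- 2 * pi * x * (\<xi> / c)))"
    using c by (subst lborel_integral_real_affine[where c="1/c" and t=0]) (auto simp: scaleR_conv_of_real ift_dilate)
  also have "\<dots> = v (c * (\<xi> / c))" by (rule fourier_inversion_unit[OF b x])
  finally show ?thesis using c by simp
qed

lemma measurable_fst_real:
  "f \<in> measurable borel M \<Longrightarrow> (\<lambda>p::real \<times> real. f (fst p)) \<in> measurable borel M"
  by (rule measurable_compose[of fst _ borel]) (auto intro!: borel_measurable_continuous_onI continuous_intros)

lemma measurable_snd_real:
  "f \<in> measurable borel M \<Longrightarrow> (\<lambda>p::real \<times> real. f (snd p)) \<in> measurable borel M"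
  by (rule measurable_compose[of snd _ borel]) (auto intro!: borel_measurable_continuous_onI continuous_intros)

lemma integrable_prod_mult:
  fixes f g :: "real \<Rightarrow> 'b::{real_normed_field, banach, second_countable_topology}"
  assumes f: "integrable lborel f" and g: "integrable lborel g"
  shows "integrable lborel (\<lambda>p::real \<times> real. f (fst p) * g (snd p))"
    and "(LINT p|lborel. f (fst p) * g (snd p)) = (LINT x|lborel. f x) * (LINT y|lborel. g y)"
proof -
  note [measurable] = borel_measurable_integrable[OF f] borel_measurable_integrable[OF g]
  have i: "integrable (lborel \<Otimes>\<^sub>M lborel) (\<lambda>p::real \<times> real. f (fst p) * g (snd p))"
    by (rule lborel_pair.Fubini_integrable) (auto simp: norm_mult f g)
  then show "integrable lborel (\<lambda>p::real \<times> real. f (fst p) * g (snd p))" by (simp add: lborel_prod)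
  have "(LINT p|lborel. f (fst p) * g (snd p)) = (LINT x|lborel. LINT y|lborel. f x * g y)"
    using lborel_pair.integral_fst'[OF i] by (simp add: lborel_prod)
  then show "(LINT p|lborel. f (fst p) * g (snd p)) = (LINT x|lborel. f x) * (LINT y|lborel. g y)" by simp
qed

theorem plancherel:
  assumes u: "bump R u" and v: "bump R' v"
  shows "(LINT x|lborel. ift u x * cnj (ift v x)) = (LINT t|lborel. u t * cnj (v t))"
proof -
  note [measurable] = bump_measurable[OF u] bump_measurable[OF v]
  define F where "F = (\<lambda>x t. u t * cis (2 * pi * x * t) * cnj (ift v x))"
  have "integrable lborel (\<lambda>p::real \<times> real. cnj (ift v (fst p)) * u (snd p))"
    by (intro integrable_prod_mult integrable_cnj integrable_ift[OF v] bump_integrable[OF u])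
  then have "integrable lborel (\<lambda>p::real \<times> real. cnj (ift v (fst p)) * u (snd p) * cis (2 * pi * fst p * snd p))"
  proof (rule integrable_mult_bounded[where C=1])
    have "(\<lambda>p::real \<times> real. cis (2 * pi * fst p * snd p)) \<in> borel_measurable borel"
      by (intro borel_measurable_continuous_onI continuous_intros)
    then show "(\<lambda>p::real \<times> real. cis (2 * pi * fst p * snd p)) \<in> borel_measurable lborel" by simp
  qed simp
  moreover have "case_prod F = (\<lambda>p. cnj (ift v (fst p)) * u (snd p) * cis (2 * pi * fst p * snd p))"
    by (auto simp: F_def fun_eq_iff)
  ultimately have i: "integrable (lborel \<Otimes>\<^sub>M lborel) (case_prod F)"
    by (simp only: lborel_prod)
  have "(LINT x|lborel. ift u x * cnj (ift v x)) = (LINT x|lborel. LINT t|lborel. F x t)"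
    unfolding F_def ift_def[of u] by simp
  also have "\<dots> = (LINT t|lborel. LINT x|lborel. F x t)"
    by (rule lborel_pair.Fubini_integral[OF i, symmetric])
  also have "\<dots> = (LINT t|lborel. u t * cnj (v t))"
  proof (intro Bochner_Integration.integral_cong refl)
    fix t
    have "(LINT x|lborel. F x t) = (LINT x|lborel. u t * cnj (ift v x * cis (- 2 * pi * x * t)))"
      unfolding F_def by (intro Bochner_Integration.integral_cong refl) (simp add: cis_cnj)
    also have "\<dots> = u t * cnj (v t)"
      by (simp only: integral_mult_right_zero Bochner_Integration.integral_cnj fourier_inversion[OF v])
    finally show "(LINT x|lborel. F x t) = u t * cnj (v t)" .
  qed
  finally show ?thesis .
qed

section \<open>Inverse Fourier transforms on the plane, dilates and translates\<close>

lemma inv_fourier_prod: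
  assumes u: "integrable lborel u" and v: "integrable lborel v"
  shows "inv_fourier (\<lambda>p. u (fst p) * v (snd p)) x = ift u (fst x) * ift v (snd x)"
proof -
  have "inv_fourier (\<lambda>p. u (fst p) * v (snd p)) x =
     (LINT p|lborel. (u (fst p) * cis (2 * pi * fst x * fst p)) * (v (snd p) * cis (2 * pi * snd x * snd p)))"
    unfolding inv_fourier_def
  proof (intro Bochner_Integration.integral_cong refl)
    fix p :: "real \<times> real"
    have "exp (2 * pi * \<i> * of_real (x \<bullet> p)) = cis (2 * pi * fst x * fst p) * cis (2 * pi * snd x * snd p)"
      unfolding cis_mult by (simp add: cis_conv_exp inner_prod_def algebra_simps)
    then show "u (fst p) * v (snd p) * exp (2 * pi * \<i> * of_real (x \<bullet> p)) =
      (u (fst p) * cis (2 * pi * fst x * fst p)) * (v (snd p) * cis (2 * pi * snd x * snd p))" by simp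
  qed
  also have "\<dots> = ift u (fst x) * ift v (snd x)"
    unfolding ift_def by (intro integrable_prod_mult integrable_mult_cis u v) auto
  finally show ?thesis .
qed

lemma inv_fourier_sum_prod:
  assumes "finite Q" "\<And>q. q \<in> Q \<Longrightarrow> integrable lborel (U q)" "\<And>q. q \<in> Q \<Longrightarrow> integrable lborel (V q)"
  shows "inv_fourier (\<lambda>p. \<Sum>q\<in>Q. U q (fst p) * V q (snd p)) x = (\<Sum>q\<in>Q. ift (U q) (fst x) * ift (V q) (snd x))"
proof -
  have "inv_fourier (\<lambda>p. \<Sum>q\<in>Q. U q (fst p) * V q (snd p)) x =
     (\<Sum>q\<in>Q. inv_fourier (\<lambda>p. U q (fst p) * V q (snd p)) x)"
    unfolding inv_fourier_def sum_distrib_right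
  proof (rule Bochner_Integration.integral_sum)
    fix q assume q: "q \<in> Q"
    have i: "integrable lborel (\<lambda>p::real \<times> real. U q (fst p) * V q (snd p))"
      by (intro integrable_prod_mult assms q)
    show "integrable lborel (\<lambda>p. U q (fst p) * V q (snd p) * exp (2 * pi * \<i> * of_real (x \<bullet> p)))"
    proof (rule integrable_mult_bounded[OF i, where C=1])
      have "(\<lambda>p. exp (2 * pi * \<i> * of_real (x \<bullet> p))) \<in> borel_measurable borel"
        by (intro borel_measurable_continuous_onI continuous_intros)
      then show "(\<lambda>p. exp (2 * pi * \<i> * of_real (x \<bullet> p))) \<in> borel_measurable lborel"
        by simp
    qed simp
  qed
  also have "\<dots> = (\<Sum>q\<in>Q. ift (U q) (fst x) * ift (V q) (snd x))"
    by (intro sum.cong refl inv_fourier_prod assms)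
  finally show ?thesis .
qed

text \<open>One tensor factor of a wavelet at scale \<open>b\<close> and position \<open>k\<close>, with the
  normalisation left out.\<close>

definition atom :: "(real \<Rightarrow> complex) \<Rightarrow> int \<Rightarrow> int \<Rightarrow> real \<Rightarrow> complex" where
  "atom u b k = (\<lambda>x. ift u (2 powi b * x - of_int k))"

text \<open>The Fourier transform of \<open>atom u b k\<close> up to the factor \<open>2^b\<close>.\<close>

definition atom_hat :: "(real \<Rightarrow> complex) \<Rightarrow> int \<Rightarrow> int \<Rightarrow> real \<Rightarrow> complex" where
  "atom_hat u b k = (\<lambda>t. u (t / 2 powi b) * cis (- 2 * pi * of_int k * (t / 2 powi b)))"

lemma bump_atom_hat:
  assumes "bump R u" shows "bump (R * 2 powi b) (atom_hat u b k)"
  using bump_dilate[OF bump_modulate[OF assms, of "- 2 * pi * of_int k"], of "1 / 2 powi b"]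
  by (simp add: atom_hat_def)

lemma ift_atom_hat: "ift (atom_hat u b k) x = 2 powi b * atom u b k x"
proof -
  have "ift (atom_hat u b k) x = ift (\<lambda>t. (\<lambda>t. u t * cis (2 * pi * (- of_int k) * t)) (1 / 2 powi b * t)) x"
    unfolding atom_hat_def by (rule arg_cong2[of _ _ _ _ ift]) auto
  also have "\<dots> = 2 powi b * ift (\<lambda>t. u t * cis (2 * pi * (- of_int k) * t)) (2 powi b * x)"
    by (subst ift_dilate) (auto simp: field_simps of_real_power_int)
  also have "\<dots> = 2 powi b * atom u b k x" unfolding ift_modulate atom_def by simp
  finally show ?thesis .
qed

definition conv1 :: "(real \<Rightarrow> complex) \<Rightarrow> (real \<Rightarrow> complex) \<Rightarrow> real \<Rightarrow> complex" where
  "conv1 m \<phi> x = (LINT t|lborel. m t * \<phi> (x - t))"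

lemma conv1_kernel_integrable:
  fixes m \<phi> :: "real \<Rightarrow> complex"
  assumes m: "integrable lborel m" and \<phi>: "integrable lborel \<phi>"
  shows "integrable (lborel \<Otimes>\<^sub>M lborel) (\<lambda>(t, x). m t * \<phi> (x - t))"
proof -
  have [measurable]: "m \<in> borel_measurable borel" "\<phi> \<in> borel_measurable borel"
    using m \<phi> by (auto dest: borel_measurable_integrable)
  have shift: "integrable lborel (\<lambda>x. \<phi> (x - t))" "(LINT x|lborel. norm (\<phi> (x - t))) = (LINT x|lborel. norm (\<phi> x))" for t
  proof -
    show "integrable lborel (\<lambda>x. \<phi> (x - t))"
      using lborel_integrable_real_affine[OF \<phi>, of 1 "-t"] by simp
    show "(LINT x|lborel. norm (\<phi> (x - t))) = (LINT x|lborel. norm (\<phi> x))"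
      using lborel_integral_real_affine[of 1 "\<lambda>x. norm (\<phi> x)" "-t"] by simp
  qed
  show ?thesis
  proof (rule lborel_pair.Fubini_integrable)
    show "(\<lambda>(t, x). m t * \<phi> (x - t)) \<in> borel_measurable (lborel \<Otimes>\<^sub>M lborel)" by measurable
    have "(\<lambda>t. LINT x|lborel. norm (case (t, x) of (t, x) \<Rightarrow> m t * \<phi> (x - t))) = (\<lambda>t. norm (m t) * (LINT x|lborel. norm (\<phi> x)))"
      by (simp add: norm_mult shift(2))
    then show "integrable lborel (\<lambda>t. LINT x|lborel. norm (case (t, x) of (t, x) \<Rightarrow> m t * \<phi> (x - t)))"
      using m by simp
    show "AE t in lborel. integrable lborel (\<lambda>x. case (t, x) of (t, x) \<Rightarrow> m t * \<phi> (x - t))"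
      using shift(1) by simp
  qed
qed

lemma conv1_integrable:
  assumes "integrable lborel m" "integrable lborel \<phi>"
  shows "integrable lborel (conv1 m \<phi>)"
  using lborel_pair.integrable_snd[OF conv1_kernel_integrable[OF assms]] by (simp add: conv1_def[abs_def])

lemma conv1_bounded:
  assumes m: "integrable lborel m" and \<phi>: "\<phi> \<in> borel_measurable borel" "\<And>x. norm (\<phi> x) \<le> C"
  shows "norm (conv1 m \<phi> x) \<le> (LINT t|lborel. norm (m t)) * C"
    and "integrable lborel (\<lambda>t. m t * \<phi> (x - t))"
proof -
  note [measurable] = \<phi>(1)
  show int: "integrable lborel (\<lambda>t. m t * \<phi> (x - t))"
    by (rule integrable_mult_bounded[OF m _ \<phi>(2)]) measurable
  have "norm (conv1 m \<phi> x) \<le> (LINT t|lborel. norm (m t * \<phi> (x - t)))"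
    unfolding conv1_def by (rule integral_norm_bound)
  also have "\<dots> \<le> (LINT t|lborel. norm (m t) * C)"
  proof (intro integral_mono integrable_norm int integrable_mult_left m)
    show "norm (m t * \<phi> (x - t)) \<le> norm (m t) * C" for t
      unfolding norm_mult by (intro mult_left_mono \<phi>) simp
  qed
  finally show "norm (conv1 m \<phi> x) \<le> (LINT t|lborel. norm (m t)) * C" by simp
qed

text \<open>Convolution with \<open>m\<close> averages translates of \<open>ift u\<close>, and a translation
  only modulates \<open>u\<close>, which leaves its zero set unchanged.\<close>

lemma conv1_ift_orthogonal:
  assumes m: "integrable lborel m" and u: "bump R u" and v: "bump R' v" and uv: "\<And>t. u t = 0 \<or> v t = 0"
  shows "(LINT x|lborel. conv1 m (ift u) x * cnj (ift v x)) = 0"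
proof -
  note [measurable] = bump_measurable[OF u] bump_measurable[OF v]
  define B where "B = (LINT t|lborel. norm (v t))"
  have B: "norm (ift v x) \<le> B" for x unfolding B_def by (rule norm_ift_le[OF bump_integrable[OF v]])
  define F where "F = (\<lambda>t x. m t * ift u (x - t) * cnj (ift v x))"
  have Fe: "case_prod F = (\<lambda>p. (case p of (t, x) \<Rightarrow> m t * ift u (x - t)) * cnj (ift v (snd p)))"
    by (auto simp: F_def fun_eq_iff)
  have i: "integrable (lborel \<Otimes>\<^sub>M lborel) (case_prod F)"
    unfolding Fe by (rule integrable_mult_bounded[OF conv1_kernel_integrable[OF m integrable_ift[OF u]], where C=B]) (measurable, simp add: B)
  have "(LINT x|lborel. conv1 m (ift u) x * cnj (ift v x)) = (LINT x|lborel. LINT t|lborel. F t x)"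
    unfolding conv1_def F_def by simp
  also have "\<dots> = (LINT t|lborel. LINT x|lborel. F t x)" by (rule lborel_pair.Fubini_integral[OF i])
  also have "\<dots> = (LINT t::real|lborel. 0)"
  proof (intro Bochner_Integration.integral_cong refl)
    fix t
    have "(LINT x|lborel. F t x) = m t * (LINT x|lborel. ift (\<lambda>s. u s * cis (2 * pi * (- t) * s)) x * cnj (ift v x))"
    proof -
      have "ift (\<lambda>s. u s * cis (2 * pi * (- t) * s)) x = ift u (x - t)" for x
        unfolding ift_modulate by simp
      then show ?thesis by (simp only: F_def mult.assoc integral_mult_right_zero)
    qed
    also have "(LINT x|lborel. ift (\<lambda>s. u s * cis (2 * pi * (- t) * s)) x * cnj (ift v x)) =
      (LINT s|lborel. u s * cis (2 * pi * (- t) * s) * cnj (v s))"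
      by (rule plancherel[OF bump_modulate[OF u] v])
    also have "\<dots> = (LINT s::real|lborel. 0)"
      by (intro Bochner_Integration.integral_cong refl) (use uv in auto)
    finally show "(LINT x|lborel. F t x) = 0" by simp
  qed
  finally show ?thesis by simp
qed

lemma atom_orthogonal:
  assumes u: "bump R u" and v: "bump R' v" and uv: "\<And>t. u t = 0 \<or> v (t / 2 powi b) = 0"
  shows "(LINT x|lborel. ift u x * cnj (atom v b k x)) = 0"
    and "integrable lborel m \<Longrightarrow> (LINT x|lborel. conv1 m (ift u) x * cnj (atom v b k x)) = 0"
proof -
  note bv = bump_atom_hat[OF v, of b k]
  have uv': "u t = 0 \<or> atom_hat v b k t = 0" for t using uv[of t] by (auto simp: atom_hat_def)
  have at: "atom v b k x = inverse (2 powi b) * ift (atom_hat v b k) x" for x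
    unfolding ift_atom_hat by simp
  have pull: "(LINT x|lborel. q x * cnj (atom v b k x)) = cnj (inverse (2 powi b)) * (LINT x|lborel. q x * cnj (ift (atom_hat v b k) x))" for q
    unfolding at complex_cnj_mult integral_mult_right_zero[symmetric] by (simp only: mult.left_commute)
  have "(LINT x|lborel. ift u x * cnj (ift (atom_hat v b k) x)) = (LINT t|lborel. u t * cnj (atom_hat v b k t))"
    by (rule plancherel[OF u bv])
  also have "\<dots> = (LINT t::real|lborel. 0)"
    by (intro Bochner_Integration.integral_cong refl) (use uv' in auto)
  finally show "(LINT x|lborel. ift u x * cnj (atom v b k x)) = 0" unfolding pull by simp
  show "(LINT x|lborel. conv1 m (ift u) x * cnj (atom v b k x)) = 0" if "integrable lborel m"
    unfolding pull conv1_ift_orthogonal[OF that u bv uv'] by simp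
qed

section \<open>Square-integrable functions on the plane\<close>

definition L2_sq :: "(real \<times> real \<Rightarrow> complex) \<Rightarrow> real" where
  "L2_sq f = (LINT x|lborel. (cmod (f x))\<^sup>2)"

lemma L2_sq_nonneg: "L2_sq f \<ge> 0" unfolding L2_sq_def by simp

lemma L2_spaceD:
  assumes "f \<in> L2_space"
  shows "f \<in> borel_measurable borel" "integrable lborel (\<lambda>x. (cmod (f x))\<^sup>2)"
  using assms by (auto simp: L2_space_def)

lemma L2_spaceI:
  assumes "f \<in> borel_measurable borel" "integrable lborel g" "\<And>x. (cmod (f x))\<^sup>2 \<le> g x"
  shows "f \<in> L2_space"
proof -
  have "integrable lborel (\<lambda>x. (cmod (f x))\<^sup>2)"
    by (rule integrable_dominated[OF assms(2)]) (use assms in simp_all)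
  then show ?thesis using assms(1) by (simp add: L2_space_def)
qed

lemma mult_le_sum_squares: "a * b \<le> a\<^sup>2 + (b::real)\<^sup>2"
proof -
  have "0 \<le> (a - b)\<^sup>2" by simp
  then have "2 * (a * b) \<le> a\<^sup>2 + b\<^sup>2" by (simp add: power2_diff)
  moreover have "0 \<le> a\<^sup>2 + b\<^sup>2" by simp
  ultimately show ?thesis by linarith
qed

text \<open>The bound \<open>ab \<le> a\<^sup>2 + b\<^sup>2\<close> replaces the Cauchy-Schwarz inequality
  throughout; it suffices because only uniform bounds over normalised families are used.\<close>

lemma L2_mult:
  assumes f: "f \<in> L2_space" and g: "g \<in> L2_space"
  shows "integrable lborel (\<lambda>x. f x * cnj (g x))"
    and "(LINT x|lborel. norm (f x * cnj (g x))) \<le> L2_sq f + L2_sq g"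
    and "(\<integral>\<^sup>+x. ennreal (norm (f x * cnj (g x))) \<partial>lborel) \<le> ennreal (L2_sq f + L2_sq g)"
proof -
  note [measurable] = L2_spaceD(1)[OF f] L2_spaceD(1)[OF g]
  have i: "integrable lborel (\<lambda>x. (cmod (f x))\<^sup>2 + (cmod (g x))\<^sup>2)"
    by (intro Bochner_Integration.integrable_add L2_spaceD assms)
  show 1: "integrable lborel (\<lambda>x. f x * cnj (g x))"
    by (rule integrable_dominated[OF i]) (auto simp: norm_mult mult_le_sum_squares)
  have "(LINT x|lborel. norm (f x * cnj (g x))) \<le> (LINT x|lborel. (cmod (f x))\<^sup>2 + (cmod (g x))\<^sup>2)"
    by (intro integral_mono i integrable_norm 1) (auto simp: norm_mult mult_le_sum_squares)
  also have "\<dots> = L2_sq f + L2_sq g" unfolding L2_sq_def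
    by (intro Bochner_Integration.integral_add L2_spaceD assms)
  finally show 2: "(LINT x|lborel. norm (f x * cnj (g x))) \<le> L2_sq f + L2_sq g" .
  show "(\<integral>\<^sup>+x. ennreal (norm (f x * cnj (g x))) \<partial>lborel) \<le> ennreal (L2_sq f + L2_sq g)"
    by (rule nn_integral_le_of_integral[OF 1 2])
qed

lemma L2_inner_bound:
  assumes f: "f \<in> L2_space" and g: "g \<in> L2_space"
  shows "norm (L2_inner f g) \<le> L2_sq f + L2_sq g"
  unfolding L2_inner_def by (rule order_trans[OF integral_norm_bound L2_mult(2)[OF assms]])

lemma L2_inner_cnj: "L2_inner g f = cnj (L2_inner f g)"
  unfolding L2_inner_def by (simp flip: Bochner_Integration.integral_cnj) (simp add: mult.commute)

lemma L2_inner_diff_right: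
  assumes "f \<in> L2_space" "g \<in> L2_space" "h \<in> L2_space"
  shows "L2_inner f (\<lambda>x. g x - h x) = L2_inner f g - L2_inner f h"
  unfolding L2_inner_def using L2_mult(1)[OF assms(1,2)] L2_mult(1)[OF assms(1,3)]
  by (subst Bochner_Integration.integral_diff[symmetric]) (auto simp: right_diff_distrib)

lemma L2_inner_diff_left:
  assumes "f \<in> L2_space" "g \<in> L2_space" "h \<in> L2_space"
  shows "L2_inner (\<lambda>x. f x - g x) h = L2_inner f h - L2_inner g h"
  unfolding L2_inner_def using L2_mult(1)[OF assms(1,3)] L2_mult(1)[OF assms(2,3)]
  by (subst Bochner_Integration.integral_diff[symmetric]) (auto simp: left_diff_distrib)

lemma L2_space_diff:
  assumes f: "f \<in> L2_space" and g: "g \<in> L2_space"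
  shows "(\<lambda>x. f x - g x) \<in> L2_space"
proof (rule L2_spaceI)
  show "(\<lambda>x. f x - g x) \<in> borel_measurable borel"
    by (intro borel_measurable_diff L2_spaceD assms)
  show "integrable lborel (\<lambda>x. 2 * (cmod (f x))\<^sup>2 + 2 * (cmod (g x))\<^sup>2)"
    by (intro Bochner_Integration.integrable_add integrable_mult_right L2_spaceD assms)
  fix x
  have "(cmod (f x - g x))\<^sup>2 \<le> (cmod (f x) + cmod (g x))\<^sup>2"
    by (intro power_mono norm_triangle_ineq4) simp
  also have "\<dots> \<le> 2 * (cmod (f x))\<^sup>2 + 2 * (cmod (g x))\<^sup>2"
    using zero_le_power2[of "cmod (f x) - cmod (g x)"] by (simp add: power2_eq_square algebra_simps)
  finally show "(cmod (f x - g x))\<^sup>2 \<le> 2 * (cmod (f x))\<^sup>2 + 2 * (cmod (g x))\<^sup>2" .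
qed

lemma asum_L2_swap:
  fixes u v :: "'i::countable \<Rightarrow> real \<times> real \<Rightarrow> complex"
  assumes u: "\<And>i. u i \<in> L2_space" and v: "\<And>i. v i \<in> L2_space"
    and K: "\<And>i. L2_sq (u i) + L2_sq (v i) \<le> K" and c: "asummable c"
  shows "integrable lborel (\<lambda>x. asum (\<lambda>i. u i x * cnj (v i x) * c i))"
    and "(LINT x|lborel. asum (\<lambda>i. u i x * cnj (v i x) * c i)) = asum (\<lambda>i. L2_inner (u i) (v i) * c i)"
proof -
  define F where "F = (\<lambda>i x. u i x * cnj (v i x) * c i)"
  have i: "integrable lborel (F i)" for i
    unfolding F_def by (intro integrable_mult_left L2_mult(1) u v)
  have bound: "(\<integral>\<^sup>+x. ennreal (norm (F i x)) \<partial>lborel) \<le> ennreal (K * norm (c i))" for i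
  proof (rule nn_integral_le_of_integral[OF i])
    have "(LINT x|lborel. norm (F i x)) = (LINT x|lborel. norm (u i x * cnj (v i x))) * norm (c i)"
      unfolding F_def norm_mult[of _ "c _"] by simp
    also have "\<dots> \<le> K * norm (c i)"
      by (intro mult_right_mono order_trans[OF L2_mult(2)[OF u v] K]) simp
    finally show "(LINT x|lborel. norm (F i x)) \<le> K * norm (c i)" .
  qed
  note sw = asum_integral_swap[of lborel F, OF lborel.sigma_finite_measure_axioms
      borel_measurable_integrable[OF i] bound integrable_mult_right[OF integrable_norm[OF c]]]
  show "integrable lborel (\<lambda>x. asum (\<lambda>i. u i x * cnj (v i x) * c i))" using sw(1) by (simp add: F_def)
  show "(LINT x|lborel. asum (\<lambda>i. u i x * cnj (v i x) * c i)) = asum (\<lambda>i. L2_inner (u i) (v i) * c i)"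
    using sw(2) by (simp add: F_def L2_inner_def)
qed

definition decay_integral :: real where "decay_integral = (LINT x|lborel. decay x)"

lemma decay_integral_nonneg: "decay_integral \<ge> 0" unfolding decay_integral_def by simp

lemma integral_decay_affine:
  "integrable lborel (\<lambda>x. decay (2 powi b * x - c))"
  "(LINT x|lborel. decay (2 powi b * x - c)) = decay_integral / 2 powi b"
proof -
  have e: "(\<lambda>x. decay (2 powi b * x - c)) = (\<lambda>x. decay (- c + 2 powi b * x))" by (simp add: algebra_simps)
  show "integrable lborel (\<lambda>x. decay (2 powi b * x - c))"
    unfolding e by (rule lborel_integrable_real_affine[OF integrable_decay]) simp
  have "decay_integral = 2 powi b * (LINT x|lborel. decay (- c + 2 powi b * x))"
    unfolding decay_integral_def by (subst lborel_integral_real_affine[where c="2 powi b" and t="-c"]) auto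
  then show "(LINT x|lborel. decay (2 powi b * x - c)) = decay_integral / 2 powi b"
    unfolding e by (simp add: field_simps)
qed

lemma decay2_integrable: "integrable lborel (\<lambda>x::real \<times> real. D * (decay (fst x) * decay (snd x)))"
  by (intro integrable_mult_right integrable_prod_mult integrable_decay)

text \<open>Open boxes form an intersection-stable generator of the Borel sets, so the integral of the
  function, cut off to a large box, vanishes over every Borel set.\<close>

lemma AE_eq_0_of_boxes:
  fixes d :: "real \<times> real \<Rightarrow> complex"
  assumes [measurable]: "d \<in> borel_measurable borel"
    and int: "\<And>l u. integrable lborel (\<lambda>x. indicator (box l u) x *\<^sub>R d x)"
    and zero: "\<And>l u. (LINT x|lborel. indicator (box l u) x *\<^sub>R d x) = 0"
  shows "AE x in lborel. d x = 0"
proof -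
  define Q where "Q = (\<lambda>n::nat. box (- real n, - real n) (real n, real n))"
  have "AE x in lborel. indicator (Q n) x *\<^sub>R d x = (\<lambda>_. 0) x" for n
  proof (rule sigma_finite_measure.density_unique_banach[OF lborel.sigma_finite_measure_axioms])
    let ?f = "\<lambda>x. indicator (Q n) x *\<^sub>R d x"
    let ?G = "range (\<lambda>(a, b). box a b :: (real \<times> real) set)"
    show f: "integrable lborel ?f" unfolding Q_def by (rule int)
    have f0: "(LINT x|lborel. ?f x) = 0" unfolding Q_def by (rule zero)
    have si: "set_integrable lborel A ?f" if "A \<in> sets lborel" for A
      unfolding set_integrable_def by (rule integrable_mult_indicator[OF that f])
    fix A :: "(real \<times> real) set" assume "A \<in> sets lborel"
    then have A: "A \<in> sigma_sets UNIV ?G" unfolding sets_lborel borel_eq_box by simp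
    have subset_Pow_UNIV: "?G \<subseteq> Pow UNIV" by simp
    have st: "Int_stable ?G" by (auto simp: Int_stable_def box_Int_box)
    have gs: "A \<in> sigma_sets UNIV ?G \<Longrightarrow> A \<in> sets lborel" for A
      unfolding sets_lborel borel_eq_box by simp
    have "(LINT x:A|lborel. ?f x) = 0"
      using st subset_Pow_UNIV A
    proof (induction rule: sigma_sets_induct_disjoint)
      case (basic A)
      then obtain a b where A: "A = box a b" by auto
      obtain a' b' where "box a b \<inter> Q n = box a' b'" unfolding Q_def box_Int_box by blast
      then have e: "indicator A x *\<^sub>R ?f x = indicator (box a' b') x *\<^sub>R d x" for x
        unfolding A by (simp flip: indicator_inter_arith)
      show ?case unfolding set_lebesgue_integral_def e by (rule zero)
    next
      case empty
      then show ?case by (simp add: set_lebesgue_integral_def)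
    next
      case (compl A)
      have "(LINT x|lborel. ?f x) = (LINT x|lborel. indicator A x *\<^sub>R ?f x + indicator (UNIV - A) x *\<^sub>R ?f x)"
        by (intro Bochner_Integration.integral_cong refl) (simp add: indicator_def)
      also have "\<dots> = (LINT x:A|lborel. ?f x) + (LINT x:(UNIV - A)|lborel. ?f x)"
        unfolding set_lebesgue_integral_def
        by (rule Bochner_Integration.integral_add) (use si gs[OF compl(1)] in \<open>auto simp: set_integrable_def\<close>)
      finally show ?case using f0 compl by simp
    next
      case (union A)
      have m: "A i \<in> sets lborel" for i using gs[of "A i"] union(2) by blast
      then have mU: "(\<Union>i. A i) \<in> sets lborel" by blast
      have "(LINT x:(\<Union>i. A i)|lborel. ?f x) = (\<Sum>i. LINT x:A i|lborel. ?f x)"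
        by (rule lebesgue_integral_countable_add[OF m _ si[OF mU]]) (use union(1) in \<open>auto simp: disjoint_family_on_def\<close>)
      then show ?case using union by simp
    qed
    then show "(LINT x:A|lborel. ?f x) = (LINT x:A|lborel. 0)" by (simp add: set_lebesgue_integral_def)
  qed simp
  then have "AE x in lborel. \<forall>n. indicator (Q n) x *\<^sub>R d x = 0" by (subst AE_all_countable) blast
  then show ?thesis
  proof eventually_elim
    fix x assume x: "\<forall>n. indicator (Q n) x *\<^sub>R d x = 0"
    obtain n :: nat where n: "\<bar>fst x\<bar> + \<bar>snd x\<bar> < real n" using reals_Archimedean2 by blast
    then have "x \<in> Q n" by (cases x) (auto simp: Q_def box_def Basis_prod_def)
    then show "d x = 0" using x[rule_format, of n] by simp
  qed
qed

lemma lborel_Ioo_finite: "emeasure lborel {l<..<u::real} < \<infinity>"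
  by (cases "l \<le> u") auto

lemma measure_lborel_Ioo_le: "measure lborel {l<..<u::real} \<le> \<bar>u - l\<bar>"
  by (cases "l \<le> u") auto

lemma powi2_tendsto: "(\<lambda>n. z / 2 powi int n :: real) \<longlonglongrightarrow> 0"
proof -
  have "(\<lambda>n. z * (1/2) ^ n) \<longlonglongrightarrow> z * 0"
    by (intro tendsto_mult tendsto_const LIMSEQ_power_zero) simp
  then show ?thesis by (simp add: power_divide)
qed

lemma AE_not_on_lines:
  "AE x::real \<times> real in lborel. fst x \<noteq> a \<and> fst x \<noteq> b \<and> snd x \<noteq> c \<and> snd x \<noteq> d"
proof -
  have "AE x in lborel \<Otimes>\<^sub>M lborel. fst x \<noteq> a \<and> fst x \<noteq> b \<and> snd x \<noteq> c \<and> snd (x::real \<times> real) \<noteq> d"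
  proof (rule lborel_pair.AE_pair_measure)
    show "{x \<in> space (lborel \<Otimes>\<^sub>M lborel). fst x \<noteq> a \<and> fst x \<noteq> b \<and> snd x \<noteq> c \<and> snd (x::real \<times> real) \<noteq> d} \<in> sets (lborel \<Otimes>\<^sub>M lborel)"
      by measurable
    show "AE x in lborel. AE y in lborel. fst (x, y) \<noteq> a \<and> fst (x, y) \<noteq> b \<and> snd (x, y) \<noteq> c \<and> snd (x, y::real) \<noteq> d"
      using AE_lborel_singleton[of a] AE_lborel_singleton[of b]
    proof eventually_elim
      case (elim x)
      show ?case using AE_lborel_singleton[of c] AE_lborel_singleton[of d]
        by eventually_elim (use elim in simp)
    qed
  qed
  then show ?thesis by (simp only: lborel_prod)
qed

lemma indicator_box_prod:
  "indicator (box (l1, l2) (u1, u2)) (x :: real \<times> real) = (indicator {l1<..<u1} (fst x) * indicator {l2<..<u2} (snd x) :: 'a::semiring_1)"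
  by (cases x) (auto simp: box_def Basis_prod_def indicator_def)

lemma box_indicator_L2:
  "(\<lambda>x::real \<times> real. indicator (box l u) x :: complex) \<in> L2_space"
  "integrable lborel (\<lambda>x::real \<times> real. indicator (box l u) x :: complex)"
proof -
  have r: "integrable lborel (\<lambda>x::real \<times> real. indicator (box l u) x :: real)"
    by (rule integrable_real_indicator) (simp_all add: emeasure_lborel_box_eq)
  then have "integrable lborel (\<lambda>x::real \<times> real. complex_of_real (indicator (box l u) x))" by simp
  then show "integrable lborel (\<lambda>x::real \<times> real. indicator (box l u) x :: complex)"
    by (simp add: of_real_indicator)
  have "(\<lambda>x::real \<times> real. (cmod (indicator (box l u) x))\<^sup>2) = (\<lambda>x. indicator (box l u) x)"
    by (auto simp: indicator_def)
  with r show "(\<lambda>x::real \<times> real. indicator (box l u) x :: complex) \<in> L2_space"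
    unfolding L2_space_def by simp
qed

lemma mask_measurable: "mask h \<in> sets borel"
proof -
  have "closed {x::real \<times> real. \<bar>fst x\<bar> \<le> h}" by (intro closed_Collect_le continuous_intros)
  then show ?thesis unfolding mask_def by (rule borel_closed)
qed

lemma l1_norm_finite_iff: "l1_norm c < \<infinity> \<longleftrightarrow> asummable c"
  by (simp add: l1_norm_def integrable_iff_bounded)

lemma l1_norm_eq: "asummable c \<Longrightarrow> l1_norm c = ennreal (asum (\<lambda>i. norm (c i)))"
  unfolding l1_norm_def by (rule nn_integral_eq_integral) auto

section \<open>The Meyer functions\<close>

instance orientation :: countable by countable_datatype

lemma UNIV_orientation: "(UNIV :: orientation set) = {Horizontal, Vertical, Diagonal}"
  using orientation.exhaust by auto

instance orientation :: finite
  by standard (simp add: UNIV_orientation)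

lemma asum_wavelet_index:
  fixes g :: "wavelet_index \<Rightarrow> 'b::{banach, second_countable_topology}"
  assumes g: "asummable g"
  defines "G \<equiv> \<lambda>b. \<Sum>\<iota>\<in>UNIV. asum (\<lambda>p. g (\<iota>, b, p))"
  shows "asummable G" "asum g = asum G"
proof -
  have 1: "asummable (\<lambda>q. g (\<iota>, q))" for \<iota> by (rule asum_pair(1)[OF g])
  have 2: "asummable (\<lambda>b. asum (\<lambda>p. g (\<iota>, b, p)))" for \<iota> by (rule asum_pair(2)[OF 1])
  show "asummable G" unfolding G_def by (intro Bochner_Integration.integrable_sum 2)
  have "asum g = (\<Sum>\<iota>\<in>UNIV. asum (\<lambda>q. g (\<iota>, q)))"
    by (subst asum_pair(3)[OF g]) (rule asum_finite_UNIV)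
  also have "\<dots> = (\<Sum>\<iota>\<in>UNIV. asum (\<lambda>b. asum (\<lambda>p. g (\<iota>, b, p))))"
    by (intro sum.cong refl asum_pair(3)[OF 1])
  also have "\<dots> = asum G" unfolding G_def by (intro Bochner_Integration.integral_sum[symmetric] 2)
  finally show "asum g = asum G" .
qed

lemma asummable_wavelet_indexI:
  fixes g :: "wavelet_index \<Rightarrow> 'b::{banach, second_countable_topology}"
  assumes "finite B" "\<And>\<iota> b p. b \<notin> B \<Longrightarrow> g (\<iota>, b, p) = 0" "\<And>\<iota> b. asummable (\<lambda>p. g (\<iota>, b, p))"
  shows "asummable g"
proof (rule asummable_pairI)
  show "asummable (\<lambda>q. g (\<iota>, q))" for \<iota>
    by (rule asummable_pairI[OF assms(3)], rule asum_finite_support(1)[OF assms(1)]) (use assms(2) in simp)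
qed (rule asum_finite_UNIV)

lemma smooth_derivs:
  assumes "smooth f"
  obtains f' f'' where "\<And>x. (f has_real_derivative f' x) (at x)" "\<And>x. (f' has_real_derivative f'' x) (at x)"
    "continuous_on UNIV f''" 
proof (rule that)
  have d: "(deriv ^^ n) f differentiable_on UNIV" for n using assms by (simp add: smooth_def)
  have dd: "((deriv ^^ n) f has_real_derivative (deriv ^^ Suc n) f x) (at x)" for n x
    using d[of n] DERIV_deriv_iff_real_differentiable[of "(deriv ^^ n) f" x]
    by (auto simp: differentiable_on_def)
  show "(f has_real_derivative (deriv ^^ Suc 0) f x) (at x)" for x using dd[of 0] by simp
  show "((deriv ^^ Suc 0) f has_real_derivative (deriv ^^ Suc (Suc 0)) f x) (at x)" for x by (rule dd)
  show "continuous_on UNIV ((deriv ^^ Suc (Suc 0)) f)"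
    by (rule differentiable_imp_continuous_on[OF d])
qed

lemma C2_of_real:
  assumes "\<And>x. (f has_real_derivative f' x) (at x)" "\<And>x. (f' has_real_derivative f'' x) (at x)"
    "continuous_on UNIV f''"
  shows "C2 (\<lambda>x. complex_of_real (f x))"
  unfolding C2_def
  by (intro exI[of _ "\<lambda>x. complex_of_real (f' x)"] exI[of _ "\<lambda>x. complex_of_real (f'' x)"] conjI allI
      has_vector_derivative_of_real continuous_intros assms)

lemma C2_sin_cos:
  assumes "smooth f"
  shows "C2 (\<lambda>x. complex_of_real (sin (c * f x)))" and "C2 (\<lambda>x. complex_of_real (cos (c * f x)))"
proof -
  obtain f' f'' where f: "\<And>x. (f has_real_derivative f' x) (at x)" "\<And>x. (f' has_real_derivative f'' x) (at x)"
    "continuous_on UNIV f''" using smooth_derivs[OF assms] by blast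
  have c: "continuous_on UNIV f" "continuous_on UNIV f'"
    using f by (meson DERIV_continuous_on has_field_derivative_at_within)+
  show "C2 (\<lambda>x. complex_of_real (sin (c * f x)))"
  proof (rule C2_of_real)
    fix x
    show "((\<lambda>x. sin (c * f x)) has_real_derivative c * f' x * cos (c * f x)) (at x)"
      by (rule derivative_eq_intros f refl)+ simp
    show "((\<lambda>x. c * f' x * cos (c * f x)) has_real_derivative
       c * f'' x * cos (c * f x) - c * f' x * (c * f' x) * sin (c * f x)) (at x)"
      by (rule derivative_eq_intros f refl)+ (simp add: algebra_simps)
  qed (intro continuous_intros c f)
  show "C2 (\<lambda>x. complex_of_real (cos (c * f x)))"
  proof (rule C2_of_real)
    fix x
    show "((\<lambda>x. cos (c * f x)) has_real_derivative - c * f' x * sin (c * f x)) (at x)"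
      by (rule derivative_eq_intros f refl)+ simp
    show "((\<lambda>x. - c * f' x * sin (c * f x)) has_real_derivative
       - c * f'' x * sin (c * f x) - c * f' x * (c * f' x) * cos (c * f x)) (at x)"
      by (rule derivative_eq_intros f refl)+ (simp add: algebra_simps)
  qed (intro continuous_intros c f)
qed

context
  fixes \<nu> :: "real \<Rightarrow> real"
  assumes nu: "meyer_aux \<nu>"
begin

lemma nu_smooth: "smooth \<nu>" and nu_0: "x \<le> 0 \<Longrightarrow> \<nu> x = 0" and nu_1: "x \<ge> 1 \<Longrightarrow> \<nu> x = 1"
  using nu by (auto simp: meyer_aux_def)

text \<open>In this form the function is visibly smooth: the absolute value has disappeared because, for
  \<open>\<xi> \<ge> 0\<close>, the second summand vanishes, and for \<open>\<xi> \<le> 0\<close>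
  the first one does. On \<open>1/16 \<le> \<bar>\<xi>\<bar> \<le> 1/8\<close> the cosine factor
  is \<open>1\<close>, on \<open>1/8 \<le> \<bar>\<xi>\<bar> \<le> 1/4\<close> the sine factor is.\<close>

lemma meyer_W_eq:
  "meyer_W \<nu> \<xi> = cis (- 16 * pi / 3 * \<xi>) *
     (complex_of_real (sin (pi/2 * \<nu> (16 * \<xi> + (-1)))) * complex_of_real (cos (pi/2 * \<nu> (8 * \<xi> + (-1)))) +
      complex_of_real (sin (pi/2 * \<nu> (-16 * \<xi> + (-1)))) * complex_of_real (cos (pi/2 * \<nu> (-8 * \<xi> + (-1)))))"
proof -
  have e: "exp (- 16 * pi * \<i> * of_real \<xi> / 3) = cis (- 16 * pi / 3 * \<xi>)"
    by (simp add: cis_conv_exp algebra_simps)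
  consider "\<bar>\<xi>\<bar> < 1/16" | "1/16 \<le> \<bar>\<xi>\<bar>" "\<bar>\<xi>\<bar> \<le> 1/8" | "1/8 < \<bar>\<xi>\<bar>" "\<bar>\<xi>\<bar> \<le> 1/4" | "1/4 < \<bar>\<xi>\<bar>"
    by linarith
  then show ?thesis
    unfolding meyer_W_def e
    by cases (auto simp: abs_if nu_0 nu_1 split: if_splits)
qed

text \<open>One of the two factors is always \<open>1\<close>.\<close>

lemma meyer_phi_eq:
  "meyer_phi_hat \<nu> \<xi> =
     complex_of_real (cos (pi/2 * \<nu> (16 * \<xi> + (-1)))) * complex_of_real (cos (pi/2 * \<nu> (-16 * \<xi> + (-1))))"
proof -
  consider "\<bar>\<xi>\<bar> \<le> 1/16" | "1/16 < \<bar>\<xi>\<bar>" "\<bar>\<xi>\<bar> \<le> 1/8" | "1/8 < \<bar>\<xi>\<bar>" by linarith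
  then show ?thesis
    unfolding meyer_phi_hat_def
    by cases (auto simp: abs_if nu_0 nu_1 split: if_splits)
qed

lemma meyer_W_inner: "\<bar>\<xi>\<bar> \<le> 1/16 \<Longrightarrow> meyer_W \<nu> \<xi> = 0"
  unfolding meyer_W_eq by (simp add: abs_le_iff nu_0)

lemma meyer_W_outer: "1/4 \<le> \<bar>\<xi>\<bar> \<Longrightarrow> meyer_W \<nu> \<xi> = 0"
  unfolding meyer_W_def by (auto simp: nu_1)

lemma bump_meyer_W: "bump (1/4) (meyer_W \<nu>)"
proof -
  have "C2 (meyer_W \<nu>)"
    unfolding meyer_W_eq[abs_def]
    by (intro C2_mult C2_add C2_cis C2_affine[of "\<lambda>x. complex_of_real (sin (pi/2 * \<nu> x))"]
         C2_affine[of "\<lambda>x. complex_of_real (cos (pi/2 * \<nu> x))"] C2_sin_cos nu_smooth)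
  then show ?thesis by (simp add: bump_def meyer_W_outer)
qed

lemma meyer_phi_outer: "1/8 \<le> \<bar>\<xi>\<bar> \<Longrightarrow> meyer_phi_hat \<nu> \<xi> = 0"
  unfolding meyer_phi_hat_def by (auto simp: nu_1)

lemma bump_meyer_phi: "bump (1/4) (meyer_phi_hat \<nu>)"
proof -
  have "C2 (meyer_phi_hat \<nu>)"
    unfolding meyer_phi_eq[abs_def]
    by (intro C2_mult C2_affine[of "\<lambda>x. complex_of_real (cos (pi/2 * \<nu> x))"] C2_sin_cos nu_smooth)
  then show ?thesis by (auto simp: bump_def meyer_phi_outer)
qed

text \<open>The identity behind the Parseval property: adding a band of frequencies to the low-pass part
  gives the low-pass part of the next scale. Iterating it over the scales telescopes.\<close>

lemma meyer_two_scale: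
  "meyer_phi_hat \<nu> \<xi> * cnj (meyer_phi_hat \<nu> \<xi>) + meyer_W \<nu> \<xi> * cnj (meyer_W \<nu> \<xi>) =
   meyer_phi_hat \<nu> (1/2 * \<xi>) * cnj (meyer_phi_hat \<nu> (1/2 * \<xi>))"
proof -
  have c: "cis t * z * cnj (cis t * z) = z * cnj z" for t z
  proof -
    have "cis t * z * cnj (cis t * z) = (cis t * cnj (cis t)) * (z * cnj z)" by simp
    also have "cis t * cnj (cis t) = 1" unfolding cis_cnj cis_mult by simp
    finally show ?thesis by simp
  qed
  have s: "complex_of_real (cos a) * complex_of_real (cos a) + complex_of_real (sin a) * complex_of_real (sin a) = 1" for a
    unfolding of_real_mult[symmetric] of_real_add[symmetric] sin_cos_squared_add3 by simp
  consider "\<bar>\<xi>\<bar> \<le> 1/16" | "1/16 < \<bar>\<xi>\<bar>" "\<bar>\<xi>\<bar> \<le> 1/8" | "1/8 < \<bar>\<xi>\<bar>" "\<bar>\<xi>\<bar> \<le> 1/4" | "1/4 < \<bar>\<xi>\<bar>" by linarith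
  then show ?thesis
    unfolding meyer_W_eq c meyer_phi_eq
    by cases (auto simp: abs_if nu_0 nu_1 s split: if_splits)
qed

definition low_kernel :: "real \<Rightarrow> complex" where
  "low_kernel = ift (\<lambda>t. meyer_phi_hat \<nu> t * cnj (meyer_phi_hat \<nu> t))"

definition band_kernel :: "real \<Rightarrow> complex" where
  "band_kernel = ift (\<lambda>t. meyer_W \<nu> t * cnj (meyer_W \<nu> t))"

lemma low_plus_band: "low_kernel x + band_kernel x = 2 * low_kernel (2 * x)"
proof -
  note b = bump_integrable[OF bump_mult_cnj[OF bump_meyer_phi bump_meyer_phi]]
    bump_integrable[OF bump_mult_cnj[OF bump_meyer_W bump_meyer_W]]
  have "low_kernel x + band_kernel x =
     ift (\<lambda>t. meyer_phi_hat \<nu> t * cnj (meyer_phi_hat \<nu> t) + meyer_W \<nu> t * cnj (meyer_W \<nu> t)) x"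
    unfolding low_kernel_def band_kernel_def ift_def distrib_right
    by (intro Bochner_Integration.integral_add[symmetric] integrable_mult_cis b) auto
  also have "\<dots> = 2 * low_kernel (2 * x)"
    unfolding meyer_two_scale low_kernel_def
    using ift_dilate[of "1/2" "\<lambda>t. meyer_phi_hat \<nu> t * cnj (meyer_phi_hat \<nu> t)" x] by (simp add: mult.commute)
  finally show ?thesis .
qed

lemma low_kernel_decay: obtains C where "C > 0" "\<And>x. norm (low_kernel x) \<le> C * decay x"
  using ift_decay[OF bump_mult_cnj[OF bump_meyer_phi bump_meyer_phi]] unfolding low_kernel_def by blast

lemma low_kernel_integral: "integrable lborel low_kernel" "(LINT x|lborel. low_kernel x) = 1"
  using integrable_ift[OF bump_mult_cnj[OF bump_meyer_phi bump_meyer_phi]]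
   fourier_inversion[OF bump_mult_cnj[OF bump_meyer_phi bump_meyer_phi], of 0]
  by (simp_all add: low_kernel_def meyer_phi_eq nu_0)

lemma low_kernel_measurable [measurable]: "low_kernel \<in> borel_measurable borel"
  using borel_measurable_integrable[OF low_kernel_integral(1)] by simp

fun factor1 factor2 :: "orientation \<Rightarrow> real \<Rightarrow> complex" where
  "factor1 Vertical = meyer_phi_hat \<nu>" | "factor1 Horizontal = meyer_W \<nu>" | "factor1 Diagonal = meyer_W \<nu>"
| "factor2 Vertical = meyer_W \<nu>" | "factor2 Horizontal = meyer_phi_hat \<nu>" | "factor2 Diagonal = meyer_W \<nu>"

lemma bump_factor: "bump (1/4) (factor1 \<iota>)" "bump (1/4) (factor2 \<iota>)"
  by (cases \<iota>; simp add: bump_meyer_W bump_meyer_phi)+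

lemma meyer_W2_eq: "meyer_W2 \<nu> \<iota> p = factor1 \<iota> (fst p) * factor2 \<iota> (snd p)"
  by (cases p; cases \<iota>) auto

abbreviation \<psi> :: "wavelet_index \<Rightarrow> real \<times> real \<Rightarrow> complex" where
  "\<psi> \<equiv> meyer_psi \<nu>"

lemma meyer_psi_eq:
  "\<psi> (\<iota>, b, k1, k2) x = 2 powi b * (atom (factor1 \<iota>) b k1 (fst x) * atom (factor2 \<iota>) b k2 (snd x))"
proof -
  let ?u = "atom_hat (factor1 \<iota>) b k1" and ?v = "atom_hat (factor2 \<iota>) b k2"
  note i = bump_integrable[OF bump_atom_hat[OF bump_factor(1)]] bump_integrable[OF bump_atom_hat[OF bump_factor(2)]]
  have "\<psi> (\<iota>, b, k1, k2) x = inv_fourier (\<lambda>p. (2 powi (-b) * ?u (fst p)) * ?v (snd p)) x"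
    unfolding meyer_psi_def
  proof (rule arg_cong[of _ _ "\<lambda>f. inv_fourier f x"], rule ext)
    fix p :: "real \<times> real"
    have "exp (- 2 * pi * \<i> * of_real ((real_of_int k1, real_of_int k2) \<bullet> (p /\<^sub>R 2 powi b))) =
       cis (- 2 * pi * of_int k1 * (fst p / 2 powi b)) * cis (- 2 * pi * of_int k2 * (snd p / 2 powi b))"
      unfolding cis_mult by (simp add: cis_conv_exp inner_prod_def divide_inverse algebra_simps)
    then show "meyer_psi_hat \<nu> (\<iota>, b, k1, k2) p = 2 powi (-b) * ?u (fst p) * ?v (snd p)"
      by (simp add: meyer_W2_eq atom_hat_def divide_inverse mult_ac of_real_power_int)
  qed
  also have "\<dots> = ift (\<lambda>t. 2 powi (-b) * ?u t) (fst x) * ift ?v (snd x)"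
    by (intro inv_fourier_prod integrable_mult_right i)
  also have "ift (\<lambda>t. 2 powi (-b) * ?u t) (fst x) = 2 powi (-b) * ift ?u (fst x)"
    unfolding ift_def by (simp add: mult.assoc)
  finally show ?thesis unfolding ift_atom_hat by (simp add: power_int_minus field_simps)
qed

section \<open>Size and one-scale sums of the wavelets\<close>

lemma meyer_const:
  obtains K where "K > 0"
   "\<And>u. u \<in> {meyer_phi_hat \<nu>, meyer_W \<nu>} \<Longrightarrow> (\<forall>x. norm (ift u x) \<le> K * decay x) \<and>
      (\<forall>x. asummable (\<lambda>n::int. ift u (x - of_int n))) \<and>
      (\<forall>x. asum (\<lambda>n::int. norm (ift u (x - of_int n))) \<le> K)"
proof -
  obtain A where A: "A > 0" "\<And>x. asummable (\<lambda>n::int. ift (meyer_phi_hat \<nu>) (x - of_int n))"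
    "\<And>x. asum (\<lambda>n::int. norm (ift (meyer_phi_hat \<nu>) (x - of_int n))) \<le> A" "\<And>x. norm (ift (meyer_phi_hat \<nu>) x) \<le> A * decay x"
    using ift_int_bound[OF bump_meyer_phi] by metis
  obtain B where B: "B > 0" "\<And>x. asummable (\<lambda>n::int. ift (meyer_W \<nu>) (x - of_int n))"
    "\<And>x. asum (\<lambda>n::int. norm (ift (meyer_W \<nu>) (x - of_int n))) \<le> B" "\<And>x. norm (ift (meyer_W \<nu>) x) \<le> B * decay x"
    using ift_int_bound[OF bump_meyer_W] by metis
  have "A * decay x \<le> max A B * decay x" "B * decay x \<le> max A B * decay x" for x
    by (intro mult_right_mono; simp)+
  note m = this
  show ?thesis
    by (rule that[of "max A B"]) (use A B in \<open>auto intro: order_trans[OF _ m(1)] order_trans[OF _ m(2)] simp: le_max_iff_disj\<close>)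
qed

lemma psi_bounds:
  obtains K where "K > 0"
    "\<And>\<iota> b k1 k2 x. norm (\<psi> (\<iota>, b, k1, k2) x) \<le>
        K * (2 powi b * (decay (2 powi b * fst x - of_int k1) * decay (2 powi b * snd x - of_int k2)))"
    "\<And>\<iota> b x. asummable (\<lambda>p. \<psi> (\<iota>, b, p) x)"
    "\<And>\<iota> b x. asum (\<lambda>p. norm (\<psi> (\<iota>, b, p) x)) \<le> K * 2 powi b"
proof -
  obtain K where K: "K > 0" and K':
   "\<And>u. u \<in> {meyer_phi_hat \<nu>, meyer_W \<nu>} \<Longrightarrow> (\<forall>x. norm (ift u x) \<le> K * decay x) \<and>
      (\<forall>x. asummable (\<lambda>n::int. ift u (x - of_int n))) \<and>
      (\<forall>x. asum (\<lambda>n::int. norm (ift u (x - of_int n))) \<le> K)"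
    using meyer_const by blast
  have mem: "factor1 \<iota> \<in> {meyer_phi_hat \<nu>, meyer_W \<nu>}" "factor2 \<iota> \<in> {meyer_phi_hat \<nu>, meyer_W \<nu>}" for \<iota>
    by (cases \<iota>; simp add: factor1.simps factor2.simps)+
  note K1 = K'[OF mem(1), THEN conjunct1, rule_format] and K2 = K'[OF mem(2), THEN conjunct1, rule_format]
    and S1 = K'[OF mem(1), THEN conjunct2, THEN conjunct1, rule_format] and S2 = K'[OF mem(2), THEN conjunct2, THEN conjunct1, rule_format]
    and B1 = K'[OF mem(1), THEN conjunct2, THEN conjunct2, rule_format] and B2 = K'[OF mem(2), THEN conjunct2, THEN conjunct2, rule_format]
  have eq: "\<psi> (\<iota>, b, p) x = 2 powi b * (atom (factor1 \<iota>) b (fst p) (fst x) * atom (factor2 \<iota>) b (snd p) (snd x))" for \<iota> b p x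
    by (cases p) (simp add: meyer_psi_eq)
  have n2: "norm (2 powi b :: complex) = 2 powi b" for b by (simp add: norm_power_int)
  show ?thesis
  proof (rule that[of "K * K"])
    show "K * K > 0" using K by simp
    fix \<iota> b x
    show "norm (\<psi> (\<iota>, b, k1, k2) x) \<le>
        K * K * (2 powi b * (decay (2 powi b * fst x - of_int k1) * decay (2 powi b * snd x - of_int k2)))" for k1 k2
    proof -
      have "norm (\<psi> (\<iota>, b, k1, k2) x) \<le> 2 powi b *
         ((K * decay (2 powi b * fst x - of_int k1)) * (K * decay (2 powi b * snd x - of_int k2)))"
        unfolding eq norm_mult n2 atom_def fst_conv snd_conv
        using K by (intro mult_left_mono mult_mono K1 K2) auto
      then show ?thesis by (simp add: mult_ac)
    qed
    have s: "asummable (\<lambda>p. atom (factor1 \<iota>) b (fst p) (fst x) * atom (factor2 \<iota>) b (snd p) (snd x))"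
      unfolding atom_def by (rule asum_prod(1)[OF S1 S2])
    then show "asummable (\<lambda>p. \<psi> (\<iota>, b, p) x)"
      unfolding eq by (rule integrable_mult_right)
    have "asum (\<lambda>p. norm (\<psi> (\<iota>, b, p) x)) = 2 powi b *
       asum (\<lambda>p. norm (atom (factor1 \<iota>) b (fst p) (fst x)) * norm (atom (factor2 \<iota>) b (snd p) (snd x)))"
      unfolding eq norm_mult n2 by (rule integral_mult_right_zero)
    also have "\<dots> = 2 powi b * (asum (\<lambda>k. norm (atom (factor1 \<iota>) b k (fst x))) * asum (\<lambda>k. norm (atom (factor2 \<iota>) b k (snd x))))"
      unfolding atom_def by (subst asum_prod(2)[OF integrable_norm[OF S1] integrable_norm[OF S2]]) (rule refl)
    also have "\<dots> \<le> 2 powi b * (K * K)"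
      unfolding atom_def using K by (intro mult_left_mono mult_mono B1 B2) auto
    finally show "asum (\<lambda>p. norm (\<psi> (\<iota>, b, p) x)) \<le> K * K * 2 powi b" by (simp add: mult.commute)
  qed
qed

lemma psi_measurable [measurable]: "\<psi> l \<in> borel_measurable borel"
proof -
  obtain \<iota> b k1 k2 where l: "l = (\<iota>, b, k1, k2)" by (cases l) auto
  have a: "atom u b k \<in> borel_measurable borel" if "bump R u" for u R b k
    unfolding atom_def using bump_measurable[OF that] by measurable
  have "(\<lambda>x. 2 powi b * (atom (factor1 \<iota>) b k1 (fst x) * atom (factor2 \<iota>) b k2 (snd x))) \<in> borel_measurable borel"
    by (intro borel_measurable_times borel_measurable_const measurable_fst_real measurable_snd_real a[OF bump_factor(1)] a[OF bump_factor(2)])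
  also have "(\<lambda>x. 2 powi b * (atom (factor1 \<iota>) b k1 (fst x) * atom (factor2 \<iota>) b k2 (snd x))) = \<psi> l"
    unfolding l by (rule ext) (simp only: meyer_psi_eq)
  finally show ?thesis .
qed

text \<open>The factor \<open>2^b\<close> normalises in \<open>L\<^sup>2\<close>: the bound is uniform over
  all scales and positions.\<close>

lemma psi_L2:
  obtains K where "K > 0" "\<And>l. \<psi> l \<in> L2_space" "\<And>l. L2_sq (\<psi> l) \<le> K"
proof -
  obtain K where K: "K > 0" and b1:
    "\<And>\<iota> b k1 k2 x. norm (\<psi> (\<iota>, b, k1, k2) x) \<le>
        K * (2 powi b * (decay (2 powi b * fst x - of_int k1) * decay (2 powi b * snd x - of_int k2)))"
    using psi_bounds by metis
  have key: "\<psi> l \<in> L2_space \<and> L2_sq (\<psi> l) \<le> K\<^sup>2 * decay_integral\<^sup>2" for l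
  proof -
    obtain \<iota> b k1 k2 where l: "l = (\<iota>, b, k1, k2)" by (cases l) auto
    define D where "D = (\<lambda>x::real \<times> real. decay (2 powi b * fst x - of_int k1) * decay (2 powi b * snd x - of_int k2))"
    have D0: "D x \<ge> 0" for x by (simp add: D_def)
    have D1: "D x \<le> 1" for x unfolding D_def by (intro mult_le_one decay_le_1) auto
    have iD: "integrable lborel D" and ID: "(LINT x|lborel. D x) = (decay_integral / 2 powi b) * (decay_integral / 2 powi b)"
      unfolding D_def
      using integrable_prod_mult[OF integral_decay_affine(1)[of b "of_int k1"] integral_decay_affine(1)[of b "of_int k2"]]
      by (simp_all add: integral_decay_affine(2))
    have le: "(cmod (\<psi> l x))\<^sup>2 \<le> (K\<^sup>2 * (2 powi b)\<^sup>2) * D x" for x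
    proof -
      have "(cmod (\<psi> l x))\<^sup>2 \<le> (K * (2 powi b * D x))\<^sup>2"
        unfolding l using b1 by (intro power_mono) (simp_all add: D_def)
      also have "\<dots> = (K\<^sup>2 * (2 powi b)\<^sup>2) * (D x * D x)" by (simp add: power2_eq_square mult_ac)
      also have "\<dots> \<le> (K\<^sup>2 * (2 powi b)\<^sup>2) * D x"
        using D0 D1 by (intro mult_left_mono mult_left_le) auto
      finally show ?thesis .
    qed
    have i: "integrable lborel (\<lambda>x. (K\<^sup>2 * (2 powi b)\<^sup>2) * D x)" by (intro integrable_mult_right iD)
    have L: "\<psi> l \<in> L2_space" by (rule L2_spaceI[OF psi_measurable i le])
    have "L2_sq (\<psi> l) \<le> (LINT x|lborel. (K\<^sup>2 * (2 powi b)\<^sup>2) * D x)"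
      unfolding L2_sq_def by (intro integral_mono L2_spaceD(2)[OF L] i le)
    also have "\<dots> = K\<^sup>2 * decay_integral\<^sup>2" by (simp add: ID power2_eq_square)
    finally have "L2_sq (\<psi> l) \<le> K\<^sup>2 * decay_integral\<^sup>2" .
    with L show ?thesis by simp
  qed
  show ?thesis
    by (rule that[of "K\<^sup>2 * decay_integral\<^sup>2 + 1"]) (use key in \<open>auto simp: add_increasing2 intro: add_nonneg_pos\<close>)
qed

lemma psi_in_L2: "\<psi> l \<in> L2_space" using psi_L2 by metis

lemma psi_L1_scale:
  obtains K where "K > 0"
    "\<And>\<iota> b g. integrable lborel g \<Longrightarrow> asummable (\<lambda>p. LINT x|lborel. norm (g x :: complex) * norm (\<psi> (\<iota>, b, p) x))"
    "\<And>\<iota> b g. integrable lborel g \<Longrightarrow>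
        asum (\<lambda>p. LINT x|lborel. norm (g x :: complex) * norm (\<psi> (\<iota>, b, p) x)) \<le> K * 2 powi b * (LINT x|lborel. norm (g x))"
proof -
  obtain K where K: "K > 0" 
    "\<And>\<iota> b x. asummable (\<lambda>p. \<psi> (\<iota>, b, p) x)"
    "\<And>\<iota> b x. asum (\<lambda>p. norm (\<psi> (\<iota>, b, p) x)) \<le> K * 2 powi b"
    by (rule psi_bounds, rule that, assumption+)
  have *: "asummable (\<lambda>p. LINT x|lborel. norm (g x) * norm (\<psi> (\<iota>, b, p) x))"
    "asum (\<lambda>p. LINT x|lborel. norm (g x) * norm (\<psi> (\<iota>, b, p) x)) \<le> (LINT x|lborel. K * 2 powi b * norm (g x))"
    if g: "integrable lborel g" for g :: "real \<times> real \<Rightarrow> complex" and \<iota> b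
  proof -
    have [measurable]: "g \<in> borel_measurable borel" using g by (auto dest: borel_measurable_integrable)
    note [measurable] = psi_measurable
    have m: "(\<lambda>x. norm (g x) * norm (\<psi> (\<iota>, b, p) x)) \<in> borel_measurable lborel" for p by measurable
    have s: "asummable (\<lambda>p. norm (g x) * norm (\<psi> (\<iota>, b, p) x))" for x
      by (intro integrable_mult_right integrable_norm K)
    have le: "asum (\<lambda>p. norm (g x) * norm (\<psi> (\<iota>, b, p) x)) \<le> K * 2 powi b * norm (g x)" for x
      using mult_left_mono[OF K(3), of "norm (g x)" \<iota> b x] by (simp add: mult_ac)
    have G: "integrable lborel (\<lambda>x. K * 2 powi b * norm (g x))" by (intro integrable_mult_right integrable_norm g)
    note r = asum_integral_bound[of lborel "\<lambda>p x. norm (g x) * norm (\<psi> (\<iota>, b, p) x)", OF lborel.sigma_finite_measure_axioms m _ s le G]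
    show "asummable (\<lambda>p. LINT x|lborel. norm (g x) * norm (\<psi> (\<iota>, b, p) x))"
      "asum (\<lambda>p. LINT x|lborel. norm (g x) * norm (\<psi> (\<iota>, b, p) x)) \<le> (LINT x|lborel. K * 2 powi b * norm (g x))"
      by (rule r(2,3); simp)+
  qed
  show ?thesis by (rule that[OF K(1) *(1)]) (use *(2) in simp_all)
qed

lemma coefficients_summable_scale:
  assumes "integrable lborel g"
  shows "asummable (\<lambda>p. L2_inner g (\<psi> (\<iota>, b, p)))"
proof -
  have s: "asummable (\<lambda>p. LINT x|lborel. norm (g x) * norm (\<psi> (\<iota>, b, p) x))"
    by (rule psi_L1_scale) (use assms in blast)
  show ?thesis
    by (rule asummable_bound(1)[OF s])
      (unfold L2_inner_def, rule order_trans[OF integral_norm_bound], simp add: norm_mult)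
qed

lemma psi_coefficient_bound:
  assumes f: "f \<in> L2_space"
  obtains C where "C > 0" "\<And>l. norm (L2_inner f (\<psi> l)) \<le> C"
proof -
  obtain Kn where Kn: "Kn > 0" "\<And>l. \<psi> l \<in> L2_space" "\<And>l. L2_sq (\<psi> l) \<le> Kn"
    by (rule psi_L2, rule that, assumption+)
  show ?thesis
  proof (rule that[of "L2_sq f + Kn"])
    show "L2_sq f + Kn > 0" using Kn L2_sq_nonneg[of f] by simp
    show "norm (L2_inner f (\<psi> l)) \<le> L2_sq f + Kn" for l
      by (rule order_trans[OF L2_inner_bound[OF f Kn(2)]]) (use Kn(3) in simp)
  qed
qed

text \<open>With \<open>q = 2k(2\<cdot>) - k\<close> the three orientations give \<open>k q + q k + q q = (k
  + q)(k + q) - k k\<close>.\<close>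

lemma factor_kernel:
  "(\<Sum>\<iota>\<in>UNIV. ift (\<lambda>t. factor1 \<iota> t * cnj (factor1 \<iota> t)) z1 * ift (\<lambda>t. factor2 \<iota> t * cnj (factor2 \<iota> t)) z2)
    = 4 * (low_kernel (2 * z1) * low_kernel (2 * z2)) - low_kernel z1 * low_kernel z2"
proof -
  have b: "band_kernel z = 2 * low_kernel (2 * z) - low_kernel z" for z
    using low_plus_band[of z] by (simp add: algebra_simps)
  show ?thesis
    unfolding UNIV_orientation
    by (simp add: factor1.simps factor2.simps flip: low_kernel_def band_kernel_def)
      (simp add: b algebra_simps)
qed

definition scale_kernel :: "int \<Rightarrow> real \<times> real \<Rightarrow> complex" where
  "scale_kernel b z = (2 powi b * low_kernel (2 powi b * fst z)) * (2 powi b * low_kernel (2 powi b * snd z))"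

lemma psi_scale_sum:
  "asum (\<lambda>p. \<psi> (\<iota>, b, p) x * cnj (\<psi> (\<iota>, b, p) y)) =
    (2 powi b)\<^sup>2 * (ift (\<lambda>t. factor1 \<iota> t * cnj (factor1 \<iota> t)) (2 powi b * (fst x - fst y)) *
                   ift (\<lambda>t. factor2 \<iota> t * cnj (factor2 \<iota> t)) (2 powi b * (snd x - snd y)))"
proof -
  have s: "asummable (\<lambda>n::int. ift u (x - of_int n) * cnj (ift v (y - of_int n)))" if u: "bump R u" and v: "bump R' v" for u v R R' x y
  proof -
    have C: "asummable (\<lambda>n::int. ift u (x - of_int n))" by (rule ift_int_bound[OF u])
    show ?thesis
      by (rule integrable_mult_bounded[OF C]) (use norm_ift_le[OF bump_integrable[OF v]] in simp_all)
  qed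
  have pc: "cnj (2 powi b :: complex) = 2 powi b"
    by (simp add: power_int_def)
  have "asum (\<lambda>p. \<psi> (\<iota>, b, p) x * cnj (\<psi> (\<iota>, b, p) y)) =
    asum (\<lambda>p. (2 powi b)\<^sup>2 * ((atom (factor1 \<iota>) b (fst p) (fst x) * cnj (atom (factor1 \<iota>) b (fst p) (fst y))) *
      (atom (factor2 \<iota>) b (snd p) (snd x) * cnj (atom (factor2 \<iota>) b (snd p) (snd y)))))"
  proof (rule arg_cong[of _ _ asum], rule ext)
    fix p :: "int \<times> int"
    obtain k1 k2 where p: "p = (k1, k2)" by (cases p)
    show "\<psi> (\<iota>, b, p) x * cnj (\<psi> (\<iota>, b, p) y) = (2 powi b)\<^sup>2 * ((atom (factor1 \<iota>) b (fst p) (fst x) * cnj (atom (factor1 \<iota>) b (fst p) (fst y))) *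
      (atom (factor2 \<iota>) b (snd p) (snd x) * cnj (atom (factor2 \<iota>) b (snd p) (snd y))))"
      unfolding p meyer_psi_eq complex_cnj_mult pc fst_conv snd_conv by (simp add: power2_eq_square mult_ac)
  qed
  also have "\<dots> = (2 powi b)\<^sup>2 * (asum (\<lambda>k. atom (factor1 \<iota>) b k (fst x) * cnj (atom (factor1 \<iota>) b k (fst y))) *
      asum (\<lambda>k. atom (factor2 \<iota>) b k (snd x) * cnj (atom (factor2 \<iota>) b k (snd y))))"
    unfolding atom_def integral_mult_right_zero
    by (subst asum_prod(2)[OF s[OF bump_factor(1) bump_factor(1)] s[OF bump_factor(2) bump_factor(2)]]) (rule refl)
  finally show ?thesis
    unfolding atom_def shannon_parseval[OF bump_factor(1) bump_factor(1)] shannon_parseval[OF bump_factor(2) bump_factor(2)]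
    by (simp add: right_diff_distrib)
qed

lemma psi_scale_sum_all:
  "(\<Sum>\<iota>\<in>UNIV. asum (\<lambda>p. \<psi> (\<iota>, b, p) x * cnj (\<psi> (\<iota>, b, p) y))) =
    scale_kernel (b + 1) (x - y) - scale_kernel b (x - y)"
proof -
  have "2 powi (b + 1) = (2 * 2 powi b :: real)" "2 powi (b + 1) = (2 * 2 powi b :: complex)"
    by (simp_all add: power_int_add)
  then show ?thesis
    unfolding psi_scale_sum sum_distrib_left[symmetric] factor_kernel scale_kernel_def
    by (simp add: algebra_simps power2_eq_square)
qed

section \<open>Low-pass filtering of a box\<close>

text \<open>The convolution of the indicator function of an interval with \<open>2^b k(2^b \<cdot>)\<close>.\<close>

definition box_conv :: "int \<Rightarrow> real \<Rightarrow> real \<Rightarrow> real \<Rightarrow> complex" where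
  "box_conv b l u x = (LINT y|lborel. indicator {l<..<u} y *\<^sub>R (2 powi b * low_kernel (2 powi b * (x - y))))"

lemma box_conv_alt:
  "box_conv b l u x = (LINT z|lborel. indicator {l<..<u} (x - z / 2 powi b) *\<^sub>R low_kernel z)"
proof -
  have c: "(- 1 / 2 powi b :: real) \<noteq> 0" by simp
  have "box_conv b l u x = \<bar>- 1 / 2 powi b :: real\<bar> *\<^sub>R (LINT z|lborel. indicator {l<..<u} (x + (- 1 / 2 powi b) * z) *\<^sub>R
     (2 powi b * low_kernel (2 powi b * (x - (x + (- 1 / 2 powi b) * z)))))"
    unfolding box_conv_def by (rule lborel_integral_real_affine[OF c])
  also have "\<dots> = (LINT z|lborel. indicator {l<..<u} (x - z / 2 powi b) *\<^sub>R low_kernel z)"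
    unfolding integral_scaleR_right[symmetric]
    by (intro Bochner_Integration.integral_cong refl) (simp add: scaleR_conv_of_real of_real_power_int)
  finally show ?thesis .
qed

lemma box_conv_measurable [measurable]: "box_conv b l u \<in> borel_measurable borel"
  unfolding box_conv_def[abs_def] by measurable

lemma box_conv_int: "integrable lborel (\<lambda>y. indicator {l<..<u} y *\<^sub>R (2 powi b * low_kernel (2 powi b * (x - y))))"
proof -
  have "integrable lborel (\<lambda>y. low_kernel (2 powi b * x + (- (2 powi b)) * y))"
    by (rule lborel_integrable_real_affine[OF low_kernel_integral(1)]) simp
  then have "integrable lborel (\<lambda>y. 2 powi b * low_kernel (2 powi b * (x - y)))"
    by (intro integrable_mult_right) (simp add: algebra_simps)
  then show ?thesis by (intro integrable_mult_indicator) auto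
qed

lemma box_conv_le:
  assumes "\<And>y. y \<in> {l<..<u} \<Longrightarrow> norm (2 powi b * low_kernel (2 powi b * (x - y))) \<le> B" and B: "B \<ge> 0"
  shows "norm (box_conv b l u x) \<le> \<bar>u - l\<bar> * B"
proof -
  have "norm (box_conv b l u x) \<le> (LINT y|lborel. norm (indicator {l<..<u} y *\<^sub>R (2 powi b * low_kernel (2 powi b * (x - y)))))"
    unfolding box_conv_def by (rule integral_norm_bound)
  also have "\<dots> \<le> (LINT y|lborel. indicator {l<..<u} y * B)"
  proof (rule integral_mono)
    show "integrable lborel (\<lambda>y. indicator {l<..<u} y * B)"
      by (intro integrable_mult_left integrable_real_indicator) (use lborel_Ioo_finite[of l u] in auto)
    show "integrable lborel (\<lambda>y. norm (indicator {l<..<u} y *\<^sub>R (2 powi b * low_kernel (2 powi b * (x - y)))))"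
      by (intro integrable_norm box_conv_int)
  qed (use assms in \<open>auto simp: indicator_def\<close>)
  also have "\<dots> \<le> \<bar>u - l\<bar> * B"
    using B by (auto intro!: mult_right_mono measure_lborel_Ioo_le)
  finally show ?thesis .
qed

text \<open>A single dominating function serves all scales, fine and coarse: \<open>s / (1 + s\<^sup>2
  t\<^sup>2) \<le> 1 / (2t)\<close> for every \<open>s > 0\<close>, which gives decay like
  \<open>1/\<bar>x\<bar>\<close> away from the interval, and near the interval the
  \<open>L\<^sup>1\<close>-norm of the kernel is a bound. Decay \<open>1/\<bar>x\<bar>\<close> is
  square-integrable, and this is all that pairing with an \<open>L\<^sup>2\<close> function
  requires.\<close>

lemma box_conv_dominated:
  obtains D where "D > 0" "\<And>b x. (cmod (box_conv b l u x))\<^sup>2 \<le> D * decay x"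
proof -
  obtain C where C: "C > 0" "\<And>x. norm (low_kernel x) \<le> C * decay x" using low_kernel_decay by blast
  define A where "A = (LINT z|lborel. norm (low_kernel z))"
  define R where "R = 2 * (\<bar>l\<bar> + \<bar>u\<bar>) + 1"
  define E where "E = C * \<bar>u - l\<bar>"
  have A: "norm (box_conv b l u x) \<le> A" for b x
  proof -
    have "norm (box_conv b l u x) \<le> (LINT z|lborel. norm (indicator {l<..<u} (x - z / 2 powi b) *\<^sub>R low_kernel z))"
      unfolding box_conv_alt by (rule integral_norm_bound)
    also have "\<dots> \<le> A"
      unfolding A_def by (rule integral_mono')
        (use low_kernel_integral(1) in \<open>auto simp: indicator_def\<close>)
    finally show ?thesis .
  qed
  have B: "norm (box_conv b l u x) * \<bar>x\<bar> \<le> E" if x: "\<bar>x\<bar> \<ge> R" for b x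
  proof -
    have x0: "\<bar>x\<bar> > 0" using x by (simp add: R_def)
    have "norm (box_conv b l u x) \<le> \<bar>u - l\<bar> * (C / \<bar>x\<bar>)"
    proof (rule box_conv_le)
      fix y assume y: "y \<in> {l<..<u}"
      define s where "s = (2 powi b :: real)"
      have s: "s > 0" by (simp add: s_def)
      define t where "t = \<bar>x - y\<bar>"
      have *: "\<bar>y\<bar> \<le> \<bar>l\<bar> + \<bar>u\<bar>" using y by auto
      have "p \<le> 2 * q" if "r \<le> s" "2 * s + 1 \<le> p" "p - r \<le> q" for p q r s :: real using that by linarith
      from this[OF * _ abs_triangle_ineq2] have t: "2 * t \<ge> \<bar>x\<bar>" using x unfolding R_def t_def by blast
      have t0: "t > 0" using t x0 by simp
      \<comment> \<open>The scale-free bound \<open>s / (1 + s\<^sup>2 t\<^sup>2) \<le> 1 / (2 t)\<close>.\<close>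
      have "0 \<le> (1 - s * t)\<^sup>2" by simp
      then have "s * (2 * t) \<le> 1 + (s * t)\<^sup>2" by (simp add: power2_diff)
      moreover have "s * \<bar>x\<bar> \<le> s * (2 * t)" using s t by (intro mult_left_mono) auto
      ultimately have le: "s * \<bar>x\<bar> \<le> 1 + (s * t)\<^sup>2" by linarith
      have "s * decay (s * (x - y)) = s / (1 + (s * t)\<^sup>2)" by (simp add: decay_def t_def power_mult_distrib)
      also have "\<dots> \<le> 1 / \<bar>x\<bar>" using le x0 by (simp add: field_simps add_pos_nonneg)
      finally have "C * (s * decay (s * (x - y))) \<le> C * (1 / \<bar>x\<bar>)" using C by (intro mult_left_mono) auto
      moreover have "norm (2 powi b * low_kernel (2 powi b * (x - y))) \<le> s * (C * decay (s * (x - y)))"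
        using C(2)[of "s * (x - y)"] s by (simp add: norm_mult norm_power_int s_def)
      ultimately show "norm (2 powi b * low_kernel (2 powi b * (x - y))) \<le> C / \<bar>x\<bar>"
        by (simp add: mult.left_commute)
    qed (use C in simp)
    then have "norm (box_conv b l u x) \<le> E / \<bar>x\<bar>" by (simp add: E_def mult.commute)
    then show ?thesis using x0 by (simp add: field_simps)
  qed
  have A0: "A \<ge> 0" by (simp add: A_def)
  define D where "D = A\<^sup>2 * (1 + R\<^sup>2) + 2 * E\<^sup>2 + 1"
  have "(cmod (box_conv b l u x))\<^sup>2 * (1 + x\<^sup>2) \<le> D" for b x
  proof (cases "\<bar>x\<bar> \<ge> R")
    case True
    have "1 \<le> \<bar>x\<bar>" using True by (simp add: R_def)
    then have x1: "1 \<le> x\<^sup>2" using one_le_power[of "\<bar>x\<bar>" 2] by simp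
    have "(norm (box_conv b l u x) * \<bar>x\<bar>)\<^sup>2 \<le> E\<^sup>2" by (intro power_mono B True) simp
    then have "(cmod (box_conv b l u x))\<^sup>2 * x\<^sup>2 \<le> E\<^sup>2" by (simp add: power_mult_distrib)
    moreover have "(cmod (box_conv b l u x))\<^sup>2 * 1 \<le> (cmod (box_conv b l u x))\<^sup>2 * x\<^sup>2"
      by (intro mult_left_mono x1) simp
    moreover have "0 \<le> A\<^sup>2 * (1 + R\<^sup>2)" by simp
    moreover have "p * (1 + q) \<le> r + 2 * s + 1" if "p * q \<le> s" "p * 1 \<le> p * q" "0 \<le> r" for p q r s :: real
      using that by (simp add: distrib_left)
    ultimately show ?thesis unfolding D_def by blast
  next
    case False
    then have "\<bar>x\<bar> \<le> \<bar>R\<bar>" by simp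
    then have "x\<^sup>2 \<le> R\<^sup>2" by (simp only: abs_le_square_iff)
    moreover have "(cmod (box_conv b l u x))\<^sup>2 \<le> A\<^sup>2" by (intro power_mono A) simp
    ultimately have "(cmod (box_conv b l u x))\<^sup>2 * (1 + x\<^sup>2) \<le> A\<^sup>2 * (1 + R\<^sup>2)" by (intro mult_mono) auto
    moreover have "0 \<le> E\<^sup>2" by simp
    ultimately show ?thesis unfolding D_def by linarith
  qed
  then have "(cmod (box_conv b l u x))\<^sup>2 \<le> D * decay x" for b x
    by (simp add: decay_def pos_le_divide_eq add_pos_nonneg)
  moreover have "D > 0" unfolding D_def by (intro add_nonneg_pos) auto
  ultimately show ?thesis using that by blast
qed

lemma box_conv_fine:
  assumes "x \<noteq> l" "x \<noteq> u"
  shows "(\<lambda>n. box_conv (int n) l u x) \<longlonglongrightarrow> indicator {l<..<u} x"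
proof -
  have "(\<lambda>n. box_conv (int n) l u x) \<longlonglongrightarrow> (LINT z|lborel. indicator {l<..<u} x *\<^sub>R low_kernel z)"
    unfolding box_conv_alt
  proof (rule integral_dominated_convergence[where w="\<lambda>z. norm (low_kernel z)"])
    show "AE z in lborel. (\<lambda>n. indicator {l<..<u} (x - z / 2 powi int n) *\<^sub>R low_kernel z)
       \<longlonglongrightarrow> indicator {l<..<u} x *\<^sub>R low_kernel z"
    proof (rule AE_I2)
      fix z
      have lim: "(\<lambda>n. x - z / 2 powi int n) \<longlonglongrightarrow> x"
        using tendsto_diff[OF tendsto_const powi2_tendsto, of x z] by simp
      have "\<forall>\<^sub>F n in sequentially. (indicator {l<..<u} (x - z / 2 powi int n) :: real) = indicator {l<..<u} x"
      proof (cases "x \<in> {l<..<u}")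
        case True
        then have "\<forall>\<^sub>F n in sequentially. x - z / 2 powi int n \<in> {l<..<u}"
          using lim by (intro topological_tendstoD[OF lim]) auto
        then show ?thesis by eventually_elim (use True in simp)
      next
        case False
        then have "x \<in> {..<l} \<union> {u<..}" using assms by auto
        then have "\<forall>\<^sub>F n in sequentially. x - z / 2 powi int n \<in> {..<l} \<union> {u<..}"
          by (intro topological_tendstoD[OF lim]) auto
        then show ?thesis by eventually_elim (use False in \<open>auto simp: indicator_def\<close>)
      qed
      then have "\<forall>\<^sub>F n in sequentially. indicator {l<..<u} (x - z / 2 powi int n) *\<^sub>R low_kernel z = indicator {l<..<u} x *\<^sub>R low_kernel z"
        by eventually_elim simp
      then show "(\<lambda>n. indicator {l<..<u} (x - z / 2 powi int n) *\<^sub>R low_kernel z) \<longlonglongrightarrow> indicator {l<..<u} x *\<^sub>R low_kernel z"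
        by (rule tendsto_eventually)
    qed
    show "AE z in lborel. norm (indicator {l<..<u} (x - z / 2 powi int n) *\<^sub>R low_kernel z) \<le> norm (low_kernel z)" for n
      by (rule AE_I2) (auto simp: indicator_def)
  qed (use low_kernel_integral(1) in auto)
  also have "(LINT z|lborel. indicator {l<..<u} x *\<^sub>R low_kernel z) = indicator {l<..<u} x"
    using low_kernel_integral(2) by (simp add: scaleR_conv_of_real indicator_def)
  finally show ?thesis .
qed

lemma box_conv_coarse: "(\<lambda>n. box_conv (- int n) l u x) \<longlonglongrightarrow> 0"
proof -
  obtain C where C: "C > 0" "\<And>x. norm (low_kernel x) \<le> C * decay x" using low_kernel_decay by blast
  have C': "norm (low_kernel x) \<le> C" for x
    using order_trans[OF C(2) mult_left_mono[OF decay_le_1]] C(1) by simp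
  have "norm (box_conv (- int n) l u x) \<le> (\<bar>u - l\<bar> * C) / 2 powi int n" for n
  proof -
    have "norm (box_conv (- int n) l u x) \<le> \<bar>u - l\<bar> * (C / 2 powi int n)"
    proof (rule box_conv_le)
      show "norm (2 powi (- int n) * low_kernel (2 powi (- int n) * (x - y))) \<le> C / 2 powi int n" for y
        using C'[of "2 powi (- int n) * (x - y)"] by (simp add: norm_mult norm_divide norm_power power_int_minus divide_simps)
    qed (use C in simp)
    then show ?thesis by simp
  qed
  then show ?thesis
    by (rule Lim_null_comparison[OF always_eventually[OF allI] powi2_tendsto])
qed

definition box_conv2 :: "int \<Rightarrow> real \<times> real \<Rightarrow> real \<times> real \<Rightarrow> real \<times> real \<Rightarrow> complex" where
  "box_conv2 b l u x = box_conv b (fst l) (fst u) (fst x) * box_conv b (snd l) (snd u) (snd x)"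

lemma box_conv2_dominated:
  obtains D where "D > 0" "\<And>b x. (cmod (box_conv2 b l u x))\<^sup>2 \<le> D * (decay (fst x) * decay (snd x))"
proof -
  obtain D1 where D1: "D1 > 0" "\<And>b x. (cmod (box_conv b (fst l) (fst u) x))\<^sup>2 \<le> D1 * decay x"
    by (rule box_conv_dominated[of "fst l" "fst u"], rule that, assumption+)
  obtain D2 where D2: "D2 > 0" "\<And>b x. (cmod (box_conv b (snd l) (snd u) x))\<^sup>2 \<le> D2 * decay x"
    by (rule box_conv_dominated[of "snd l" "snd u"], rule that, assumption+)
  show ?thesis
  proof (rule that[of "D1 * D2"])
    show "D1 * D2 > 0" using D1 D2 by simp
    fix b x
    have "(cmod (box_conv2 b l u x))\<^sup>2 \<le> (D1 * decay (fst x)) * (D2 * decay (snd x))"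
      unfolding box_conv2_def norm_mult power_mult_distrib using D1 D2 by (intro mult_mono) auto
    then show "(cmod (box_conv2 b l u x))\<^sup>2 \<le> D1 * D2 * (decay (fst x) * decay (snd x))" by (simp add: mult_ac)
  qed
qed

lemma box_conv2_measurable: "box_conv2 b l u \<in> borel_measurable borel"
  unfolding box_conv2_def[abs_def]
  by (intro borel_measurable_times measurable_fst_real measurable_snd_real box_conv_measurable)

lemma box_conv2_L2: "box_conv2 b l u \<in> L2_space"
proof -
  obtain D where D: "D > 0" "\<And>b x. (cmod (box_conv2 b l u x))\<^sup>2 \<le> D * (decay (fst x) * decay (snd x))"
    by (rule box_conv2_dominated[of l u], rule that, assumption+)
  show ?thesis by (rule L2_spaceI[OF box_conv2_measurable decay2_integrable D(2)])
qed

lemma box_scale_expansion: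
  fixes l u :: "real \<times> real"
  defines "g \<equiv> \<lambda>x::real \<times> real. indicator (box l u) x :: complex"
  shows "(\<Sum>\<iota>\<in>UNIV. asum (\<lambda>p. L2_inner g (\<psi> (\<iota>, b, p)) * \<psi> (\<iota>, b, p) x)) =
    box_conv2 (b + 1) l u x - box_conv2 b l u x"
proof -
  obtain Kn where Kn: "Kn > 0" "\<And>l. \<psi> l \<in> L2_space" "\<And>l. L2_sq (\<psi> l) \<le> Kn"
    by (rule psi_L2, rule that, assumption+)
  have g: "g \<in> L2_space" unfolding g_def by (rule box_indicator_L2)
  define S where "S = (\<lambda>\<iota> y. asum (\<lambda>p. \<psi> (\<iota>, b, p) x * cnj (\<psi> (\<iota>, b, p) y)))"
  have 1: "integrable lborel (\<lambda>y. g y * S \<iota> y)"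
    "asum (\<lambda>p. L2_inner g (\<psi> (\<iota>, b, p)) * \<psi> (\<iota>, b, p) x) = (LINT y|lborel. g y * S \<iota> y)" for \<iota>
  proof -
    have s: "asummable (\<lambda>p. \<psi> (\<iota>, b, p) x)" by (rule psi_bounds)
    note sw = asum_L2_swap[of "\<lambda>_. g" "\<lambda>p. \<psi> (\<iota>, b, p)", OF g Kn(2) add_left_mono[OF Kn(3)] s]
    have FS: "asum (\<lambda>p. g y * cnj (\<psi> (\<iota>, b, p) y) * \<psi> (\<iota>, b, p) x) = g y * S \<iota> y" for y
      unfolding S_def by (simp add: mult_ac flip: integral_mult_right_zero)
    show "integrable lborel (\<lambda>y. g y * S \<iota> y)" using sw(1) unfolding FS .
    show "asum (\<lambda>p. L2_inner g (\<psi> (\<iota>, b, p)) * \<psi> (\<iota>, b, p) x) = (LINT y|lborel. g y * S \<iota> y)"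
      using sw(2) unfolding FS by (rule sym)
  qed
  have 2: "integrable lborel (\<lambda>y. g y * scale_kernel b (x - y))"
    "(LINT y|lborel. g y * scale_kernel b (x - y)) = box_conv2 b l u x" for b
  proof -
    let ?p = "\<lambda>y. indicator {fst l<..<fst u} y *\<^sub>R (2 powi b * low_kernel (2 powi b * (fst x - y)))"
    let ?q = "\<lambda>y. indicator {snd l<..<snd u} y *\<^sub>R (2 powi b * low_kernel (2 powi b * (snd x - y)))"
    have e: "g y * scale_kernel b (x - y) = ?p (fst y) * ?q (snd y)" for y
      unfolding g_def scale_kernel_def 
      using indicator_box_prod[of "fst l" "snd l" "fst u" "snd u" y, where 'a=complex]
      by (simp add: scaleR_conv_of_real of_real_indicator)
    show "integrable lborel (\<lambda>y. g y * scale_kernel b (x - y))"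
      unfolding e by (intro integrable_prod_mult(1) box_conv_int)
    show "(LINT y|lborel. g y * scale_kernel b (x - y)) = box_conv2 b l u x"
      unfolding e box_conv2_def box_conv_def by (intro integrable_prod_mult(2) box_conv_int)
  qed
  have "(\<Sum>\<iota>\<in>UNIV. asum (\<lambda>p. L2_inner g (\<psi> (\<iota>, b, p)) * \<psi> (\<iota>, b, p) x)) =
    (LINT y|lborel. (\<Sum>\<iota>\<in>UNIV. g y * S \<iota> y))"
    unfolding 1(2) by (rule Bochner_Integration.integral_sum[symmetric]) (rule 1(1))
  also have "\<dots> = (LINT y|lborel. g y * scale_kernel (b + 1) (x - y) - g y * scale_kernel b (x - y))"
    unfolding S_def sum_distrib_left[symmetric] psi_scale_sum_all by (simp add: right_diff_distrib)
  also have "\<dots> = box_conv2 (b + 1) l u x - box_conv2 b l u x"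
    by (simp add: 2)
  finally show ?thesis .
qed

section \<open>Reconstruction from the wavelet coefficients\<close>

text \<open>The sum over translations is moved onto the box, where \<open>box_scale_expansion\<close>
  evaluates it; for \<open>f\<close> itself only square-integrability is at hand.\<close>

lemma scale_pairing:
  fixes l u :: "real \<times> real"
  defines "g \<equiv> \<lambda>x::real \<times> real. indicator (box l u) x :: complex"
  assumes f: "f \<in> L2_space"
  shows "(\<Sum>\<iota>\<in>UNIV. asum (\<lambda>p. L2_inner f (\<psi> (\<iota>, b, p)) * cnj (L2_inner g (\<psi> (\<iota>, b, p))))) =
    L2_inner f (box_conv2 (b + 1) l u) - L2_inner f (box_conv2 b l u)"
proof -
  obtain Kn where Kn: "Kn > 0" "\<And>l. \<psi> l \<in> L2_space" "\<And>l. L2_sq (\<psi> l) \<le> Kn"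
    by (rule psi_L2, rule that, assumption+)
  have g: "g \<in> L2_space" "integrable lborel g" unfolding g_def by (rule box_indicator_L2)+
  define S where "S = (\<lambda>\<iota> x. asum (\<lambda>p. L2_inner g (\<psi> (\<iota>, b, p)) * \<psi> (\<iota>, b, p) x))"
  have 1: "integrable lborel (\<lambda>x. f x * cnj (S \<iota> x))"
    "asum (\<lambda>p. L2_inner f (\<psi> (\<iota>, b, p)) * cnj (L2_inner g (\<psi> (\<iota>, b, p)))) = (LINT x|lborel. f x * cnj (S \<iota> x))" for \<iota>
  proof -
    let ?d = "\<lambda>p. cnj (L2_inner g (\<psi> (\<iota>, b, p)))"
    have d: "asummable ?d" by (intro integrable_cnj coefficients_summable_scale g)
    note sw = asum_L2_swap[of "\<lambda>_. f" "\<lambda>p. \<psi> (\<iota>, b, p)", OF f Kn(2) add_left_mono[OF Kn(3)] d]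
    have FS: "asum (\<lambda>p. f x * cnj (\<psi> (\<iota>, b, p) x) * ?d p) = f x * cnj (S \<iota> x)" for x
    proof -
      have "asum (\<lambda>p. f x * cnj (\<psi> (\<iota>, b, p) x) * ?d p) =
          asum (\<lambda>p. f x * cnj (L2_inner g (\<psi> (\<iota>, b, p)) * \<psi> (\<iota>, b, p) x))"
        by (rule arg_cong[of _ _ asum]) (simp add: mult_ac)
      then show ?thesis by (simp only: S_def integral_mult_right_zero Bochner_Integration.integral_cnj)
    qed
    show "integrable lborel (\<lambda>x. f x * cnj (S \<iota> x))" using sw(1) unfolding FS .
    show "asum (\<lambda>p. L2_inner f (\<psi> (\<iota>, b, p)) * ?d p) = (LINT x|lborel. f x * cnj (S \<iota> x))"
      using sw(2) unfolding FS by (rule sym)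
  qed
  have "(\<Sum>\<iota>\<in>UNIV. asum (\<lambda>p. L2_inner f (\<psi> (\<iota>, b, p)) * cnj (L2_inner g (\<psi> (\<iota>, b, p))))) =
    (LINT x|lborel. (\<Sum>\<iota>\<in>UNIV. f x * cnj (S \<iota> x)))"
    unfolding 1(2) by (rule Bochner_Integration.integral_sum[symmetric]) (rule 1(1))
  also have "\<dots> = L2_inner f (\<lambda>x. box_conv2 (b + 1) l u x - box_conv2 b l u x)"
  proof -
    have "(\<Sum>\<iota>\<in>UNIV. S \<iota> x) = box_conv2 (b + 1) l u x - box_conv2 b l u x" for x
      unfolding S_def g_def by (rule box_scale_expansion)
    then show ?thesis
      unfolding L2_inner_def by (simp only: sum_distrib_left[symmetric] cnj_sum[symmetric])
  qed
  also have "\<dots> = L2_inner f (box_conv2 (b + 1) l u) - L2_inner f (box_conv2 b l u)"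
    by (intro L2_inner_diff_right f box_conv2_L2)
  finally show ?thesis .
qed

lemma box_conv2_pairing_limit:
  fixes l u :: "real \<times> real"
  assumes f: "f \<in> L2_space"
  shows "(\<lambda>n. L2_inner f (box_conv2 (int n) l u)) \<longlonglongrightarrow> L2_inner f (indicator (box l u))"
    and "(\<lambda>n. L2_inner f (box_conv2 (- int n) l u)) \<longlonglongrightarrow> 0"
proof -
  obtain D where D: "D > 0" "\<And>b x. (cmod (box_conv2 b l u x))\<^sup>2 \<le> D * (decay (fst x) * decay (snd x))"
    by (rule box_conv2_dominated[of l u], rule that, assumption+)
  define w where "w = (\<lambda>x. (cmod (f x))\<^sup>2 + D * (decay (fst x) * decay (snd x)))"
  note [measurable] = L2_spaceD(1)[OF f] box_conv2_measurable
  have w: "integrable lborel w"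
    unfolding w_def by (intro Bochner_Integration.integrable_add L2_spaceD f decay2_integrable)
  have bound: "AE x in lborel. norm (f x * cnj (box_conv2 b l u x)) \<le> w x" for b
  proof (rule AE_I2)
    fix x
    have "norm (f x * cnj (box_conv2 b l u x)) \<le> (cmod (f x))\<^sup>2 + (cmod (box_conv2 b l u x))\<^sup>2"
      by (simp add: norm_mult mult_le_sum_squares)
    also have "\<dots> \<le> w x" unfolding w_def by (intro add_left_mono D)
    finally show "norm (f x * cnj (box_conv2 b l u x)) \<le> w x" .
  qed
  have m: "(\<lambda>x. f x * cnj (box_conv2 b l u x)) \<in> borel_measurable lborel" for b by measurable
  have mi: "(\<lambda>x. f x * cnj (indicator (box l u) x)) \<in> borel_measurable lborel"
    using L2_mult(1)[OF f box_indicator_L2(1)] by (rule borel_measurable_integrable)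
  show "(\<lambda>n. L2_inner f (box_conv2 (int n) l u)) \<longlonglongrightarrow> L2_inner f (indicator (box l u))"
    unfolding L2_inner_def
  proof (rule integral_dominated_convergence[OF mi m w _ bound])
    show "AE x in lborel. (\<lambda>n. f x * cnj (box_conv2 (int n) l u x)) \<longlonglongrightarrow> f x * cnj (indicator (box l u) x)"
      using AE_not_on_lines[of "fst l" "fst u" "snd l" "snd u"]
    proof eventually_elim
      case (elim x)
      have "(\<lambda>n. box_conv2 (int n) l u x) \<longlonglongrightarrow> indicator {fst l<..<fst u} (fst x) * indicator {snd l<..<snd u} (snd x)"
        unfolding box_conv2_def by (intro tendsto_mult box_conv_fine) (use elim in auto)
      moreover have "indicator {fst l<..<fst u} (fst x) * indicator {snd l<..<snd u} (snd x) = (indicator (box l u) x :: complex)"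
        using indicator_box_prod[of "fst l" "snd l" "fst u" "snd u" x, where 'a=complex] by simp
      ultimately have "(\<lambda>n. box_conv2 (int n) l u x) \<longlonglongrightarrow> indicator (box l u) x" by simp
      then show ?case by (intro tendsto_mult tendsto_const tendsto_cnj)
    qed
  qed
  have "(\<lambda>n. L2_inner f (box_conv2 (- int n) l u)) \<longlonglongrightarrow> L2_inner f (\<lambda>_. 0)"
    unfolding L2_inner_def
  proof (rule integral_dominated_convergence[OF _ m w _ bound])
    show "AE x in lborel. (\<lambda>n. f x * cnj (box_conv2 (- int n) l u x)) \<longlonglongrightarrow> f x * cnj 0"
    proof (rule AE_I2)
      fix x
      have "(\<lambda>n. box_conv2 (- int n) l u x) \<longlonglongrightarrow> 0 * 0"
        unfolding box_conv2_def by (intro tendsto_mult box_conv_coarse)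
      then have "(\<lambda>n. box_conv2 (- int n) l u x) \<longlonglongrightarrow> 0" by simp
      then show "(\<lambda>n. f x * cnj (box_conv2 (- int n) l u x)) \<longlonglongrightarrow> f x * cnj 0"
        by (intro tendsto_mult tendsto_const tendsto_cnj)
    qed
  qed simp
  then show "(\<lambda>n. L2_inner f (box_conv2 (- int n) l u)) \<longlonglongrightarrow> 0" by (simp add: L2_inner_def)
qed

text \<open>The contributions of the scales telescope, leaving a filtered box at a very fine scale, which
  tends to the box, and one at a very coarse scale, which tends to \<open>0\<close>.\<close>

lemma parseval_box:
  fixes l u :: "real \<times> real"
  assumes f: "f \<in> L2_space" and c: "asummable (\<lambda>l. L2_inner f (\<psi> l))"
  shows "asum (\<lambda>i. L2_inner f (\<psi> i) * L2_inner (\<psi> i) (indicator (box l u))) = L2_inner f (indicator (box l u))"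
proof -
  let ?g = "\<lambda>x::real \<times> real. indicator (box l u) x :: complex"
  define a where "a = (\<lambda>i. L2_inner f (\<psi> i) * cnj (L2_inner ?g (\<psi> i)))"
  define G where "G = (\<lambda>b. \<Sum>\<iota>\<in>UNIV. asum (\<lambda>p. a (\<iota>, b, p)))"
  obtain C where C: "C > 0" "\<And>l. norm (L2_inner ?g (\<psi> l)) \<le> C"
    by (rule psi_coefficient_bound[OF box_indicator_L2(1)[of l u]], rule that, assumption+)
  have a: "asummable a" unfolding a_def by (rule integrable_mult_bounded[OF c, where C=C]) (simp_all add: C)
  define P where "P = (\<lambda>b. L2_inner f (box_conv2 b l u))"
  have GP: "G b = P (b + 1) - P b" for b
    unfolding G_def a_def P_def by (rule scale_pairing[OF f])
  have part: "(\<Sum>b=-int N..int N. G b) = P (int (Suc N)) - P (- int N)" for N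
    unfolding GP sum_telescope_symmetric by (simp add: add.commute)
  note lim = box_conv2_pairing_limit[OF f, of l u]
  have "(\<lambda>N. \<Sum>b=-int N..int N. G b) \<longlonglongrightarrow> L2_inner f (indicator (box l u)) - 0"
    unfolding part P_def by (intro tendsto_diff lim(2) LIMSEQ_Suc[OF lim(1)])
  moreover have "(\<lambda>N. \<Sum>b=-int N..int N. G b) \<longlonglongrightarrow> asum G"
    unfolding G_def by (intro asum_int_symmetric_limit asum_wavelet_index(1) a)
  ultimately have "asum G = L2_inner f (indicator (box l u)) - 0" by (rule LIMSEQ_unique[rotated])
  then have "asum G = L2_inner f (indicator (box l u))" by simp
  moreover have "asum a = asum G" unfolding G_def by (rule asum_wavelet_index(2)[OF a])
  moreover have "cnj (L2_inner ?g (\<psi> i)) = L2_inner (\<psi> i) (indicator (box l u))" for i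
    by (rule L2_inner_cnj[symmetric])
  ultimately show ?thesis unfolding a_def by simp
qed

lemma synthesis_pairing:
  assumes c: "asummable (c :: wavelet_index \<Rightarrow> complex)" and h: "h \<in> L2_space"
  shows "integrable lborel (\<lambda>y. asum (\<lambda>i. c i * \<psi> i y) * cnj (h y))"
    and "(LINT y|lborel. asum (\<lambda>i. c i * \<psi> i y) * cnj (h y)) = asum (\<lambda>i. c i * L2_inner (\<psi> i) h)"
proof -
  obtain Kn where Kn: "Kn > 0" "\<And>l. \<psi> l \<in> L2_space" "\<And>l. L2_sq (\<psi> l) \<le> Kn"
    by (rule psi_L2, rule that, assumption+)
  note sw = asum_L2_swap[of \<psi> "\<lambda>_. h", OF Kn(2) h add_right_mono[OF Kn(3)] c]
  have mc: "\<psi> i y * cnj (h y) * c i = c i * \<psi> i y * cnj (h y)" for i y by simp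
  have FS: "asum (\<lambda>i. \<psi> i y * cnj (h y) * c i) = asum (\<lambda>i. c i * \<psi> i y) * cnj (h y)" for y
    unfolding mc by (rule integral_mult_left_zero)
  show "integrable lborel (\<lambda>y. asum (\<lambda>i. c i * \<psi> i y) * cnj (h y))"
    using sw(1) unfolding FS .
  show "(LINT y|lborel. asum (\<lambda>i. c i * \<psi> i y) * cnj (h y)) = asum (\<lambda>i. c i * L2_inner (\<psi> i) h)"
    using sw(2) unfolding FS by (simp add: mult.commute)
qed

text \<open>Both sides have the same integral over every box. The series is first known to be integrable
  only after multiplication with square-integrable functions; dividing by the strictly positive
  function \<open>\<gamma>\<close> yields its measurability.\<close>

theorem reconstruction:
  assumes f: "f \<in> L2_space" and c: "asummable (\<lambda>i. L2_inner f (\<psi> i))"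
  shows "AE y in lborel. f y = asum (\<lambda>i. L2_inner f (\<psi> i) * \<psi> i y)"
proof -
  let ?c = "\<lambda>i. L2_inner f (\<psi> i)"
  define s where "s = (\<lambda>y. asum (\<lambda>i. ?c i * \<psi> i y))"
  define \<gamma> where "\<gamma> = (\<lambda>x::real \<times> real. complex_of_real (decay (fst x) * decay (snd x)))"
  have \<gamma>0: "\<gamma> x \<noteq> 0" for x using decay_pos[of "fst x"] decay_pos[of "snd x"] by (simp add: \<gamma>_def)
  have \<gamma>m: "\<gamma> \<in> borel_measurable borel"
    unfolding \<gamma>_def of_real_mult
    by (intro borel_measurable_times measurable_fst_real[of "\<lambda>x. complex_of_real (decay x)"]
        measurable_snd_real[of "\<lambda>x. complex_of_real (decay x)"]) measurable
  have \<gamma>: "\<gamma> \<in> L2_space"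
  proof (rule L2_spaceI[OF \<gamma>m decay2_integrable[of 1]])
    fix x
    have "decay (fst x) * decay (snd x) \<le> 1" by (intro mult_le_one decay_le_1) simp
    then show "(cmod (\<gamma> x))\<^sup>2 \<le> 1 * (decay (fst x) * decay (snd x))"
      using mult_right_mono[of "decay (fst x) * decay (snd x)" 1 "decay (fst x) * decay (snd x)"]
      by (simp add: \<gamma>_def norm_mult power2_eq_square)
  qed
  have "(\<lambda>y. s y * cnj (\<gamma> y)) \<in> borel_measurable borel"
    using borel_measurable_integrable[OF synthesis_pairing(1)[OF c \<gamma>]] by (simp add: s_def)
  then have "(\<lambda>y. s y * cnj (\<gamma> y) / cnj (\<gamma> y)) \<in> borel_measurable borel"
    by (intro borel_measurable_divide borel_measurable_cnj \<gamma>m)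
  then have sm: "s \<in> borel_measurable borel" using \<gamma>0 by simp
  have box: "(\<lambda>x. indicator (box l u) x *\<^sub>R q x) = (\<lambda>x. q x * cnj (indicator (box l u) x))"
    for l u :: "real \<times> real" and q :: "real \<times> real \<Rightarrow> complex"
    by (auto simp: indicator_def)
  have "AE y in lborel. f y - s y = 0"
  proof (rule AE_eq_0_of_boxes)
    show "(\<lambda>y. f y - s y) \<in> borel_measurable borel" using sm L2_spaceD(1)[OF f] by measurable
    fix l u :: "real \<times> real"
    have i: "integrable lborel (\<lambda>x. indicator (box l u) x *\<^sub>R f x)" "integrable lborel (\<lambda>x. indicator (box l u) x *\<^sub>R s x)"
      unfolding box s_def by (intro L2_mult(1) f box_indicator_L2 synthesis_pairing(1) c)+
    then show "integrable lborel (\<lambda>x. indicator (box l u) x *\<^sub>R (f x - s x))"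
      unfolding scaleR_diff_right by (rule Bochner_Integration.integrable_diff)
    have "(LINT x|lborel. indicator (box l u) x *\<^sub>R s x) = asum (\<lambda>i. ?c i * L2_inner (\<psi> i) (indicator (box l u)))"
      unfolding box s_def by (rule synthesis_pairing(2)[OF c box_indicator_L2(1)])
    also have "\<dots> = L2_inner f (indicator (box l u))" by (rule parseval_box[OF f c])
    also have "\<dots> = (LINT x|lborel. indicator (box l u) x *\<^sub>R f x)"
      unfolding box L2_inner_def ..
    finally show "(LINT x|lborel. indicator (box l u) x *\<^sub>R (f x - s x)) = 0"
      unfolding scaleR_diff_right using i by simp
  qed
  then show ?thesis by eventually_elim (simp add: s_def)
qed

corollary parseval:
  assumes f: "f \<in> L2_space" and c: "asummable (\<lambda>i. L2_inner f (\<psi> i))" and h: "h \<in> L2_space"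
  shows "L2_inner f h = asum (\<lambda>i. L2_inner f (\<psi> i) * L2_inner (\<psi> i) h)"
proof -
  have "L2_inner f h = (LINT y|lborel. asum (\<lambda>i. L2_inner f (\<psi> i) * \<psi> i y) * cnj (h y))"
    unfolding L2_inner_def[of f h]
  proof (rule integral_cong_AE)
    show "AE y in lborel. f y * cnj (h y) = asum (\<lambda>i. L2_inner f (\<psi> i) * \<psi> i y) * cnj (h y)"
      using reconstruction[OF f c] by eventually_elim simp
  qed (use L2_mult(1)[OF f h] synthesis_pairing(1)[OF c h] in \<open>auto dest: borel_measurable_integrable\<close>)
  then show ?thesis using synthesis_pairing(2)[OF c h] by simp
qed

section \<open>Functions supported in the mask\<close>

text \<open>Across the strip the wavelet is bounded by \<open>2^b\<close> times its profile along the strip,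
  whose integral is of order \<open>2^(-b)\<close>. The scale cancels.\<close>

lemma psi_mask_integral:
  obtains K where "K > 0" "\<And>i h. h \<ge> 0 \<Longrightarrow> integrable lborel (\<lambda>x. indicator (mask h) x *\<^sub>R \<psi> i x)"
    "\<And>i h. h \<ge> 0 \<Longrightarrow> (LINT x|lborel. norm (indicator (mask h) x *\<^sub>R \<psi> i x)) \<le> K * h"
proof -
  obtain K where K: "K > 0" "\<And>\<iota> b k1 k2 x. norm (\<psi> (\<iota>, b, k1, k2) x) \<le>
        K * (2 powi b * (decay (2 powi b * fst x - of_int k1) * decay (2 powi b * snd x - of_int k2)))"
    by (rule psi_bounds, rule that, assumption+)
  have *: "integrable lborel (\<lambda>x. indicator (mask h) x *\<^sub>R \<psi> i x) \<and>
    (LINT x|lborel. norm (indicator (mask h) x *\<^sub>R \<psi> i x)) \<le> (2 * K * decay_integral) * h" if h: "h \<ge> 0" for i h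
  proof -
    obtain \<iota> b k1 k2 where i: "i = (\<iota>, b, k1, k2)" by (cases i) auto
    define E where "E = (\<lambda>x::real \<times> real. (K * 2 powi b) * (indicator {-h..h} (fst x) * decay (2 powi b * snd x - of_int k2)))"
    have i1: "integrable lborel (indicator {-h..h} :: real \<Rightarrow> real)"
      using h by (intro integrable_real_indicator) auto
    note pr = integrable_prod_mult[OF i1 integral_decay_affine(1)[of b "of_int k2"]]
    have iE: "integrable lborel E" unfolding E_def by (intro integrable_mult_right pr(1))
    have IE: "(LINT x|lborel. E x) = (2 * K * decay_integral) * h"
      unfolding E_def integral_mult_right_zero pr(2) integral_decay_affine(2) using h by simp
    have le: "norm (indicator (mask h) x *\<^sub>R \<psi> i x) \<le> E x" for x
    proof (cases "x \<in> mask h")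
      case True
      have "norm (\<psi> i x) \<le> K * (2 powi b * (decay (2 powi b * fst x - of_int k1) * decay (2 powi b * snd x - of_int k2)))"
        unfolding i by (rule K)
      also have "\<dots> \<le> K * (2 powi b * (1 * decay (2 powi b * snd x - of_int k2)))"
        using K(1) by (intro mult_left_mono mult_right_mono decay_le_1) auto
      also have "\<dots> = E x" using True by (simp add: E_def mask_def abs_le_iff indicator_def)
      finally show ?thesis using True by simp
    next
      case False
      then show ?thesis using K(1) by (simp add: E_def)
    qed
    have m: "(\<lambda>x. indicator (mask h) x *\<^sub>R \<psi> i x) \<in> borel_measurable lborel"
      using mask_measurable psi_measurable by measurable
    have int: "integrable lborel (\<lambda>x. indicator (mask h) x *\<^sub>R \<psi> i x)"
      by (rule integrable_dominated[OF iE m le])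
    moreover have "(LINT x|lborel. norm (indicator (mask h) x *\<^sub>R \<psi> i x)) \<le> (LINT x|lborel. E x)"
      by (intro integral_mono integrable_norm int iE le)
    ultimately show ?thesis using IE by simp
  qed
  show ?thesis
  proof (rule that[of "2 * K * decay_integral + 1"])
    show "2 * K * decay_integral + 1 > 0" using K decay_integral_nonneg by (intro add_nonneg_pos) auto
    fix i and h :: real assume h: "h \<ge> 0"
    show "integrable lborel (\<lambda>x. indicator (mask h) x *\<^sub>R \<psi> i x)" using *[OF h] by blast
    show "(LINT x|lborel. norm (indicator (mask h) x *\<^sub>R \<psi> i x)) \<le> (2 * K * decay_integral + 1) * h"
      using *[OF h, of i] h by (simp add: distrib_right)
  qed
qed

text \<open>The matrix entries \<open>\<langle>\<psi>\<^sub>i, 1\<^sub>M \<psi>\<^sub>\<mu>\<rangle>\<close>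
  have, for each fixed \<open>i\<close>, an absolute sum of at most \<open>K 2^b h\<close> over
  the \<open>\<mu>\<close> of one scale and orientation. Applying this matrix to the coefficient
  sequence of \<open>g\<close> reproduces its entries at that scale.\<close>

lemma mask_concentration:
  obtains K where "K > 0" "\<And>g h \<iota> b. g \<in> L2_space \<Longrightarrow> asummable (\<lambda>i. L2_inner g (\<psi> i)) \<Longrightarrow> h \<ge> 0 \<Longrightarrow>
     (AE x in lborel. x \<notin> mask h \<longrightarrow> g x = 0) \<Longrightarrow>
     asum (\<lambda>p. norm (L2_inner g (\<psi> (\<iota>, b, p)))) \<le> K * 2 powi b * h * asum (\<lambda>i. norm (L2_inner g (\<psi> i)))"
proof -
  obtain K1 where K1: "K1 > 0" "\<And>i h. h \<ge> 0 \<Longrightarrow> integrable lborel (\<lambda>x. indicator (mask h) x *\<^sub>R \<psi> i x)"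
    "\<And>i h. h \<ge> 0 \<Longrightarrow> (LINT x|lborel. norm (indicator (mask h) x *\<^sub>R \<psi> i x)) \<le> K1 * h"
    by (rule psi_mask_integral, rule that, assumption+)
  obtain K2 where K2: "K2 > 0"
    "\<And>\<iota> b g. integrable lborel g \<Longrightarrow> asummable (\<lambda>p. LINT x|lborel. norm (g x :: complex) * norm (\<psi> (\<iota>, b, p) x))"
    "\<And>\<iota> b g. integrable lborel g \<Longrightarrow>
        asum (\<lambda>p. LINT x|lborel. norm (g x :: complex) * norm (\<psi> (\<iota>, b, p) x)) \<le> K2 * 2 powi b * (LINT x|lborel. norm (g x))"
    by (rule psi_L1_scale, rule that, assumption+)
  show ?thesis
  proof (rule that[of "K2 * K1"])
    show "K2 * K1 > 0" using K1 K2 by simp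
    fix g :: "real \<times> real \<Rightarrow> complex" and h :: real and \<iota> b
    assume g: "g \<in> L2_space" and s: "asummable (\<lambda>i. L2_inner g (\<psi> i))" and h: "h \<ge> 0"
      and supp: "AE x in lborel. x \<notin> mask h \<longrightarrow> g x = 0"
    let ?c = "\<lambda>i. L2_inner g (\<psi> i)"
    define m where "m = (\<lambda>i x. indicator (mask h) x *\<^sub>R \<psi> i x)"
    define J where "J = (\<lambda>i p. LINT x|lborel. norm (m i x) * norm (\<psi> (\<iota>, b, p) x))"
    have mi: "integrable lborel (m i)" for i unfolding m_def by (rule K1(2)[OF h])
    have J0: "J i p \<ge> 0" for i p unfolding J_def by (intro Bochner_Integration.integral_nonneg) simp
    have Js: "asummable (\<lambda>p. J i p)" for i unfolding J_def by (rule K2(2)[OF mi])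
    have Jle: "asum (\<lambda>p. J i p) \<le> K2 * K1 * 2 powi b * h" for i
    proof -
      have "asum (\<lambda>p. J i p) \<le> K2 * 2 powi b * (LINT x|lborel. norm (m i x))" unfolding J_def by (rule K2(3)[OF mi])
      also have "\<dots> \<le> K2 * 2 powi b * (K1 * h)"
        unfolding m_def using K2(1) by (intro mult_left_mono K1(3) h) auto
      finally show ?thesis by (simp add: mult_ac)
    qed
    have mL2: "m i \<in> L2_space" for i
    proof (rule L2_spaceI[OF _ L2_spaceD(2)[OF psi_in_L2[of i]]])
      show "m i \<in> borel_measurable borel" using borel_measurable_integrable[OF mi] by simp
    qed (simp add: m_def indicator_def)
    have cJ: "norm (?c (\<iota>, b, p)) \<le> asum (\<lambda>i. norm (?c i) * J i p)" and cs: "asummable (\<lambda>i. norm (?c i) * J i p)" for p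
    proof -
      have "J i p \<le> K2 * K1 * 2 powi b * h" for i
      proof -
        have "J i p = asum (\<lambda>q. if q = p then J i p else 0)" by (rule asum_single[symmetric])
        also have "\<dots> \<le> asum (\<lambda>q. J i q)"
          by (rule integral_mono[OF asum_finite_support(1)[of "{p}"] Js]) (auto simp: J0)
        finally show ?thesis using Jle[of i] by simp
      qed
      note Jb = this
      show cs: "asummable (\<lambda>i. norm (?c i) * J i p)"
      proof (rule asummable_bound(1)[OF integrable_mult_left[OF integrable_norm[OF s], of "K2 * K1 * 2 powi b * h"]])
        show "norm (norm (?c i) * J i p) \<le> norm (?c i) * (K2 * K1 * 2 powi b * h)" for i
          using Jb[of i] J0[of i p] by (simp add: mult_left_mono)
      qed
      \<comment> \<open>Since \<open>g\<close> vanishes off the mask, the wavelet may be cut off there before expanding \<open>g\<close>.\<close>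
      have "?c (\<iota>, b, p) = L2_inner g (m (\<iota>, b, p))"
        unfolding L2_inner_def
      proof (rule integral_cong_AE)
        show "AE x in lborel. g x * cnj (\<psi> (\<iota>, b, p) x) = g x * cnj (m (\<iota>, b, p) x)"
          using supp by eventually_elim (auto simp: m_def indicator_def)
      qed (use L2_mult(1)[OF g psi_in_L2] L2_mult(1)[OF g mL2] in \<open>auto dest: borel_measurable_integrable\<close>)
      also have "\<dots> = asum (\<lambda>i. ?c i * L2_inner (\<psi> i) (m (\<iota>, b, p)))"
        by (rule parseval[OF g s mL2])
      finally have e: "?c (\<iota>, b, p) = asum (\<lambda>i. ?c i * L2_inner (\<psi> i) (m (\<iota>, b, p)))" .
      have "norm (?c i * L2_inner (\<psi> i) (m (\<iota>, b, p))) \<le> norm (?c i) * J i p" for i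
      proof -
        have "norm (L2_inner (\<psi> i) (m (\<iota>, b, p))) \<le> (LINT x|lborel. norm (\<psi> i x * cnj (m (\<iota>, b, p) x)))"
          unfolding L2_inner_def by (rule integral_norm_bound)
        also have "\<dots> = J i p" unfolding J_def m_def
          by (intro Bochner_Integration.integral_cong refl) (simp add: norm_mult)
        finally show ?thesis unfolding norm_mult by (intro mult_left_mono) auto
      qed
      then show "norm (?c (\<iota>, b, p)) \<le> asum (\<lambda>i. norm (?c i) * J i p)"
        unfolding e by (rule asummable_bound(2)[OF cs])
    qed
    have s1: "asummable (\<lambda>p. norm (?c i) * J i p)" for i by (intro integrable_mult_right Js)
    have l1: "asum (\<lambda>p. norm (?c i) * J i p) \<le> norm (?c i) * (K2 * K1 * 2 powi b * h)" for i
      using mult_left_mono[OF Jle, of "norm (?c i)" i] by simp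
    note ib = asum_integral_bound[of "count_space (UNIV :: wavelet_index set)" "\<lambda>p i. norm (?c i) * J i p",
       OF sigma_finite_measure_count_space _ _ s1 l1 integrable_mult_left[OF integrable_norm[OF s]]]
    have 1: "asummable (\<lambda>p. asum (\<lambda>i. norm (?c i) * J i p))" by (rule ib(2)) (auto simp: J0)
    have 2: "asum (\<lambda>p. asum (\<lambda>i. norm (?c i) * J i p)) \<le> asum (\<lambda>i. norm (?c i) * (K2 * K1 * 2 powi b * h))"
      by (rule ib(3)) (auto simp: J0)
    have "asum (\<lambda>p. norm (?c (\<iota>, b, p))) \<le> asum (\<lambda>p. asum (\<lambda>i. norm (?c i) * J i p))"
      by (rule asummable_bound(3)[OF 1 cJ])
    also note 2
    also have "asum (\<lambda>i. norm (?c i) * (K2 * K1 * 2 powi b * h)) = K2 * K1 * 2 powi b * h * asum (\<lambda>i. norm (?c i))"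
      by (simp add: mult.commute)
    finally show "asum (\<lambda>p. norm (?c (\<iota>, b, p))) \<le> K2 * K1 * 2 powi b * h * asum (\<lambda>i. norm (?c i))" .
  qed
qed

section \<open>The line image\<close>

definition scales :: "nat \<Rightarrow> (orientation \<times> int) set" where
  "scales j = UNIV \<times> {2 * int j, 2 * int j + 1}"

definition band1 :: "orientation \<times> int \<Rightarrow> real \<Rightarrow> complex" where
  "band1 q t = factor1 (fst q) (2 powi (- snd q) * t)"

definition band2 :: "orientation \<times> int \<Rightarrow> real \<Rightarrow> complex" where
  "band2 q t = factor2 (fst q) (2 powi (- snd q) * t)"

lemma bump_band: "bump ((1/4) / 2 powi (- snd q)) (band1 q)" "bump ((1/4) / 2 powi (- snd q)) (band2 q)"
  unfolding band1_def[abs_def] band2_def[abs_def] by (intro bump_dilate bump_factor; simp)+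

lemma band_filter_eq: "band_filter \<nu> j = (\<lambda>p. \<Sum>q\<in>scales j. band1 q (fst p) * band2 q (snd p))"
proof
  fix p :: "real \<times> real"
  have e: "- 2 * int j = - (2 * int j)" "- 2 * int j - 1 = - (2 * int j + 1)" by simp_all
  have "(\<Sum>q\<in>scales j. band1 q (fst p) * band2 q (snd p)) =
     (\<Sum>\<iota>\<in>UNIV. \<Sum>m\<in>{2 * int j, 2 * int j + 1}. band1 (\<iota>, m) (fst p) * band2 (\<iota>, m) (snd p))"
    unfolding scales_def sum.cartesian_product by (rule sum.cong) auto
  also have "\<dots> = band_filter \<nu> j p"
    unfolding band_filter_def UNIV_orientation e
    by (intro sum.cong refl) (simp add: band1_def band2_def meyer_W2_eq)
  finally show "band_filter \<nu> j p = (\<Sum>q\<in>scales j. band1 q (fst p) * band2 q (snd p))" by simp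
qed

text \<open>In every orientation at least one factor is the band-pass function \<open>W\<close>. Of two
  scales at distance at least two, the finer one contributes that factor: it vanishes for
  \<open>\<bar>t\<bar> \<le> 2^a/4\<close>, where \<open>a\<close> is the coarser scale, and both
  factors of that scale vanish for larger \<open>\<bar>t\<bar>\<close>.\<close>

lemma frequency_disjoint:
  assumes q: "q \<in> scales j" and b: "b \<notin> {2 * int j - 1..2 * int j + 2}"
  shows "(\<forall>t. band1 q t = 0 \<or> factor1 \<iota> (t / 2 powi b) = 0) \<or> (\<forall>t. band2 q t = 0 \<or> factor2 \<iota> (t / 2 powi b) = 0)"
proof -
  obtain \<kappa> m where qm: "q = (\<kappa>, m)" and m: "m = 2 * int j \<or> m = 2 * int j + 1"
    using q by (auto simp: scales_def)
  have outer: "factor1 o' t = 0" "factor2 o' t = 0" if "1/4 \<le> \<bar>t\<bar>" for o' t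
    using bump_zero[OF bump_factor(1) that] bump_zero[OF bump_factor(2) that] by auto
  have W: "factor1 o' = meyer_W \<nu> \<or> factor2 o' = meyer_W \<nu>" for o'
    by (cases o') (simp_all add: factor1.simps factor2.simps)
  note inner = meyer_W_inner
  have sep: "2 powi (c + 2) * (1/16::real) = 2 powi c * (1/4)" for c :: int by (simp add: power_int_add)
  consider "m + 2 \<le> b" | "b + 2 \<le> m" using b m by auto
  then show ?thesis
  proof cases
    case 1
    have le: "2 powi m * (1/4) \<le> 2 powi b * (1/16::real)"
      using power_int_increasing[OF 1, of "2::real"] unfolding sep[symmetric] by (intro mult_right_mono) auto
    have "1/4 \<le> \<bar>2 powi (- m) * t\<bar> \<or> \<bar>t / 2 powi b\<bar> \<le> 1/16" for t :: real
    proof (cases "\<bar>t\<bar> \<le> 2 powi b * (1/16)")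
      case True
      then show ?thesis by (simp add: abs_divide field_simps)
    next
      case False
      then have "2 powi m * (1/4) \<le> \<bar>t\<bar>" using le by linarith
      then show ?thesis by (simp add: abs_mult power_int_minus field_simps)
    qed
    then show ?thesis using W[of \<iota>] outer inner unfolding qm band1_def band2_def fst_conv snd_conv by metis
  next
    case 2
    have le: "2 powi b * (1/4) \<le> 2 powi m * (1/16::real)"
      using power_int_increasing[OF 2, of "2::real"] unfolding sep[symmetric] by (intro mult_right_mono) auto
    have "\<bar>2 powi (- m) * t\<bar> \<le> 1/16 \<or> 1/4 \<le> \<bar>t / 2 powi b\<bar>" for t :: real
    proof (cases "\<bar>t\<bar> \<le> 2 powi m * (1/16)")
      case True
      then show ?thesis by (simp add: abs_mult power_int_minus field_simps)
    next
      case False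
      then have "2 powi b * (1/4) \<le> \<bar>t\<bar>" using le by linarith
      then show ?thesis by (simp add: abs_divide field_simps)
    qed
    then show ?thesis using W[of \<kappa>] outer inner unfolding qm band1_def band2_def fst_conv snd_conv by metis
  qed
qed

context
  fixes w :: "real \<Rightarrow> real" and \<rho> :: real
  assumes w_meas: "w \<in> borel_measurable borel" and w_range: "\<And>x. w x \<in> {0..1}"
begin

definition wdens :: "real \<Rightarrow> complex" where
  "wdens t = indicator {-\<rho>..\<rho>} t *\<^sub>R complex_of_real (w t)"

lemma wdens_integrable: "integrable lborel wdens"
proof (rule integrable_dominated[of lborel "indicator {-\<rho>..\<rho>}"])
  show "integrable lborel (indicator {-\<rho>..\<rho>} :: real \<Rightarrow> real)"
    by (rule integrable_real_indicator) (cases "-\<rho> \<le> \<rho>"; auto)+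
  show "wdens \<in> borel_measurable lborel" unfolding wdens_def[abs_def] using w_meas by measurable
  show "norm (wdens t) \<le> indicator {-\<rho>..\<rho>} t" for t
    using w_range[of t] by (simp add: wdens_def indicator_def)
qed

lemma line_image_eq:
  "line_image \<nu> \<rho> w j x = (\<Sum>q\<in>scales j. conv1 wdens (ift (band1 q)) (fst x) * ift (band2 q) (snd x))"
proof -
  have fin: "finite (scales j)" by (simp add: scales_def)
  have inv: "inv_fourier (band_filter \<nu> j) z = (\<Sum>q\<in>scales j. ift (band1 q) (fst z) * ift (band2 q) (snd z))" for z
    unfolding band_filter_eq by (intro inv_fourier_sum_prod fin bump_integrable[OF bump_band(1)] bump_integrable[OF bump_band(2)])
  have int: "integrable lborel (\<lambda>t. wdens t * ift (band1 q) (fst x - t))" for q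
  proof -
    have "norm (ift (band1 q) y) \<le> (LINT t|lborel. norm (band1 q t))" for y
      by (rule norm_ift_le[OF bump_integrable[OF bump_band(1)]])
    then show ?thesis
      by (rule conv1_bounded(2)[OF wdens_integrable ift_measurable[OF bump_measurable[OF bump_band(1)]]])
  qed
  have "line_image \<nu> \<rho> w j x = (LINT t|lborel. wdens t * (\<Sum>q\<in>scales j. ift (band1 q) (fst x - t) * ift (band2 q) (snd x)))"
    unfolding line_image_def distr_conv_def line_distr_def set_lebesgue_integral_def inv
    by (simp add: wdens_def)
  also have "\<dots> = (LINT t|lborel. (\<Sum>q\<in>scales j. wdens t * ift (band1 q) (fst x - t) * ift (band2 q) (snd x)))"
    by (simp only: sum_distrib_left mult.assoc)
  also have "\<dots> = (\<Sum>q\<in>scales j. LINT t|lborel. wdens t * ift (band1 q) (fst x - t) * ift (band2 q) (snd x))"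
    by (intro Bochner_Integration.integral_sum integrable_mult_left int)
  also have "\<dots> = (\<Sum>q\<in>scales j. conv1 wdens (ift (band1 q)) (fst x) * ift (band2 q) (snd x))"
    by (simp add: conv1_def)
  finally show ?thesis .
qed

lemma line_image_L1: "integrable lborel (line_image \<nu> \<rho> w j)"
  unfolding line_image_eq[abs_def]
  by (intro Bochner_Integration.integrable_sum integrable_prod_mult(1) conv1_integrable wdens_integrable integrable_ift[OF bump_band(1)] integrable_ift[OF bump_band(2)])

lemma line_image_L2: "line_image \<nu> \<rho> w j \<in> L2_space"
proof -
  define A where "A = (\<lambda>q. (LINT t|lborel. norm (wdens t)) * (LINT t|lborel. norm (band1 q t)))"
  define B where "B = (\<lambda>q. LINT t|lborel. norm (band2 q t))"
  define C where "C = (\<Sum>q\<in>scales j. A q * B q)"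
  have AB: "A q \<ge> 0" "B q \<ge> 0" for q by (simp_all add: A_def B_def)
  have "norm (line_image \<nu> \<rho> w j x) \<le> C" for x
    unfolding line_image_eq C_def
  proof (intro order_trans[OF norm_sum] sum_mono)
    fix q
    have "norm (conv1 wdens (ift (band1 q)) (fst x)) \<le> A q"
      unfolding A_def using bump_measurable[OF bump_band(1)]
      by (intro conv1_bounded(1) wdens_integrable ift_measurable norm_ift_le[OF bump_integrable[OF bump_band(1)]]) auto
    moreover have "norm (ift (band2 q) (snd x)) \<le> B q"
      unfolding B_def by (rule norm_ift_le[OF bump_integrable[OF bump_band(2)]])
    ultimately show "norm (conv1 wdens (ift (band1 q)) (fst x) * ift (band2 q) (snd x)) \<le> A q * B q"
      unfolding norm_mult using AB by (intro mult_mono) auto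
  qed
  then have "(cmod (line_image \<nu> \<rho> w j x))\<^sup>2 \<le> C * norm (line_image \<nu> \<rho> w j x)" for x
    unfolding power2_eq_square by (rule mult_right_mono) simp
  then show ?thesis
    using borel_measurable_integrable[OF line_image_L1[of j]]
    by (intro L2_spaceI[OF _ integrable_mult_right[OF integrable_norm[OF line_image_L1[of j]], of C]]) simp_all
qed

lemma line_image_coefficient_zero:
  assumes b: "b \<notin> {2 * int j - 1..2 * int j + 2}"
  shows "L2_inner (line_image \<nu> \<rho> w j) (\<psi> (\<iota>, b, p)) = 0"
proof -
  obtain k1 k2 where p: "p = (k1, k2)" by (cases p)
  define a1 where "a1 = (\<lambda>q x. conv1 wdens (ift (band1 q)) x * cnj (atom (factor1 \<iota>) b k1 x))"
  define a2 where "a2 = (\<lambda>q x. ift (band2 q) x * cnj (atom (factor2 \<iota>) b k2 x))"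
  have bdd: "integrable lborel (\<lambda>x. q x * cnj (atom u b k x))" if q: "integrable lborel q" and u: "bump R u" for q u R k
  proof (rule integrable_mult_bounded[OF q])
    show "(\<lambda>x. cnj (atom u b k x)) \<in> borel_measurable lborel"
      unfolding atom_def using bump_measurable[OF u] by measurable
    show "norm (cnj (atom u b k x)) \<le> (LINT t|lborel. norm (u t))" for x
      using norm_ift_le[OF bump_integrable[OF u]] by (simp add: atom_def)
  qed
  have i1: "integrable lborel (a1 q)" for q
    unfolding a1_def by (rule bdd[OF conv1_integrable[OF wdens_integrable integrable_ift[OF bump_band(1)]] bump_factor(1)])
  have i2: "integrable lborel (a2 q)" for q
    unfolding a2_def by (rule bdd[OF integrable_ift[OF bump_band(2)] bump_factor(2)])
  have "L2_inner (line_image \<nu> \<rho> w j) (\<psi> (\<iota>, b, p)) = (LINT x|lborel. (\<Sum>q\<in>scales j. cnj (2 powi b) * (a1 q (fst x) * a2 q (snd x))))"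
    unfolding L2_inner_def p
    unfolding line_image_eq sum_distrib_right
    by (intro Bochner_Integration.integral_cong sum.cong refl)
      (simp only: meyer_psi_eq a1_def a2_def complex_cnj_mult mult_ac)
  also have "\<dots> = (\<Sum>q\<in>scales j. cnj (2 powi b) * ((LINT x|lborel. a1 q x) * (LINT x|lborel. a2 q x)))"
    by (subst Bochner_Integration.integral_sum)
      (simp_all only: integral_mult_right_zero integrable_prod_mult[OF i1 i2] integrable_mult_right)
  also have "\<dots> = 0"
  proof (intro sum.neutral ballI)
    fix q assume q: "q \<in> scales j"
    have "(LINT x|lborel. a1 q x) = 0 \<or> (LINT x|lborel. a2 q x) = 0"
      using frequency_disjoint[OF q b, of \<iota>]
    proof
      assume "\<forall>t. band1 q t = 0 \<or> factor1 \<iota> (t / 2 powi b) = 0"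
      then have "(LINT x|lborel. a1 q x) = 0"
        unfolding a1_def by (intro atom_orthogonal(2)[OF bump_band(1) bump_factor(1)] wdens_integrable) auto
      then show ?thesis ..
    next
      assume "\<forall>t. band2 q t = 0 \<or> factor2 \<iota> (t / 2 powi b) = 0"
      then have "(LINT x|lborel. a2 q x) = 0"
        unfolding a2_def by (intro atom_orthogonal(1)[OF bump_band(2) bump_factor(2)]) auto
      then show ?thesis ..
    qed
    then show "cnj (2 powi b) * ((LINT x|lborel. a1 q x) * (LINT x|lborel. a2 q x)) = 0" by auto
  qed
  finally show ?thesis .
qed

lemma line_image_coefficients_summable: "asummable (\<lambda>i. L2_inner (line_image \<nu> \<rho> w j) (\<psi> i))"
proof (rule asummable_wavelet_indexI[of "{2 * int j - 1..2 * int j + 2}"])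
  show "asummable (\<lambda>p. L2_inner (line_image \<nu> \<rho> w j) (\<psi> (\<iota>, b, p)))" for \<iota> b
    by (rule coefficients_summable_scale[OF line_image_L1])
qed (use line_image_coefficient_zero in auto)

end

section \<open>Exact recovery\<close>

text \<open>The four scales and three orientations contribute at most \<open>12 \<cdot> K \<cdot> 4 \<cdot>
  2^b0 h\<close> times the total mass; the threshold \<open>1 / (144 K)\<close> makes this a
  third, whereas minimality requires at least one half.\<close>

lemma exact_recovery:
  obtains \<delta> where "\<delta> > 0"
    "\<And>x0 L h b0. \<lbrakk>x0 \<in> L2_space; asummable (\<lambda>i. L2_inner x0 (\<psi> i));
      \<And>\<iota> b p. b \<notin> {b0 - 1..b0 + 2} \<Longrightarrow> L2_inner x0 (\<psi> (\<iota>, b, p)) = 0;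
      h > 0; h * 2 powi b0 \<le> \<delta>;
      inpainting_solution (\<psi>) h (unmasked_proj h x0) L\<rbrakk> \<Longrightarrow> AE x in lborel. L x - x0 x = 0"
proof -
  obtain K where K: "K > 0" "\<And>g h \<iota> b. g \<in> L2_space \<Longrightarrow> asummable (\<lambda>i. L2_inner g (\<psi> i)) \<Longrightarrow> h \<ge> 0 \<Longrightarrow>
     (AE x in lborel. x \<notin> mask h \<longrightarrow> g x = 0) \<Longrightarrow>
     asum (\<lambda>p. norm (L2_inner g (\<psi> (\<iota>, b, p)))) \<le> K * 2 powi b * h * asum (\<lambda>i. norm (L2_inner g (\<psi> i)))"
    by (rule mask_concentration, rule that, assumption+)
  show ?thesis
  proof (rule that[of "1 / (144 * K)"])
    show "1 / (144 * K) > 0" using K by simp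
    fix x0 L :: "real \<times> real \<Rightarrow> complex" and h :: real and b0 :: int
    assume x0: "x0 \<in> L2_space" and sx: "asummable (\<lambda>i. L2_inner x0 (\<psi> i))"
      and off: "\<And>\<iota> b p. b \<notin> {b0 - 1..b0 + 2} \<Longrightarrow> L2_inner x0 (\<psi> (\<iota>, b, p)) = 0"
      and h: "h > 0" and hb: "h * 2 powi b0 \<le> 1 / (144 * K)"
      and sol: "inpainting_solution (\<psi>) h (unmasked_proj h x0) L"
    have L: "L \<in> L2_space" and feas: "AE x in lborel. unmasked_proj h x0 x = unmasked_proj h L x"
      and min: "\<not> l1_norm (analysis_op (\<psi>) x0) < l1_norm (analysis_op (\<psi>) L)"
      using sol x0 unfolding inpainting_solution_def is_arg_min_def by auto
    define cx where "cx = (\<lambda>i. L2_inner x0 (\<psi> i))"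
    define cL where "cL = (\<lambda>i. L2_inner L (\<psi> i))"
    define g where "g = (\<lambda>x. L x - x0 x)"
    define cg where "cg = (\<lambda>i. L2_inner g (\<psi> i))"
    have sx': "asummable cx" using sx by (simp add: cx_def)
    have le: "l1_norm cL \<le> l1_norm cx"
      using min by (simp add: analysis_op_def cx_def cL_def not_less)
    also have "\<dots> < \<infinity>" using sx' by (subst l1_norm_finite_iff)
    finally have sL: "asummable cL" by (subst (asm) l1_norm_finite_iff)
    have leR: "asum (\<lambda>i. norm (cL i)) \<le> asum (\<lambda>i. norm (cx i))"
    proof -
      have "asum (\<lambda>i. norm (cx i)) \<ge> 0" by (intro Bochner_Integration.integral_nonneg) simp
      then show ?thesis
        using le unfolding l1_norm_eq[OF sL] l1_norm_eq[OF sx'] by (simp add: ennreal_le_iff)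
    qed
    have g: "g \<in> L2_space" unfolding g_def by (rule L2_space_diff[OF L x0])
    have cg: "cg i = cL i - cx i" for i
      unfolding cg_def cL_def cx_def g_def by (rule L2_inner_diff_left[OF L x0 psi_in_L2])
    have sg: "asummable cg" unfolding cg[abs_def] by (rule Bochner_Integration.integrable_diff[OF sL sx'])
    have supp: "AE x in lborel. x \<notin> mask h \<longrightarrow> g x = 0"
      using feas by eventually_elim (auto simp: unmasked_proj_def g_def)
    define B where "B = {b0 - 1..b0 + 2}"
    define e where "e = (\<lambda>i :: wavelet_index. if fst (snd i) \<in> B then norm (cg i) else 0)"
    have se: "asummable e"
      by (rule asummable_bound(1)[OF integrable_norm[OF sg]]) (simp add: e_def)
    define X where "X = asum (\<lambda>i. norm (cg i))"
    have X0: "X \<ge> 0" unfolding X_def by (intro Bochner_Integration.integral_nonneg) simp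
    have E: "asum e \<le> X / 3"
    proof -
      have fin: "finite B" by (simp add: B_def)
      have "asum e = asum (\<lambda>b. \<Sum>\<iota>\<in>UNIV. asum (\<lambda>p. e (\<iota>, b, p)))"
        by (rule asum_wavelet_index(2)[OF se])
      also have "\<dots> = (\<Sum>b\<in>B. \<Sum>\<iota>\<in>UNIV. asum (\<lambda>p. e (\<iota>, b, p)))"
        by (rule asum_finite_support(2)[OF fin]) (simp add: e_def)
      also have "\<dots> \<le> (\<Sum>b\<in>B. \<Sum>\<iota>\<in>(UNIV::orientation set). 1 / 36 * X)"
      proof (intro sum_mono)
        fix b \<iota> assume b: "b \<in> B"
        have "asum (\<lambda>p. e (\<iota>, b, p)) = asum (\<lambda>p. norm (cg (\<iota>, b, p)))" using b by (simp add: e_def)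
        also have "\<dots> \<le> K * 2 powi b * h * X"
          unfolding cg_def X_def using g sg supp h by (intro K(2)) (simp_all add: cg_def)
        also have "\<dots> \<le> 1 / 36 * X"
        proof (rule mult_right_mono[OF _ X0])
          have "2 powi b \<le> (2::real) powi (b0 + 2)"
            using b by (intro power_int_increasing) (auto simp: B_def)
          also have "\<dots> = 4 * 2 powi b0" by (simp add: power_int_add)
          finally have "K * 2 powi b * h \<le> K * (4 * 2 powi b0) * h"
            using K(1) h by (intro mult_right_mono mult_left_mono) auto
          also have "\<dots> = 4 * K * (h * 2 powi b0)" by simp
          also have "\<dots> \<le> 4 * K * (1 / (144 * K))" using K(1) by (intro mult_left_mono hb) auto
          also have "\<dots> = 1 / 36" using K(1) by simp
          finally show "K * 2 powi b * h \<le> 1 / 36" .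
        qed
        finally show "asum (\<lambda>p. e (\<iota>, b, p)) \<le> 1 / 36 * X" .
      qed
      also have "\<dots> = X / 3" by (simp add: B_def UNIV_orientation)
      finally show ?thesis .
    qed
    \<comment> \<open>At the scales in \<open>B\<close> this is the triangle inequality; elsewhere \<open>cx\<close> vanishes and \<open>cL = cg\<close>.\<close>
    have pw: "norm (cx i) + norm (cg i) - 2 * e i \<le> norm (cL i)" for i
    proof (cases "fst (snd i) \<in> B")
      case True
      have "norm (cx i) \<le> norm (cL i) + norm (cg i)"
        unfolding cg using norm_triangle_ineq4[of "cL i" "cL i - cx i"] by simp
      then show ?thesis using True by (simp add: e_def)
    next
      case False
      then have "cx i = 0" unfolding cx_def B_def by (cases i) (simp add: off)
      then show ?thesis using False by (simp add: e_def cg)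
    qed
    have "asum (\<lambda>i. norm (cx i)) + X - 2 * asum e = asum (\<lambda>i. norm (cx i) + norm (cg i) - 2 * e i)"
      unfolding X_def using sx' sg se by simp
    also have "\<dots> \<le> asum (\<lambda>i. norm (cL i))"
      by (intro integral_mono pw) (use sx' sg se sL in auto)
    finally have "X \<le> 2 * asum e" using leR by simp
    with E X0 have "X = 0" by simp
    then have "AE i in count_space UNIV. norm (cg i) = 0"
      unfolding X_def by (subst (asm) integral_nonneg_eq_0_iff_AE) (use sg in auto)
    then have cg0: "cg i = 0" for i by (cases i) (simp add: AE_count_space)
    have "AE y in lborel. g y = asum (\<lambda>i. cg i * \<psi> i y)"
      unfolding cg_def by (rule reconstruction[OF g]) (use sg in \<open>simp add: cg_def\<close>)
    then show "AE x in lborel. L x - x0 x = 0" by (simp add: cg0 g_def)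
  qed
qed

end

section \<open>Inpainting of the line image\<close>

theorem theorem4p3:
  fixes \<nu> w :: "real \<Rightarrow> real" and \<rho> :: real and h :: "nat \<Rightarrow> real"
    and f L :: "nat \<Rightarrow> real \<times> real \<Rightarrow> complex"
  assumes "meyer_aux \<nu>"
    and "\<rho> > 0"
    and "smooth w" and "\<And>x. w x \<in> {0..1}"
    and "closure {x. w x \<noteq> 0} \<subseteq> {-\<rho>..\<rho>}" and "\<exists>x. w x \<noteq> 0"
    and "\<And>j. h j > 0" and "\<And>j. h j < \<rho>"
    and "h \<in> o(\<lambda>j. 2 powi (- 2 * int j))"
    and "\<And>j. f j = unmasked_proj (h j) (line_image \<nu> \<rho> w j)"
    and "\<And>j. inpainting_solution (meyer_psi \<nu>) (h j) (f j) (L j)"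
  shows "(\<lambda>j. L2_norm (\<lambda>x. L j x - line_image \<nu> \<rho> w j x) / L2_norm (line_image \<nu> \<rho> w j))
           \<longlonglongrightarrow> 0"
proof -
  note nu = assms(1)
  have w: "w \<in> borel_measurable borel"
  proof -
    have "w differentiable_on UNIV" using assms(3) unfolding smooth_def by (metis funpow_0)
    then show ?thesis by (intro borel_measurable_continuous_onI differentiable_imp_continuous_on)
  qed
  note x0 = line_image_L2[OF nu w assms(4)] line_image_coefficients_summable[OF nu w assms(4)]
    line_image_coefficient_zero[OF nu w assms(4)]
  show ?thesis
  proof (rule exact_recovery[OF nu])
    fix \<delta> :: real
    assume \<delta>: "\<delta> > 0"
    "\<And>x0 L h b0. \<lbrakk>x0 \<in> L2_space; asummable (\<lambda>i. L2_inner x0 (meyer_psi \<nu> i));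
      \<And>\<iota> b p. b \<notin> {b0 - 1..b0 + 2} \<Longrightarrow> L2_inner x0 (meyer_psi \<nu> (\<iota>, b, p)) = 0;
      h > 0; h * 2 powi b0 \<le> \<delta>;
      inpainting_solution (meyer_psi \<nu>) h (unmasked_proj h x0) L\<rbrakk> \<Longrightarrow> AE x in lborel. L x - x0 x = 0"
    have "\<forall>\<^sub>F j in sequentially. norm (h j) \<le> \<delta> * norm (2 powi (- 2 * int j) :: real)"
      by (rule landau_o.smallD[OF assms(9) \<delta>(1)])
    then have "\<forall>\<^sub>F j in sequentially. L2_norm (\<lambda>x. L j x - line_image \<nu> \<rho> w j x) / L2_norm (line_image \<nu> \<rho> w j) = 0"
    proof eventually_elim
      case (elim j)
      have "h j * 2 powi (2 * int j) \<le> \<delta>"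
      proof -
        have "h j \<le> \<delta> / 2 powi (2 * int j)"
          using elim assms(7)[of j] by (simp add: power_int_minus divide_inverse)
        then show ?thesis by (simp add: field_simps)
      qed
      from \<delta>(2)[OF x0 assms(7) this assms(11)[of j, unfolded assms(10)]]
      have "AE x in lborel. L j x - line_image \<nu> \<rho> w j x = 0" .
      then have "AE x in lborel. (cmod (L j x - line_image \<nu> \<rho> w j x))\<^sup>2 = 0" by eventually_elim simp
      then have "(LINT x|lborel. (cmod (L j x - line_image \<nu> \<rho> w j x))\<^sup>2) = 0"
        by (rule integral_eq_zero_AE)
      then show ?case by (simp add: L2_norm_def)
    qed
    then show ?thesis by (rule tendsto_eventually)
  qed
qed

end
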